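(* Let $p$ be a prime. For $v\in\mathbb{Z}^2_{\mathrm{prim}}$, the pairs of real and $p$-adic directions $$\left(\frac{v}{\|v\|},\,v\right)\in\mathbb{S}^1\times\mathbb{S}^1_p$$ become uniformly distributed in $\mathbb{S}^1\times\mathbb{S}^1_p$ with respect to $\mathrm{Leb}\times m_p$ as $\|v\|\to\infty$, meaning that for every arc $\Theta\subset\mathbb{S}^1$ and every $p$-adic arc $\Theta_p\subset\mathbb{S}^1_p$, $$\frac{\#\left\{v\in\mathbb{Z}^2_{\mathrm{prim}}:\ \left(\frac{v}{\|v\|},v\right)\in\Theta\times\Theta_p,\ \|v\|\le R\right\}}{\#\left\{v\in\mathbb{Z}^2_{\mathrm{prim}}:\ \|v\|\le R\right\}}\ \underset{R\to\infty}{\longrightarrow}\ \mathrm{Leb}(\Theta)\cdot m_p(\Theta_p).$$ Moreover, for every $\delta>0$, the absolute value of the difference between the left-hand ratio and its limit is $O\left(R^{-2\tau_p+\delta}\right)$ as $R\to\infty$, where $\tau_p=\frac1{28}$ (the implied constant may depend on $p,\Theta,\Theta_p,\delta$).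
   Context: $\mathbb{Z}^2_{\mathrm{prim}}$ is the set of pairs $(a,b)\in\mathbb{Z}^2$ with $\gcd(a,b)=1$, and $\|\cdot\|$ is the Euclidean norm on $\mathbb{R}^2$. $\mathbb{S}^1$ is the Euclidean unit circle in $\mathbb{R}^2$, and $\mathrm{Leb}$ is the Lebesgue (arc length) measure on $\mathbb{S}^1$ normalized to be a probability measure. The $p$-adic norm on $\mathbb{Q}_p^2$ is $\|(a,b)\|_p=\max\{|a|_p,|b|_p\}$, and $\mathbb{S}^1_p=\{v\in\mathbb{Q}_p^2:\|v\|_p=1\}$ is the $p$-adic unit circle. One has $\mathbb{Z}^2_{\mathrm{prim}}\subset\mathbb{S}^1_p$. A $p$-adic arc is a ball $\theta+p^N\mathbb{Z}_p^2$ with $\theta\in\mathbb{S}^1_p$ and $N>0$ an integer (such a ball is contained in $\mathbb{S}^1_p$). $\mu_p$ is the Haar measure on $\mathbb{Q}_p$ with $\mu_p(\mathbb{Z}_p)=1$, $\mu_p^2=\mu_p\times\mu_p$ on $\mathbb{Q}_p^2$, and $m_p=\mu_p^2|_{\mathbb{S}^1_p}/\mu_p^2(\mathbb{S}^1_p)$ is the restriction of $\mu_p^2$ to $\mathbb{S}^1_p$ normalized to a probability measure. *)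

theory Defs
  imports
    "HOL-Probability.Probability"
    "HOL-Library.Landau_Symbols"
    "HOL-Number_Theory.Cong"
begin


definition padic_abs :: "nat \<Rightarrow> rat \<Rightarrow> real" where
  "padic_abs p x = (if x = 0 then 0 else
     real p powi (int (multiplicity (int p) (snd (quotient_of x)))
                - int (multiplicity (int p) (fst (quotient_of x)))))"

context
  fixes p :: nat
  assumes p: "prime p"
begin

private lemma pint: "prime_elem (int p)" "\<not> is_unit (int p)"
  using p by (auto simp: prime_elem_iff_prime_abs)

lemma padic_abs_Fract:
  assumes "a \<noteq> 0" "b \<noteq> 0"
  shows "padic_abs p (of_int a / of_int b) =
     real p powi (int (multiplicity (int p) b) - int (multiplicity (int p) a))"
proof -
  obtain c d where q: "quotient_of (of_int a / of_int b) = (c, d)" by fastforce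
  have d: "d > 0" using quotient_of_denom_pos[OF q] .
  have e: "(of_int a / of_int b :: rat) = of_int c / of_int d" using quotient_of_div[OF q] .
  then have c: "c \<noteq> 0" using assms by auto
  have "(of_int (a * d) :: rat) = of_int (c * b)"
    using e d assms by (simp add: field_simps)
  then have "a * d = c * b" by (simp only: of_int_eq_iff)
  then have "multiplicity (int p) (a * d) = multiplicity (int p) (c * b)" by simp
  then have "multiplicity (int p) a + multiplicity (int p) d
      = multiplicity (int p) c + multiplicity (int p) b"
    using pint assms c d by (simp add: prime_elem_multiplicity_mult_distrib)
  then have "int (multiplicity (int p) d) - int (multiplicity (int p) c)
      = int (multiplicity (int p) b) - int (multiplicity (int p) a)" by linarith
  then show ?thesis unfolding padic_abs_def q using assms by simp
qed

private lemma rat_repr: "\<exists>a b. x = of_int a / of_int b \<and> b \<noteq> 0" for x :: rat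
proof -
  obtain c d where q: "quotient_of x = (c, d)" by fastforce
  show ?thesis using quotient_of_div[OF q] quotient_of_denom_pos[OF q] by force
qed

lemma padic_abs_0 [simp]: "padic_abs p 0 = 0"
  by (simp add: padic_abs_def)

lemma padic_abs_eq_0_iff [simp]: "padic_abs p x = 0 \<longleftrightarrow> x = 0"
  using p by (auto simp: padic_abs_def prime_gt_0_nat)

lemma padic_abs_nonneg [simp]: "padic_abs p x \<ge> 0"
  by (auto simp: padic_abs_def)

lemma padic_abs_1 [simp]: "padic_abs p 1 = 1"
  using padic_abs_Fract[of 1 1] by simp

lemma padic_abs_mult: "padic_abs p (x * y) = padic_abs p x * padic_abs p y"
proof (cases "x = 0 \<or> y = 0")
  case False
  obtain a b where x: "x = of_int a / of_int b" "b \<noteq> 0"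
    using rat_repr by blast
  obtain c d where y: "y = of_int c / of_int d" "d \<noteq> 0"
    using rat_repr by blast
  have ac: "a \<noteq> 0" "c \<noteq> 0" using False x y by auto
  have "x * y = of_int (a * c) / of_int (b * d)" using x y by simp
  then have "padic_abs p (x * y) =
      real p powi (int (multiplicity (int p) (b * d)) - int (multiplicity (int p) (a * c)))"
    using padic_abs_Fract[of "a * c" "b * d"] ac x y by simp
  also have "\<dots> = padic_abs p x * padic_abs p y"
  proof -
    have "real p \<noteq> 0" using prime_gt_0_nat[OF p] by simp
    moreover have "int (multiplicity (int p) (b * d)) - int (multiplicity (int p) (a * c))
      = (int (multiplicity (int p) b) - int (multiplicity (int p) a))
        + (int (multiplicity (int p) d) - int (multiplicity (int p) c))"
      using ac x(2) y(2) pint by (simp add: prime_elem_multiplicity_mult_distrib)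
    ultimately show ?thesis unfolding x(1) y(1) using padic_abs_Fract[OF ac(1) x(2)] padic_abs_Fract[OF ac(2) y(2)]
      by (simp add: power_int_add)
  qed
  finally show ?thesis .
qed auto

lemma padic_abs_of_int_le:
  assumes "int p ^ n dvd a" shows "padic_abs p (of_int a) \<le> real p powi (- int n)"
proof (cases "a = 0")
  case False
  then have "n \<le> multiplicity (int p) a"
    using assms pint by (simp add: power_dvd_iff_le_multiplicity)
  then show ?thesis using padic_abs_Fract[of a 1] False prime_ge_1_nat[OF p]
    by (auto intro!: power_int_increasing)
qed simp

lemma padic_abs_of_int_le_iff:
  "padic_abs p (of_int a) \<le> real p powi (- int n) \<longleftrightarrow> int p ^ n dvd a"
proof
  assume *: "padic_abs p (of_int a) \<le> real p powi (- int n)"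
  show "int p ^ n dvd a"
  proof (cases "a = 0")
    case False
    have "real p powi (- int (multiplicity (int p) a)) \<le> real p powi (- int n)"
      using * padic_abs_Fract[of a 1] False by simp
    then have "n \<le> multiplicity (int p) a"
      using prime_gt_1_nat[OF p]
        power_int_strict_increasing[of "- int n" "- int (multiplicity (int p) a)" "real p"]
      by (cases "n \<le> multiplicity (int p) a") auto
    then show ?thesis using pint False by (simp add: power_dvd_iff_le_multiplicity)
  qed simp
qed (rule padic_abs_of_int_le)

lemma padic_abs_add_le: "padic_abs p (x + y) \<le> max (padic_abs p x) (padic_abs p y)"
proof (cases "x = 0 \<or> y = 0 \<or> x + y = 0")
  case False
  obtain a b where x: "x = of_int a / of_int b" "b \<noteq> 0"
    using rat_repr by blast
  obtain c d where y: "y = of_int c / of_int d" "d \<noteq> 0"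
    using rat_repr by blast
  define A C D where "A = a * d" and "C = c * b" and "D = b * d"
  have *: "x = of_int A / of_int D" "y = of_int C / of_int D" "x + y = of_int (A + C) / of_int D"
    "D \<noteq> 0"
    using x y by (auto simp: A_def C_def D_def field_simps)
  then have nz: "A \<noteq> 0" "C \<noteq> 0" "A + C \<noteq> 0" using False by auto
  let ?m = "multiplicity (int p)"
  have "int p ^ min (?m A) (?m C) dvd A + C"
    by (intro dvd_add multiplicity_dvd') auto
  then have "min (?m A) (?m C) \<le> ?m (A + C)"
    using nz pint multiplicity_geI[of "A + C" "int p"] by blast
  moreover have "real p \<ge> 1" using prime_ge_1_nat[OF p] by simp
  ultimately have "real p powi (int (?m D) - int (?m (A + C)))
      \<le> real p powi (int (?m D) - int (min (?m A) (?m C)))"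
    by (intro power_int_increasing) auto
  then show ?thesis
    unfolding *(3) unfolding *(1,2)
    using padic_abs_Fract[OF nz(1) *(4)] padic_abs_Fract[OF nz(2) *(4)] padic_abs_Fract[OF nz(3) *(4)]
    by (auto simp: min_def split: if_splits)
qed (auto simp: le_max_iff_disj)

lemma padic_abs_minus [simp]: "padic_abs p (- x) = padic_abs p x"
proof -
  have "padic_abs p (-1) * padic_abs p (-1) = 1" using padic_abs_mult[of "-1" "-1"] by simp
  then have "(padic_abs p (-1) - 1) * (padic_abs p (-1) + 1) = 0" by (simp add: algebra_simps)
  moreover have "padic_abs p (-1) + 1 \<noteq> 0" using padic_abs_nonneg[of "-1"] by linarith
  ultimately have "padic_abs p (-1) = 1" by simp
  then show ?thesis using padic_abs_mult[of "-1" x] by simp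
qed

lemma padic_abs_diff_le: "padic_abs p (x - y) \<le> max (padic_abs p x) (padic_abs p y)"
  using padic_abs_add_le[of x "- y"] by simp

lemma padic_abs_add_le': "padic_abs p (x + y) \<le> padic_abs p x + padic_abs p y"
  using padic_abs_add_le[of x y] padic_abs_nonneg[of x] padic_abs_nonneg[of y] by linarith

lemma padic_abs_commute: "padic_abs p (x - y) = padic_abs p (y - x)"
  using padic_abs_minus[of "x - y"] by simp

lemma padic_abs_abs_diff: "\<bar>padic_abs p x - padic_abs p y\<bar> \<le> padic_abs p (x - y)"
  using padic_abs_add_le'[of "x - y" y] padic_abs_add_le'[of "y - x" x] padic_abs_commute[of x y]
  by auto

lemma padic_abs_inverse: "padic_abs p (inverse x) = inverse (padic_abs p x)"
proof (cases "x = 0")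
  case False
  then have "padic_abs p x * padic_abs p (inverse x) = 1" using padic_abs_mult[of x "inverse x"] by simp
  then show ?thesis using inverse_unique[of "padic_abs p x"] by simp
qed simp

end

definition padic_vanishes :: "nat \<Rightarrow> (nat \<Rightarrow> rat) \<Rightarrow> bool" where
  "padic_vanishes p X \<longleftrightarrow> (\<lambda>n. padic_abs p (X n)) \<longlonglongrightarrow> 0"

definition padic_cauchy :: "nat \<Rightarrow> (nat \<Rightarrow> rat) \<Rightarrow> bool" where
  "padic_cauchy p X \<longleftrightarrow> (\<forall>e>0. \<exists>N. \<forall>m\<ge>N. \<forall>n\<ge>N. padic_abs p (X m - X n) < e)"

definition padic_rel :: "nat \<Rightarrow> (nat \<Rightarrow> rat) \<Rightarrow> (nat \<Rightarrow> rat) \<Rightarrow> bool" where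
  "padic_rel p X Y \<longleftrightarrow> padic_cauchy p X \<and> padic_cauchy p Y \<and> padic_vanishes p (\<lambda>n. X n - Y n)"

context
  fixes p :: nat
  assumes p: "prime p"
begin

private lemmas [simp] = padic_abs_0[OF p] padic_abs_eq_0_iff[OF p] padic_abs_nonneg[OF p]
  padic_abs_minus[OF p] padic_abs_1[OF p] padic_abs_inverse[OF p]

lemma padic_vanishes_0 [simp]: "padic_vanishes p (\<lambda>n. 0)"
  by (simp add: padic_vanishes_def)

lemma padic_vanishes_const: "padic_vanishes p (\<lambda>n. c) \<longleftrightarrow> c = 0"
  using LIMSEQ_unique by (fastforce simp: padic_vanishes_def)

lemma padic_vanishes_le:
  assumes "padic_vanishes p X" "\<And>n. padic_abs p (Y n) \<le> C * padic_abs p (X n)"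
  shows "padic_vanishes p Y"
  unfolding padic_vanishes_def
proof (rule tendsto_sandwich[OF _ _ tendsto_const])
  show "(\<lambda>n. C * padic_abs p (X n)) \<longlonglongrightarrow> 0"
    using tendsto_mult_right_zero assms(1) unfolding padic_vanishes_def by blast
qed (use assms(2) in auto)

lemma padic_vanishes_minus: "padic_vanishes p X \<Longrightarrow> padic_vanishes p (\<lambda>n. - X n)"
  by (simp add: padic_vanishes_def)

lemma padic_vanishes_add:
  assumes "padic_vanishes p X" "padic_vanishes p Y"
  shows "padic_vanishes p (\<lambda>n. X n + Y n)"
  unfolding padic_vanishes_def
proof (rule tendsto_sandwich[OF _ _ tendsto_const])
  show "(\<lambda>n. padic_abs p (X n) + padic_abs p (Y n)) \<longlonglongrightarrow> 0"
    using assms tendsto_add[of _ 0 _ _ 0] unfolding padic_vanishes_def by fastforce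
qed (auto simp: padic_abs_add_le'[OF p])

lemma padic_vanishes_diff:
  "padic_vanishes p X \<Longrightarrow> padic_vanishes p Y \<Longrightarrow> padic_vanishes p (\<lambda>n. X n - Y n)"
  using padic_vanishes_add[OF _ padic_vanishes_minus] by fastforce

lemma padic_cauchy_const [simp]: "padic_cauchy p (\<lambda>n. c)"
  by (simp add: padic_cauchy_def)

lemma padic_cauchy_minus: "padic_cauchy p X \<Longrightarrow> padic_cauchy p (\<lambda>n. - X n)"
  unfolding padic_cauchy_def by (simp add: padic_abs_commute[OF p])

lemma padic_cauchy_add:
  assumes "padic_cauchy p X" "padic_cauchy p Y"
  shows "padic_cauchy p (\<lambda>n. X n + Y n)"
  unfolding padic_cauchy_def
proof safe
  fix e :: real assume "e > 0"
  then obtain N1 N2 where N: "\<And>m n. m \<ge> N1 \<Longrightarrow> n \<ge> N1 \<Longrightarrow> padic_abs p (X m - X n) < e"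
    "\<And>m n. m \<ge> N2 \<Longrightarrow> n \<ge> N2 \<Longrightarrow> padic_abs p (Y m - Y n) < e"
    using assms unfolding padic_cauchy_def by meson
  have "padic_abs p (X m + Y m - (X n + Y n)) < e" if "m \<ge> max N1 N2" "n \<ge> max N1 N2" for m n
    using N[of m n] that padic_abs_add_le[OF p, of "X m - X n" "Y m - Y n"]
    by (simp add: algebra_simps)
  then show "\<exists>N. \<forall>m\<ge>N. \<forall>n\<ge>N. padic_abs p (X m + Y m - (X n + Y n)) < e" by blast
qed

lemma padic_cauchy_bounded:
  assumes "padic_cauchy p X" shows "\<exists>b>0. \<forall>n. padic_abs p (X n) \<le> b"
proof -
  obtain N where N: "\<And>m n. m \<ge> N \<Longrightarrow> n \<ge> N \<Longrightarrow> padic_abs p (X m - X n) < 1"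
    using assms unfolding padic_cauchy_def by (meson zero_less_one)
  define b where "b = 1 + (\<Sum>i\<le>N. padic_abs p (X i))"
  have b: "padic_abs p (X i) \<le> b - 1" if "i \<le> N" for i
    using that member_le_sum[of i "{..N}" "\<lambda>i. padic_abs p (X i)"] by (simp add: b_def)
  have "padic_abs p (X n) \<le> b" for n
  proof (cases "n \<le> N")
    case False
    then have "padic_abs p (X n - X N) < 1" using N by simp
    then show ?thesis using b[of N] padic_abs_add_le'[OF p, of "X n - X N" "X N"] by simp
  qed (use b[of n] in auto)
  moreover have "b > 0" by (auto simp: b_def intro!: add_pos_nonneg sum_nonneg)
  ultimately show ?thesis by blast
qed

lemma padic_vanishes_mult:
  assumes "padic_vanishes p X" "padic_cauchy p Y"
  shows "padic_vanishes p (\<lambda>n. X n * Y n)" "padic_vanishes p (\<lambda>n. Y n * X n)"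
proof -
  obtain b where b: "b > 0" "\<And>n. padic_abs p (Y n) \<le> b" using padic_cauchy_bounded[OF assms(2)] by blast
  show "padic_vanishes p (\<lambda>n. X n * Y n)" "padic_vanishes p (\<lambda>n. Y n * X n)"
    by (rule padic_vanishes_le[OF assms(1), of _ b],
      use b in \<open>simp add: padic_abs_mult[OF p] mult_right_mono
        mult.commute[of "padic_abs p (X _)"]\<close>)+
qed

lemma padic_cauchy_mult:
  assumes "padic_cauchy p X" "padic_cauchy p Y"
  shows "padic_cauchy p (\<lambda>n. X n * Y n)"
  unfolding padic_cauchy_def
proof safe
  fix e :: real assume e: "e > 0"
  obtain a where a: "a > 0" "\<And>n. padic_abs p (X n) \<le> a" using padic_cauchy_bounded[OF assms(1)] by blast
  obtain b where b: "b > 0" "\<And>n. padic_abs p (Y n) \<le> b" using padic_cauchy_bounded[OF assms(2)] by blast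
  have "e / b > 0" "e / a > 0" using a b e by auto
  then obtain N1 N2 where N: "\<And>m n. m \<ge> N1 \<Longrightarrow> n \<ge> N1 \<Longrightarrow> padic_abs p (X m - X n) < e / b"
    "\<And>m n. m \<ge> N2 \<Longrightarrow> n \<ge> N2 \<Longrightarrow> padic_abs p (Y m - Y n) < e / a"
    using assms unfolding padic_cauchy_def by meson
  have "padic_abs p (X m * Y m - X n * Y n) < e" if "m \<ge> max N1 N2" "n \<ge> max N1 N2" for m n
  proof -
    have "X m * Y m - X n * Y n = X m * (Y m - Y n) + (X m - X n) * Y n" by (simp add: algebra_simps)
    then have "padic_abs p (X m * Y m - X n * Y n)
        \<le> max (padic_abs p (X m) * padic_abs p (Y m - Y n)) (padic_abs p (X m - X n) * padic_abs p (Y n))"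
      using padic_abs_add_le[OF p, of "X m * (Y m - Y n)" "(X m - X n) * Y n"]
      by (simp add: padic_abs_mult[OF p])
    also have "\<dots> < e"
    proof -
      have "padic_abs p (X m) * padic_abs p (Y m - Y n) \<le> a * padic_abs p (Y m - Y n)"
        using a by (simp add: mult_right_mono)
      also have "\<dots> < e" using N(2)[of m n] that a by (simp add: field_simps)
      finally have 1: "padic_abs p (X m) * padic_abs p (Y m - Y n) < e" .
      have "padic_abs p (X m - X n) * padic_abs p (Y n) \<le> padic_abs p (X m - X n) * b"
        using b by (simp add: mult_left_mono)
      also have "\<dots> < e" using N(1)[of m n] that b by (simp add: field_simps)
      finally show ?thesis using 1 by simp
    qed
    finally show ?thesis .
  qed
  then show "\<exists>N. \<forall>m\<ge>N. \<forall>n\<ge>N. padic_abs p (X m * Y m - X n * Y n) < e" by blast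
qed

lemma padic_cauchy_norm: "padic_cauchy p X \<Longrightarrow> convergent (\<lambda>n. padic_abs p (X n))"
proof (rule Cauchy_convergent, rule CauchyI)
  fix e :: real assume "padic_cauchy p X" "e > 0"
  then obtain N where "\<And>m n. m \<ge> N \<Longrightarrow> n \<ge> N \<Longrightarrow> padic_abs p (X m - X n) < e"
    unfolding padic_cauchy_def by metis
  then show "\<exists>M. \<forall>m\<ge>M. \<forall>n\<ge>M. norm (padic_abs p (X m) - padic_abs p (X n)) < e"
    using padic_abs_abs_diff[OF p] unfolding real_norm_def by (meson order_le_less_trans)
qed

lemma padic_cauchy_not_vanishes:
  assumes "padic_cauchy p X" "\<not> padic_vanishes p X"
  shows "\<exists>b>0. \<exists>k. \<forall>n\<ge>k. b < padic_abs p (X n)"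
proof -
  obtain l where l: "(\<lambda>n. padic_abs p (X n)) \<longlonglongrightarrow> l"
    using padic_cauchy_norm[OF assms(1)] unfolding convergent_def by blast
  then have "l \<ge> 0" by (auto intro: LIMSEQ_le_const)
  moreover have "l \<noteq> 0" using assms(2) l unfolding padic_vanishes_def by auto
  ultimately have "l > 0" by simp
  then have "eventually (\<lambda>n. padic_abs p (X n) > l / 2) sequentially"
    using order_tendstoD(1)[OF l, of "l / 2"] by simp
  then show ?thesis using \<open>l > 0\<close> unfolding eventually_sequentially
    by (intro exI[of _ "l / 2"]) auto
qed

lemma padic_vanishes_tail:
  assumes "padic_vanishes p X" "\<And>n. n \<ge> k \<Longrightarrow> padic_abs p (Y n) \<le> C * padic_abs p (X n)"
  shows "padic_vanishes p Y"
  unfolding padic_vanishes_def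
proof (rule tendsto_sandwich[OF _ _ tendsto_const])
  show "(\<lambda>n. C * padic_abs p (X n)) \<longlonglongrightarrow> 0"
    using tendsto_mult_right_zero assms(1) unfolding padic_vanishes_def by blast
  show "\<forall>\<^sub>F n in sequentially. padic_abs p (Y n) \<le> C * padic_abs p (X n)"
    using assms(2) unfolding eventually_sequentially by blast
qed auto

private lemma inv_diff:
  assumes "b < padic_abs p x" "c < padic_abs p y" "b > 0" "c > 0"
  shows "padic_abs p (inverse x - inverse y) \<le> inverse (b * c) * padic_abs p (x - y)"
proof -
  have nz: "x \<noteq> 0" "y \<noteq> 0" using assms by auto
  have "padic_abs p (inverse x - inverse y) = inverse (padic_abs p x) * padic_abs p (x - y) * inverse (padic_abs p y)"
    using nz by (simp add: inverse_diff_inverse padic_abs_mult[OF p])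
  also have "\<dots> \<le> inverse b * padic_abs p (x - y) * inverse c"
    using assms by (intro mult_mono le_imp_inverse_le) auto
  finally show ?thesis by (simp add: mult_ac)
qed

lemma padic_cauchy_inverse:
  assumes "padic_cauchy p X" "\<not> padic_vanishes p X"
  shows "padic_cauchy p (\<lambda>n. inverse (X n))"
  unfolding padic_cauchy_def
proof safe
  fix e :: real assume e: "e > 0"
  obtain b k where b: "b > 0" "\<And>n. n \<ge> k \<Longrightarrow> b < padic_abs p (X n)"
    using padic_cauchy_not_vanishes[OF assms] by blast
  have "e * (b * b) > 0" using e b by simp
  then obtain N where N: "\<And>m n. m \<ge> N \<Longrightarrow> n \<ge> N \<Longrightarrow> padic_abs p (X m - X n) < e * (b * b)"
    using assms(1) unfolding padic_cauchy_def by blast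
  have "padic_abs p (inverse (X m) - inverse (X n)) < e" if "m \<ge> max k N" "n \<ge> max k N" for m n
  proof -
    have "padic_abs p (inverse (X m) - inverse (X n)) \<le> inverse (b * b) * padic_abs p (X m - X n)"
      using inv_diff b that by simp
    also have "\<dots> < e" using N[of m n] that b by (simp add: field_simps)
    finally show ?thesis .
  qed
  then show "\<exists>N. \<forall>m\<ge>N. \<forall>n\<ge>N. padic_abs p (inverse (X m) - inverse (X n)) < e" by blast
qed

lemma padic_vanishes_diff_inverse:
  assumes "padic_cauchy p X" "\<not> padic_vanishes p X" "padic_cauchy p Y" "\<not> padic_vanishes p Y"
    and "padic_vanishes p (\<lambda>n. X n - Y n)"
  shows "padic_vanishes p (\<lambda>n. inverse (X n) - inverse (Y n))"
proof -
  obtain b k where b: "b > 0" "\<And>n. n \<ge> k \<Longrightarrow> b < padic_abs p (X n)"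
    using padic_cauchy_not_vanishes[OF assms(1,2)] by blast
  obtain c l where c: "c > 0" "\<And>n. n \<ge> l \<Longrightarrow> c < padic_abs p (Y n)"
    using padic_cauchy_not_vanishes[OF assms(3,4)] by blast
  show ?thesis
    by (rule padic_vanishes_tail[OF assms(5), of "max k l" _ "inverse (b * c)"])
      (rule inv_diff, use b c in auto)
qed

lemma padic_vanishes_cong:
  "padic_vanishes p (\<lambda>n. X n - Y n) \<Longrightarrow> padic_vanishes p X \<longleftrightarrow> padic_vanishes p Y"
  using padic_vanishes_add[of "\<lambda>n. X n - Y n" Y] padic_vanishes_diff[of X "\<lambda>n. X n - Y n"] by auto

lemma padic_rel_refl: "padic_cauchy p X \<Longrightarrow> padic_rel p X X"
  by (simp add: padic_rel_def)

lemma part_equivp_padic_rel: "part_equivp (padic_rel p)"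
proof (rule part_equivpI)
  show "\<exists>x. padic_rel p x x" using padic_rel_refl padic_cauchy_const by blast
  show "symp (padic_rel p)"
    by (rule sympI) (auto simp: padic_rel_def padic_vanishes_def padic_abs_commute[OF p])
  show "transp (padic_rel p)"
    unfolding padic_rel_def by (rule transpI) (force dest: padic_vanishes_add)
qed

lemma padic_rel_inverse:
  assumes "padic_rel p X Y"
  shows "padic_rel p (if padic_vanishes p X then (\<lambda>n. 0) else (\<lambda>n. inverse (X n)))
     (if padic_vanishes p Y then (\<lambda>n. 0) else (\<lambda>n. inverse (Y n)))"
  using assms padic_vanishes_cong[of X Y] padic_cauchy_inverse padic_vanishes_diff_inverse
  unfolding padic_rel_def by auto

lemma padic_rel_lim_abs:
  assumes "padic_rel p X Y"
  shows "lim (\<lambda>n. padic_abs p (X n)) = lim (\<lambda>n. padic_abs p (Y n))"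
proof -
  obtain l where l: "(\<lambda>n. padic_abs p (X n)) \<longlonglongrightarrow> l"
    using padic_cauchy_norm[of X] assms unfolding convergent_def padic_rel_def by blast
  have "(\<lambda>n. padic_abs p (X n) - padic_abs p (Y n)) \<longlonglongrightarrow> 0"
  proof (rule tendsto_0_le[where K = 1])
    show "(\<lambda>n. padic_abs p (X n - Y n)) \<longlonglongrightarrow> 0"
      using assms unfolding padic_rel_def padic_vanishes_def by simp
  qed (auto simp: padic_abs_abs_diff[OF p])
  from tendsto_diff[OF l this] have "(\<lambda>n. padic_abs p (Y n)) \<longlonglongrightarrow> l" by simp
  then show ?thesis using l by (simp add: limI)
qed

lemma padic_rel_mult:
  assumes "padic_rel p X X'" "padic_rel p Y Y'"
  shows "padic_rel p (\<lambda>n. X n * Y n) (\<lambda>n. X' n * Y' n)"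
proof -
  have "padic_vanishes p (\<lambda>n. X n * (Y n - Y' n) + (X n - X' n) * Y' n)"
    using assms unfolding padic_rel_def by (intro padic_vanishes_add padic_vanishes_mult) auto
  then show ?thesis using assms padic_cauchy_mult unfolding padic_rel_def by (simp add: algebra_simps)
qed

lemma padic_rel_add:
  assumes "padic_rel p X X'" "padic_rel p Y Y'"
  shows "padic_rel p (\<lambda>n. X n + Y n) (\<lambda>n. X' n + Y' n)"
  using padic_vanishes_add[of "\<lambda>n. X n - X' n" "\<lambda>n. Y n - Y' n"] assms padic_cauchy_add
  unfolding padic_rel_def by (simp add: algebra_simps)

lemma padic_rel_minus: "padic_rel p X X' \<Longrightarrow> padic_rel p (\<lambda>n. - X n) (\<lambda>n. - X' n)"
  using padic_vanishes_minus[of "\<lambda>n. X n - X' n"] padic_cauchy_minus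
  unfolding padic_rel_def by simp

lemma padic_rel_left_inverse:
  assumes "padic_cauchy p X" "\<not> padic_vanishes p X"
  shows "padic_rel p (\<lambda>n. inverse (X n) * X n) (\<lambda>n. 1)"
proof -
  obtain b k where b: "b > 0" "\<And>n. n \<ge> k \<Longrightarrow> b < padic_abs p (X n)"
    using padic_cauchy_not_vanishes[OF assms] by blast
  have "inverse (X n) * X n = 1" if "n \<ge> k" for n
    using b(1) b(2)[OF that] by (cases "X n = 0") auto
  then have "padic_vanishes p (\<lambda>n. inverse (X n) * X n - 1)"
    by (intro padic_vanishes_tail[OF padic_vanishes_0, of k]) auto
  then show ?thesis unfolding padic_rel_def using assms padic_cauchy_mult padic_cauchy_inverse by auto
qed

end

text \<open>
  The field of $p$-adic numbers is the set of Cauchy sequences of rationals for the $p$-adic absolute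
  value modulo null sequences. Since types cannot depend on terms, the prime $p$ is carried by a type
  parameter: it is the cardinality of the type argument.
\<close>

class prime_card =
  assumes prime_card: "prime CARD('a)"

instance bool :: prime_card
  by standard simp

typedef 'p padic_seq = "{X. padic_cauchy CARD('p::prime_card) X}"
  morphisms seq_nth Abs_padic_seq
  using padic_cauchy_const[OF prime_card] by blast

setup_lifting type_definition_padic_seq

lift_definition padic_equiv :: "'p::prime_card padic_seq \<Rightarrow> 'p padic_seq \<Rightarrow> bool"
  is "\<lambda>X Y. padic_vanishes CARD('p) (\<lambda>n. X n - Y n)" .

lift_definition seq_const :: "rat \<Rightarrow> 'p::prime_card padic_seq" is "\<lambda>c n. c"
  by (rule padic_cauchy_const[OF prime_card])

lift_definition seq_plus :: "'p::prime_card padic_seq \<Rightarrow> 'p padic_seq \<Rightarrow> 'p padic_seq"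
  is "\<lambda>X Y n. X n + Y n" by (rule padic_cauchy_add[OF prime_card])

lift_definition seq_uminus :: "'p::prime_card padic_seq \<Rightarrow> 'p padic_seq"
  is "\<lambda>X n. - X n" by (rule padic_cauchy_minus[OF prime_card])

lift_definition seq_times :: "'p::prime_card padic_seq \<Rightarrow> 'p padic_seq \<Rightarrow> 'p padic_seq"
  is "\<lambda>X Y n. X n * Y n" by (rule padic_cauchy_mult[OF prime_card])

lift_definition seq_inverse :: "'p::prime_card padic_seq \<Rightarrow> 'p padic_seq"
  is "\<lambda>X. if padic_vanishes CARD('p) X then (\<lambda>n. 0) else (\<lambda>n. inverse (X n))"
  by (auto intro: padic_cauchy_const[OF prime_card] padic_cauchy_inverse[OF prime_card])

lemma padic_equiv_iff:
  "padic_equiv X Y \<longleftrightarrow> padic_rel CARD('p) (seq_nth X) (seq_nth (Y :: 'p::prime_card padic_seq))"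
  using seq_nth[of X] seq_nth[of Y] by (simp add: padic_equiv.rep_eq padic_rel_def)

quotient_type 'p padic = "'p::prime_card padic_seq" / padic_equiv
proof (rule equivpI)
  note * = part_equivp_padic_rel[OF prime_card]
  show "symp (padic_equiv :: 'p padic_seq \<Rightarrow> _)"
    by (rule sympI, unfold padic_equiv_iff, rule part_equivp_symp[OF *])
  show "transp (padic_equiv :: 'p padic_seq \<Rightarrow> _)"
    by (rule transpI, unfold padic_equiv_iff, rule part_equivp_transp[OF *])
  show "reflp (padic_equiv :: 'p padic_seq \<Rightarrow> _)"
    by (rule reflpI) (simp add: padic_equiv.rep_eq padic_vanishes_0[OF prime_card])
qed

instantiation padic :: (prime_card) field
begin

lift_definition zero_padic :: "'a padic" is "seq_const 0" .

lift_definition one_padic :: "'a padic" is "seq_const 1" .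

lift_definition plus_padic :: "'a padic \<Rightarrow> 'a padic \<Rightarrow> 'a padic" is seq_plus
  unfolding padic_equiv_iff seq_plus.rep_eq by (rule padic_rel_add[OF prime_card])

lift_definition uminus_padic :: "'a padic \<Rightarrow> 'a padic" is seq_uminus
  unfolding padic_equiv_iff seq_uminus.rep_eq by (rule padic_rel_minus[OF prime_card])

lift_definition times_padic :: "'a padic \<Rightarrow> 'a padic \<Rightarrow> 'a padic" is seq_times
  unfolding padic_equiv_iff seq_times.rep_eq by (rule padic_rel_mult[OF prime_card])

lift_definition inverse_padic :: "'a padic \<Rightarrow> 'a padic" is seq_inverse
  unfolding padic_equiv_iff seq_inverse.rep_eq by (rule padic_rel_inverse[OF prime_card])

definition "x - y = x + - y" for x y :: "'a padic"

definition "x div y = x * inverse y" for x y :: "'a padic"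

instance
proof
  note [simp] = padic_vanishes_0[OF prime_card] padic_vanishes_const[OF prime_card]
  note reps = padic_equiv.rep_eq seq_const.rep_eq seq_plus.rep_eq seq_uminus.rep_eq
    seq_times.rep_eq seq_inverse.rep_eq
  fix a b c :: "'a padic"
  show "a + b = b + a"
    by transfer (simp add: reps ac_simps)
  show "(a + b) + c = a + (b + c)"
    by transfer (simp add: reps ac_simps)
  show "0 + a = a"
    by transfer (simp add: reps)
  show "- a + a = 0"
    by transfer (simp add: reps)
  show "a - b = a + - b"
    by (rule minus_padic_def)
  show "(a * b) * c = a * (b * c)"
    by transfer (simp add: reps ac_simps)
  show "a * b = b * a"
    by transfer (simp add: reps ac_simps)
  show "1 * a = a"
    by transfer (simp add: reps)
  show "(a + b) * c = a * c + b * c"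
    by transfer (simp add: reps distrib_right)
  show "(0::'a padic) \<noteq> 1"
    by transfer (simp add: reps)
  have left_inverse: "padic_equiv (seq_times (seq_inverse X) X) (seq_const 1)"
    if "\<not> padic_equiv X (seq_const 0)" for X :: "'a padic_seq"
    using padic_rel_left_inverse[OF prime_card[where 'a='a], of "seq_nth X"] that seq_nth[of X]
    by (simp add: reps padic_rel_def)
  show "a \<noteq> 0 \<Longrightarrow> inverse a * a = 1"
    by transfer (rule left_inverse)
  show "a div b = a * inverse b"
    by (rule divide_padic_def)
  show "inverse (0::'a padic) = 0"
    by transfer (simp add: reps)
qed

end

text \<open>
  The extension of the absolute value to the completion. It cannot be an instance of the overloaded
  norm, which the library reserves for real normed spaces.
\<close>

lift_definition padic_norm :: "'p::prime_card padic \<Rightarrow> real"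
  is "\<lambda>X. lim (\<lambda>n. padic_abs CARD('p) (seq_nth X n))"
  unfolding padic_equiv_iff by (rule padic_rel_lim_abs[OF prime_card])


lemma padic_cases:
  obtains X where "padic_cauchy CARD('p::prime_card) X" "(x :: 'p padic) = abs_padic (Abs_padic_seq X)"
  by (metis Quotient_abs_rep Quotient_padic mem_Collect_eq seq_nth seq_nth_inverse)

context
  fixes X :: "nat \<Rightarrow> rat" and x :: "'p::prime_card padic"
  assumes X: "padic_cauchy CARD('p) X" "x = abs_padic (Abs_padic_seq X)"
begin

lemma padic_abs_LIMSEQ: "(\<lambda>n. padic_abs CARD('p) (X n)) \<longlonglongrightarrow> padic_norm x"
  using padic_cauchy_norm[OF prime_card[where 'a='p] X(1)] X
  by (simp add: padic_norm.abs_eq Abs_padic_seq_inverse convergent_LIMSEQ_iff)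

end

definition padic_of_rat :: "rat \<Rightarrow> 'p::prime_card padic" where
  "padic_of_rat q = abs_padic (seq_const q)"

lemma padic_norm_of_rat: "padic_norm (padic_of_rat q :: 'p::prime_card padic) = padic_abs CARD('p) q"
  by (simp add: padic_of_rat_def padic_norm.abs_eq seq_const.rep_eq)

lemma padic_of_rat_0: "padic_of_rat 0 = 0"
  by (simp add: padic_of_rat_def zero_padic_def)

lemma padic_of_rat_1: "padic_of_rat 1 = 1"
  by (simp add: padic_of_rat_def one_padic_def)

lemma padic_of_rat_add: "padic_of_rat (q + r) = padic_of_rat q + (padic_of_rat r :: 'p::prime_card padic)"
proof -
  have "seq_const (q + r) = seq_plus (seq_const q) (seq_const r :: 'p padic_seq)" by transfer simp
  then show ?thesis by (simp add: padic_of_rat_def plus_padic.abs_eq)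
qed

lemma padic_of_rat_mult: "padic_of_rat (q * r) = padic_of_rat q * (padic_of_rat r :: 'p::prime_card padic)"
proof -
  have "seq_const (q * r) = seq_times (seq_const q) (seq_const r :: 'p padic_seq)" by transfer simp
  then show ?thesis by (simp add: padic_of_rat_def times_padic.abs_eq)
qed

lemma padic_of_rat_of_nat: "padic_of_rat (of_nat n) = of_nat n"
  by (induction n) (simp_all add: padic_of_rat_0 padic_of_rat_1 padic_of_rat_add)

lemma padic_norm_zero_iff: "padic_norm x = 0 \<longleftrightarrow> (x :: 'p::prime_card padic) = 0"
proof
  assume *: "padic_norm x = 0"
  obtain X where X: "padic_cauchy CARD('p) X" "x = abs_padic (Abs_padic_seq X)" by (rule padic_cases)
  have "(\<lambda>n. padic_abs CARD('p) (X n)) \<longlonglongrightarrow> 0" using padic_abs_LIMSEQ[OF X] * by simp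
  then have "padic_vanishes CARD('p) X" by (simp add: padic_vanishes_def)
  then show "x = 0" using X
    by (simp add: zero_padic_def padic.abs_eq_iff padic_equiv.rep_eq Abs_padic_seq_inverse seq_const.rep_eq)
qed (use padic_norm_of_rat[of 0, where 'p='p] in \<open>simp add: padic_of_rat_0 padic_abs_0 prime_card\<close>)

instance padic :: (prime_card) field_char_0
proof
  have *: "of_nat n = (0::'a padic) \<longleftrightarrow> n = 0" for n
    using padic_norm_zero_iff[of "padic_of_rat (of_nat n) :: 'a padic"] padic_abs_eq_0_iff[OF prime_card[where 'a='a]]
    by (simp only: padic_of_rat_of_nat[symmetric] padic_norm_of_rat of_nat_eq_0_iff)
  have "m = n" if "m \<le> n" "of_nat m = (of_nat n :: 'a padic)" for m n
    using *[of "n - m"] that by (simp add: of_nat_diff)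
  then show "inj (of_nat :: nat \<Rightarrow> 'a padic)"
    by (intro injI) (metis nat_le_linear)
qed

lemma padic_of_rat_uminus: "padic_of_rat (- q) = - padic_of_rat q"
  using padic_of_rat_add[of "- q" q] by (simp add: padic_of_rat_0 eq_neg_iff_add_eq_0)

lemma padic_of_rat_eq: "padic_of_rat q = (of_rat q :: 'p::prime_card padic)"
proof -
  obtain a b where q: "quotient_of q = (a, b)" by fastforce
  have b: "b > 0" using quotient_of_denom_pos[OF q] .
  have int: "padic_of_rat (of_int k) = (of_int k :: 'p padic)" for k
    by (cases k rule: int_cases2) (simp_all add: padic_of_rat_of_nat padic_of_rat_uminus)
  have "q * of_int b = of_int a" using quotient_of_div[OF q] b by simp
  then have "padic_of_rat q * of_int b = (of_int a :: 'p padic)"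
    using int padic_of_rat_mult by metis
  then show ?thesis unfolding quotient_of_div[OF q] using b by (simp add: of_rat_divide field_simps)
qed

lemma padic_norm_of_rat': "padic_norm (of_rat q :: 'p::prime_card padic) = padic_abs CARD('p) q"
  using padic_norm_of_rat[of q, where 'p='p] by (simp add: padic_of_rat_eq)

lemma padic_norm_of_int_le_iff:
  "padic_norm (of_int a :: 'p::prime_card padic) \<le> real CARD('p) powi (- int n) \<longleftrightarrow> int CARD('p) ^ n dvd a"
  using padic_abs_of_int_le_iff[OF prime_card[where 'a='p], of a n] padic_norm_of_rat'[of "of_int a", where 'p='p]
  by simp

lemma padic_norm_ge_0 [simp]: "padic_norm (x :: 'p::prime_card padic) \<ge> 0"
proof -
  obtain X where X: "padic_cauchy CARD('p) X" "x = abs_padic (Abs_padic_seq X)" by (rule padic_cases)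
  show ?thesis by (rule LIMSEQ_le_const[OF padic_abs_LIMSEQ[OF X]]) (simp add: padic_abs_nonneg prime_card)
qed

lemma padic_norm_mult: "padic_norm (x * y) = padic_norm x * padic_norm (y :: 'p::prime_card padic)"
proof -
  note p = prime_card[where 'a='p]
  obtain X where X: "padic_cauchy CARD('p) X" "x = abs_padic (Abs_padic_seq X)" by (rule padic_cases)
  obtain Y where Y: "padic_cauchy CARD('p) Y" "y = abs_padic (Abs_padic_seq Y)" by (rule padic_cases)
  have "seq_times (Abs_padic_seq X) (Abs_padic_seq Y) = (Abs_padic_seq (\<lambda>n. X n * Y n) :: 'p padic_seq)"
    using X Y padic_cauchy_mult[OF p X(1) Y(1)]
    by (simp add: seq_nth_inject[symmetric] seq_times.rep_eq Abs_padic_seq_inverse)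
  then have "x * y = abs_padic (Abs_padic_seq (\<lambda>n. X n * Y n))"
    using X Y by (simp add: times_padic.abs_eq)
  from padic_abs_LIMSEQ[OF padic_cauchy_mult[OF p X(1) Y(1)] this]
  show ?thesis using tendsto_mult[OF padic_abs_LIMSEQ[OF X] padic_abs_LIMSEQ[OF Y]]
    by (simp add: padic_abs_mult[OF p] LIMSEQ_unique)
qed

lemma padic_norm_add_le: "padic_norm (x + y) \<le> max (padic_norm x) (padic_norm (y :: 'p::prime_card padic))"
proof -
  note p = prime_card[where 'a='p]
  obtain X where X: "padic_cauchy CARD('p) X" "x = abs_padic (Abs_padic_seq X)" by (rule padic_cases)
  obtain Y where Y: "padic_cauchy CARD('p) Y" "y = abs_padic (Abs_padic_seq Y)" by (rule padic_cases)
  have "seq_plus (Abs_padic_seq X) (Abs_padic_seq Y) = (Abs_padic_seq (\<lambda>n. X n + Y n) :: 'p padic_seq)"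
    using X Y padic_cauchy_add[OF p X(1) Y(1)]
    by (simp add: seq_nth_inject[symmetric] seq_plus.rep_eq Abs_padic_seq_inverse)
  then have "x + y = abs_padic (Abs_padic_seq (\<lambda>n. X n + Y n))"
    using X Y by (simp add: plus_padic.abs_eq)
  from padic_abs_LIMSEQ[OF padic_cauchy_add[OF p X(1) Y(1)] this]
  show ?thesis
    by (rule LIMSEQ_le[OF _ tendsto_max[OF padic_abs_LIMSEQ[OF X] padic_abs_LIMSEQ[OF Y]]])
      (simp add: padic_abs_add_le[OF p])
qed

lemma padic_norm_0 [simp]: "padic_norm (0 :: 'p::prime_card padic) = 0"
  by (simp add: padic_norm_zero_iff)

lemma padic_norm_1 [simp]: "padic_norm (1 :: 'p::prime_card padic) = 1"
  using padic_norm_of_rat'[of 1, where 'p='p] by (simp add: padic_abs_1 prime_card)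

lemma padic_norm_minus [simp]: "padic_norm (- x :: 'p::prime_card padic) = padic_norm x"
  using padic_norm_mult[of "of_rat (-1)" x] padic_norm_of_rat'[of "-1", where 'p='p]
  by (simp add: padic_abs_1 padic_abs_minus prime_card)

lemma padic_norm_commute: "padic_norm (x - y) = padic_norm (y - x :: 'p::prime_card padic)"
  using padic_norm_minus[of "x - y"] by simp

lemma padic_norm_diff_le:
  "padic_norm (x - z) \<le> max (padic_norm (x - y)) (padic_norm (y - z :: 'p::prime_card padic))"
  using padic_norm_add_le[of "x - y" "y - z"] by simp

lemma padic_norm_close_iff:
  assumes "padic_norm (x - y :: 'p::prime_card padic) \<le> e"
  shows "padic_norm (x - a) \<le> e \<longleftrightarrow> padic_norm (y - a) \<le> e"
  using assms padic_norm_commute[of x y] order_trans[OF padic_norm_diff_le[of x a y], of e]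
    order_trans[OF padic_norm_diff_le[of y a x], of e] by auto

lemma padic_rat_dense:
  assumes "e > 0" shows "\<exists>q. padic_norm (x - of_rat q :: 'p::prime_card padic) < e"
proof -
  note p = prime_card[where 'a='p]
  obtain X where X: "padic_cauchy CARD('p) X" "x = abs_padic (Abs_padic_seq X)" by (rule padic_cases)
  have "e / 2 > 0" using assms by simp
  then obtain N where N: "\<And>m n. m \<ge> N \<Longrightarrow> n \<ge> N \<Longrightarrow> padic_abs CARD('p) (X m - X n) < e / 2"
    using X(1) unfolding padic_cauchy_def by blast
  let ?c = "- X N"
  have cau: "padic_cauchy CARD('p) (\<lambda>n. X n + ?c)"
    by (rule padic_cauchy_add[OF p X(1) padic_cauchy_const[OF p]])
  have "seq_plus (Abs_padic_seq X) (seq_const ?c) = (Abs_padic_seq (\<lambda>n. X n + ?c) :: 'p padic_seq)"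
    using X cau by (simp add: seq_nth_inject[symmetric] seq_plus.rep_eq seq_const.rep_eq Abs_padic_seq_inverse)
  then have "x - of_rat (X N) = abs_padic (Abs_padic_seq (\<lambda>n. X n + ?c))"
    using X plus_padic.abs_eq[of "Abs_padic_seq X" "seq_const ?c :: 'p padic_seq"]
      padic_of_rat_uminus[of "X N", where 'a='p]
    by (simp add: padic_of_rat_eq[symmetric] padic_of_rat_def)
  from padic_abs_LIMSEQ[OF cau this] have "padic_norm (x - of_rat (X N)) \<le> e / 2"
    by (rule LIMSEQ_le_const2) (use N in \<open>auto intro!: exI[of _ N] less_imp_le\<close>)
  then show ?thesis using assms by (intro exI[of _ "X N"]) simp
qed

instantiation padic :: (prime_card) metric_space
begin

definition "dist x y = padic_norm (x - y)" for x y :: "'a padic"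

definition "uniformity = (INF e\<in>{0<..}. principal {(x, y :: 'a padic). dist x y < e})"

definition "open U \<longleftrightarrow> (\<forall>x\<in>U. \<forall>\<^sub>F (x', y) in uniformity. x' = x \<longrightarrow> y \<in> U)" for U :: "'a padic set"

instance
proof
  fix x y z :: "'a padic"
  show "dist x y = 0 \<longleftrightarrow> x = y" by (simp add: dist_padic_def padic_norm_zero_iff)
  show "dist x y \<le> dist x z + dist y z"
    using padic_norm_diff_le[of x y z] padic_norm_commute[of y z]
      padic_norm_ge_0[of "x - z"] padic_norm_ge_0[of "y - z"]
    unfolding dist_padic_def by linarith
qed (simp_all only: uniformity_padic_def open_padic_def)

end

lemma mem_cball_padic: "y \<in> cball x e \<longleftrightarrow> padic_norm (y - x :: 'p::prime_card padic) \<le> e"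
  by (simp add: dist_padic_def padic_norm_commute[of y x])

lemma cball_padic_eq:
  assumes "y \<in> cball (x :: 'p::prime_card padic) e" shows "cball x e = cball y e"
  using assms padic_norm_diff_le[of _ x y] padic_norm_diff_le[of _ y x] padic_norm_commute[of x y]
  by (auto simp: mem_cball_padic simp del: mem_cball) (smt (verit))+

lemma prime_card_powi_less:
  assumes "e > 0" shows "\<exists>n. real CARD('p::prime_card) powi (- int n) < e"
proof -
  have "real CARD('p) > 1" using prime_gt_1_nat[OF prime_card[where 'a='p]] by simp
  then have "\<exists>n. (1 / real CARD('p)) ^ n < e" using assms by (intro real_arch_pow_inv) auto
  then show ?thesis by (simp add: power_int_minus power_one_over inverse_eq_divide)
qed

lemma prime_card_powi_pos [simp]: "real CARD('p::prime_card) powi k > 0"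
  using prime_gt_0_nat[OF prime_card[where 'a='p]] by (intro zero_less_power_int) simp

lemma padic_topological_basis:
  "topological_basis (range (\<lambda>(q, n). cball (of_rat q :: 'p::prime_card padic) (real CARD('p) powi (- int n))))"
proof (rule topological_basisI)
  fix A assume "A \<in> range (\<lambda>(q, n). cball (of_rat q :: 'p padic) (real CARD('p) powi (- int n)))"
  then obtain q n where A: "A = cball (of_rat q) (real CARD('p) powi (- int n))" by auto
  show "open A" unfolding open_contains_cball
    using cball_padic_eq unfolding A by (metis prime_card_powi_pos subset_refl)
next
  fix U and x :: "'p padic" assume "open U" "x \<in> U"
  then obtain e where e: "e > 0" "ball x e \<subseteq> U" by (meson openE)
  obtain n where n: "real CARD('p) powi (- int n) < e" using prime_card_powi_less[OF e(1)] by blast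
  obtain q where q: "padic_norm (x - of_rat q) < real CARD('p) powi (- int n)"
    using padic_rat_dense[of "real CARD('p) powi (- int n)" x] by auto
  then have "x \<in> cball (of_rat q) (real CARD('p) powi (- int n))" by (simp add: mem_cball_padic del: mem_cball)
  moreover from cball_padic_eq[OF this] have "cball (of_rat q) (real CARD('p) powi (- int n)) \<subseteq> U"
    using n e(2) by auto
  ultimately show "\<exists>B\<in>range (\<lambda>(q, n). cball (of_rat q :: 'p padic) (real CARD('p) powi (- int n))). x \<in> B \<and> B \<subseteq> U"
    by (intro bexI[of _ "cball (of_rat q) (real CARD('p) powi (- int n))"]) auto
qed

instance padic :: (prime_card) second_countable_topology
proof
  show "\<exists>B :: 'a padic set set. countable B \<and> open = generate_topology B"
    using topological_basis_imp_subbasis[OF padic_topological_basis[where 'p='a]]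
    by (intro exI[of _ "range (\<lambda>(q, n). cball (of_rat q :: 'a padic) (real CARD('a) powi (- int n)))"]) auto
qed


definition padic_integers :: "'p::prime_card padic set" where
  "padic_integers = {x. padic_norm x \<le> 1}"

text \<open>
  Haar measure on the additive group, normalised on the ring of integers. The definite description
  is justified by the lemmas \<open>ex_padic_haar\<close> and \<open>padic_haar_unique\<close> below.
\<close>

definition is_padic_haar :: "'p::prime_card padic measure \<Rightarrow> bool" where
  "is_padic_haar M \<longleftrightarrow> sets M = sets borel
     \<and> (\<forall>x. \<forall>A\<in>sets borel. emeasure M ((+) x ` A) = emeasure M A)
     \<and> emeasure M padic_integers = 1"

definition padic_haar :: "'p::prime_card padic measure" where
  "padic_haar = (THE M. is_padic_haar M)"

lemma padic_borel_eq:
  "(borel :: 'p::prime_card padic measure) = sigma UNIV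
     (range (\<lambda>(q, n). cball (of_rat q :: 'p padic) (real CARD('p) powi (- int n))))"
  by (rule borel_eq_countable_basis[OF _ padic_topological_basis]) auto

lemma padic_measure_eqI:
  fixes M N :: "'p::prime_card padic measure"
  assumes "sets M = sets borel" "sets N = sets borel"
    and M: "\<And>a n. emeasure M (cball a (real CARD('p) powi (- int n))) = ennreal (real CARD('p) powi (- int n))"
    and N: "\<And>a n. emeasure N (cball a (real CARD('p) powi (- int n))) = ennreal (real CARD('p) powi (- int n))"
  shows "M = N"
proof -
  let ?e = "\<lambda>n. real CARD('p) powi (- int n)"
  let ?B = "range (\<lambda>(q, n). cball (of_rat q :: 'p padic) (?e n))"
  let ?E = "insert {} ?B"
  let ?A = "\<lambda>i. cball (of_rat (from_nat i :: rat) :: 'p padic) 1"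
  have p1: "real CARD('p) \<ge> 1" using prime_ge_1_nat[OF prime_card[where 'a='p]] by simp
  have nested: "cball (of_rat q) (?e m) \<inter> cball (of_rat r) (?e n) \<in> ?E" if "m \<le> n" for q r :: rat and m n
  proof (cases "cball (of_rat q :: 'p padic) (?e m) \<inter> cball (of_rat r) (?e n) = {}")
    case False
    then obtain x where x: "x \<in> cball (of_rat q :: 'p padic) (?e m)" "x \<in> cball (of_rat r) (?e n)" by blast
    have "?e n \<le> ?e m" using that p1 by (intro power_int_increasing) auto
    then have "cball x (?e n) \<subseteq> cball x (?e m)" by (rule subset_cball)
    then have "cball (of_rat q :: 'p padic) (?e m) \<inter> cball (of_rat r) (?e n) = cball (of_rat r) (?e n)"
      using cball_padic_eq[OF x(1)] cball_padic_eq[OF x(2)] by auto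
    then show ?thesis by auto
  qed simp
  have st: "Int_stable ?E"
  proof (rule Int_stableI)
    fix a b assume "a \<in> ?E" "b \<in> ?E"
    then consider "a = {} \<or> b = {}" | q m r n where "a = cball (of_rat q) (?e m)" "b = cball (of_rat r) (?e n)"
      by fastforce
    then show "a \<inter> b \<in> ?E"
    proof cases
      case 2
      then show ?thesis using nested[of m n q r] nested[of n m r q] by (cases "m \<le> n") (auto simp: Int_commute)
    qed auto
  qed
  have gen: "sets (borel :: 'p padic measure) = sigma_sets UNIV ?E"
  proof -
    have "sigma_sets UNIV ?B = sigma_sets UNIV ?E"
      by (rule sigma_sets_eqI) (auto intro: sigma_sets.intros)
    then show ?thesis unfolding padic_borel_eq by simp
  qed
  show ?thesis
  proof (rule measure_eqI_generator_eq[OF st, where \<Omega> = UNIV and A = ?A])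
    show "emeasure M X = emeasure N X" if "X \<in> ?E" for X using that M N by auto
    have "?A i = (\<lambda>(q, n). cball (of_rat q :: 'p padic) (?e n)) (from_nat i, 0)" for i by simp
    then have "?A i \<in> ?B" for i by blast
    then show "range ?A \<subseteq> ?E" by blast
    show "(\<Union>i. ?A i) = UNIV"
    proof (intro set_eqI iffI UNIV_I)
      fix x :: "'p padic"
      obtain q where "padic_norm (x - of_rat q) < 1" using padic_rat_dense[of 1 x] by auto
      then have "x \<in> ?A (to_nat q)" by (simp add: mem_cball_padic del: mem_cball)
      then show "x \<in> (\<Union>i. ?A i)" by blast
    qed
    show "emeasure M (?A i) \<noteq> \<infinity>" for i using M[of "of_rat (from_nat i)" 0] by simp
  qed (use assms gen in auto)
qed

lemma padic_translation_measurable [measurable]: "(+) x \<in> borel \<rightarrow>\<^sub>M (borel :: 'p::prime_card padic measure)"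
  by (intro borel_measurable_continuous_onI) (auto simp: continuous_on_iff dist_padic_def)

lemma padic_integer_approx:
  assumes "padic_norm (x :: 'p::prime_card padic) \<le> 1"
  shows "\<exists>r<CARD('p) ^ n. padic_norm (x - of_nat r) \<le> real CARD('p) powi (- int n)"
proof -
  let ?p = "int CARD('p)" let ?e = "real CARD('p) powi (- int n)"
  note p = prime_card[where 'a='p]
  have p1: "real CARD('p) \<ge> 1" using prime_ge_1_nat[OF p] by simp
  have e1: "?e \<le> 1" using p1 power_int_increasing[of "- int n" 0 "real CARD('p)"] by simp
  obtain q where q: "padic_norm (x - of_rat q) < ?e"
    using padic_rat_dense[of ?e x] by auto
  have q1: "padic_norm (of_rat q :: 'p padic) \<le> 1"
    using padic_norm_diff_le[of 0 "of_rat q" x] q e1 assms padic_norm_commute[of x "of_rat q"]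
    by (smt (verit) add_0 diff_0 padic_norm_diff_le padic_norm_minus uminus_add_conv_diff diff_0_right)
  obtain a b where ab: "quotient_of q = (a, b)" by fastforce
  have b: "b > 0" using quotient_of_denom_pos[OF ab] .
  have q_eq: "q = of_int a / of_int b" using quotient_of_div[OF ab] .
  have "coprime a b" using quotient_of_coprime[OF ab] .
  have ndvd: "\<not> ?p dvd b"
  proof
    assume *: "?p dvd b"
    have "padic_norm (of_int b * of_rat q :: 'p padic) \<le> padic_norm (of_int b :: 'p padic)"
      using q1 mult_left_mono[OF q1, of "padic_norm (of_int b :: 'p padic)"] by (simp add: padic_norm_mult)
    also have "of_int b * of_rat q = (of_int a :: 'p padic)"
      unfolding q_eq using b by (simp add: of_rat_divide)
    also have "padic_norm (of_int b :: 'p padic) \<le> real CARD('p) powi (- int 1)"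
      using padic_norm_of_int_le_iff[of b 1, where 'p='p] * by simp
    finally have "?p dvd a" using padic_norm_of_int_le_iff[of a 1, where 'p='p] by simp
    then have "is_unit ?p" using * \<open>coprime a b\<close> by (meson coprime_common_divisor)
    then show False using p by auto
  qed
  have nb: "padic_norm (of_int b :: 'p padic) = 1"
    using padic_norm_of_rat'[of "of_int b", where 'p='p] padic_abs_Fract[OF p, of b 1] b ndvd
    by (simp add: not_dvd_imp_multiplicity_0)
  have "prime ?p" using p by simp
  then have "coprime ?p b" using ndvd by (rule prime_imp_coprime)
  then have "coprime b (?p ^ n)" by (simp add: coprime_commute)
  then obtain c where c: "[b * c = 1] (mod ?p ^ n)" using cong_solve_coprime_int by blast
  define r where "r = nat ((a * c) mod ?p ^ n)"
  have pn: "?p ^ n > 0" using prime_gt_0_nat[OF p] by simp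
  have r_int: "int r = (a * c) mod ?p ^ n" using pn by (simp add: r_def)
  have "int r < ?p ^ n" unfolding r_int using pn by simp
  then have r: "r < CARD('p) ^ n" by (simp flip: of_nat_power)
  have "[b * int r = b * (a * c)] (mod ?p ^ n)" unfolding r_int by (simp add: cong_def mod_mult_right_eq)
  also have "b * (a * c) = a * (b * c)" by simp
  also have "[a * (b * c) = a * 1] (mod ?p ^ n)" using c by (rule cong_scalar_left)
  finally have "?p ^ n dvd a - b * int r" by (simp add: cong_iff_dvd_diff dvd_diff_commute)
  then have "padic_norm (of_int (a - b * int r) :: 'p padic) \<le> ?e" using padic_norm_of_int_le_iff by blast
  also have "of_int (a - b * int r) = (of_int b * (of_rat q - of_nat r) :: 'p padic)"
    unfolding q_eq using b by (simp add: of_rat_divide algebra_simps)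
  finally have "padic_norm (of_rat q - of_nat r :: 'p padic) \<le> ?e" using nb by (simp add: padic_norm_mult)
  then have "padic_norm (x - of_nat r) \<le> ?e"
    using padic_norm_diff_le[of x "of_nat r" "of_rat q"] q by linarith
  then show ?thesis using r by blast
qed


lemma padic_haar_cball:
  assumes "is_padic_haar (M :: 'p::prime_card padic measure)"
  shows "emeasure M (cball a (real CARD('p) powi (- int n))) = ennreal (real CARD('p) powi (- int n))"
proof -
  let ?e = "real CARD('p) powi (- int n)"
  note p = prime_card[where 'a='p]
  have p0: "CARD('p) ^ n > 0" using prime_gt_0_nat[OF p] by simp
  have e1: "?e \<le> 1"
    using prime_ge_1_nat[OF p] power_int_increasing[of "- int n" 0 "real CARD('p)"] by simp
  have sM: "sets M = sets borel" using assms by (simp add: is_padic_haar_def)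
  have shift: "emeasure M (cball a ?e) = emeasure M (cball 0 ?e)" for a
  proof -
    have "cball a ?e = (+) a ` cball 0 ?e"
    proof (intro set_eqI iffI)
      fix y assume "y \<in> cball a ?e"
      then show "y \<in> (+) a ` cball 0 ?e"
        by (intro image_eqI[of _ _ "y - a"]) (auto simp: mem_cball_padic simp del: mem_cball)
    qed (auto simp: mem_cball_padic simp del: mem_cball)
    then show ?thesis using assms by (simp add: is_padic_haar_def)
  qed
  have "padic_integers = (\<Union>r<CARD('p) ^ n. cball (of_nat r :: 'p padic) ?e)" (is "_ = ?U")
  proof (intro equalityI subsetI)
    fix x :: "'p padic" assume "x \<in> padic_integers"
    then show "x \<in> ?U" using padic_integer_approx[of x n]
      by (auto simp: mem_cball_padic padic_integers_def simp del: mem_cball)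
  next
    fix x :: "'p padic" assume "x \<in> ?U"
    then obtain r where "padic_norm (x - of_nat r) \<le> ?e" by (auto simp: mem_cball_padic simp del: mem_cball)
    then show "x \<in> padic_integers"
      using padic_norm_add_le[of "x - of_nat r" "of_nat r"] e1 padic_norm_of_int_le_iff[of "int r" 0, where 'p='p]
      by (simp add: padic_integers_def)
  qed
  moreover have "disjoint_family_on (\<lambda>r. cball (of_nat r :: 'p padic) ?e) {..<CARD('p) ^ n}"
    unfolding disjoint_family_on_def
  proof (intro ballI impI)
    fix r s assume rs: "r \<in> {..<CARD('p) ^ n}" "s \<in> {..<CARD('p) ^ n}" "r \<noteq> s"
    show "cball (of_nat r :: 'p padic) ?e \<inter> cball (of_nat s) ?e = {}"
    proof (rule ccontr)
      assume "\<not> ?thesis"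
      then obtain x where "x \<in> cball (of_nat r :: 'p padic) ?e" "x \<in> cball (of_nat s) ?e" by blast
      then have "padic_norm (of_nat r - of_nat s :: 'p padic) \<le> ?e"
        using padic_norm_diff_le[of "of_nat r" "of_nat s" x] padic_norm_commute[of x "of_nat r"]
        by (simp add: mem_cball_padic del: mem_cball)
      then have "int CARD('p) ^ n dvd int r - int s"
        using padic_norm_of_int_le_iff[of "int r - int s" n, where 'p='p] by simp
      then have "[r = s] (mod CARD('p) ^ n)" by (simp add: cong_int_iff[symmetric] cong_iff_dvd_diff)
      then show False using rs by (simp add: cong_def)
    qed
  qed
  ultimately have "emeasure M padic_integers = (\<Sum>r<CARD('p) ^ n. emeasure M (cball (of_nat r :: 'p padic) ?e))"
    using sM by (subst sum_emeasure) auto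
  also have "\<dots> = of_nat (CARD('p) ^ n) * emeasure M (cball 0 ?e)"
    by (subst shift) simp
  finally have 1: "of_nat (CARD('p) ^ n) * emeasure M (cball 0 ?e) = 1"
    using assms by (simp add: is_padic_haar_def)
  have "of_nat (CARD('p) ^ n) * ennreal ?e = 1"
    using p0 by (simp add: power_int_minus ennreal_of_nat_eq_real_of_nat flip: ennreal_mult)
  then have "of_nat (CARD('p) ^ n) * emeasure M (cball 0 ?e) = of_nat (CARD('p) ^ n) * ennreal ?e"
    using 1 by simp
  moreover have "(of_nat (CARD('p) ^ n) :: ennreal) \<noteq> 0" "(of_nat (CARD('p) ^ n) :: ennreal) \<noteq> \<top>"
    using p0 by (auto simp del: of_nat_power)
  ultimately have "emeasure M (cball 0 ?e) = ennreal ?e" using p0 by (auto simp add: ennreal_mult_cancel_left simp del: of_nat_power)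
  then show ?thesis using shift by simp
qed


text \<open>
  For existence, the measure is transported from independent uniform digits: every element of the
  unit ball is a sum of digits times powers of $p$, and the field is a countable union of translates.
\<close>

definition padic_partial :: "nat \<Rightarrow> (nat \<Rightarrow> nat) \<Rightarrow> nat \<Rightarrow> nat" where
  "padic_partial p d n = (\<Sum>i<n. (d i mod p) * p ^ i)"

lemma padic_partial_less:
  assumes "p > 0" shows "padic_partial p d n < p ^ n"
proof (induction n)
  case (Suc n)
  have "d n mod p + 1 \<le> p" using assms by (simp add: Suc_leI)
  then have "(d n mod p + 1) * p ^ n \<le> p * p ^ n" by (rule mult_right_mono) simp
  then show ?case using Suc by (simp add: padic_partial_def)
qed (simp add: padic_partial_def)

lemma padic_partial_eq_iff:
  assumes "p > 0" "r < p ^ n"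
  shows "padic_partial p d n = r \<longleftrightarrow> (\<forall>i<n. d i mod p = r div p ^ i mod p)"
  using assms(2)
proof (induction n arbitrary: r)
  case (Suc n)
  have 1: "padic_partial p d (Suc n) = padic_partial p d n + p ^ n * (d n mod p)"
    by (simp add: padic_partial_def)
  have r: "r = r mod p ^ n + p ^ n * (r div p ^ n)" by simp
  have top: "r div p ^ n < p" using Suc.prems assms(1) by (simp add: less_mult_imp_div_less)
  have "padic_partial p d (Suc n) = r \<longleftrightarrow> padic_partial p d n = r mod p ^ n \<and> d n mod p = r div p ^ n"
  proof
    assume *: "padic_partial p d (Suc n) = r"
    show "padic_partial p d n = r mod p ^ n \<and> d n mod p = r div p ^ n"
      unfolding *[symmetric] 1 using padic_partial_less[OF assms(1), of d n] assms(1) by simp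
  next
    assume "padic_partial p d n = r mod p ^ n \<and> d n mod p = r div p ^ n"
    then show "padic_partial p d (Suc n) = r" unfolding 1 by simp
  qed
  also have "padic_partial p d n = r mod p ^ n \<longleftrightarrow> (\<forall>i<n. d i mod p = r mod p ^ n div p ^ i mod p)"
    using assms(1) by (intro Suc.IH) simp
  also have "\<dots> \<longleftrightarrow> (\<forall>i<n. d i mod p = r div p ^ i mod p)"
  proof -
    have "r mod p ^ n div p ^ i mod p = r div p ^ i mod p" if "i < n" for i
    proof -
      have n: "p ^ n = p ^ i * (p * p ^ (n - i - 1))"
        using that by (simp flip: power_add power_Suc)
      have "r mod p ^ n div p ^ i = r div p ^ i mod (p * p ^ (n - i - 1))"
        unfolding n by (simp add: mod_mult2_eq assms(1))
      then show ?thesis by (simp add: mod_mult2_eq)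
    qed
    then show ?thesis by auto
  qed
  finally show ?case using top by (auto simp: less_Suc_eq)
qed (simp add: padic_partial_def)

definition padic_digit_space :: "nat \<Rightarrow> (nat \<Rightarrow> nat) measure" where
  "padic_digit_space p = (\<Pi>\<^sub>M i\<in>UNIV. measure_pmf (pmf_of_set {..<p}))"

lemma padic_digit_space_partial:
  assumes "p > 0" "r < p ^ n"
  shows "{d. padic_partial p d n = r} \<in> sets (padic_digit_space p)"
    and "emeasure (padic_digit_space p) {d. padic_partial p d n = r} = ennreal (real p powi (- int n))"
proof -
  interpret product_prob_space "\<lambda>i::nat. measure_pmf (pmf_of_set {..<p})" UNIV
    by unfold_locales (simp add: measure_pmf.emeasure_space_1)
  let ?X = "\<lambda>i. {k. k mod p = r div p ^ i mod p}"
  have eq: "{d. padic_partial p d n = r} = {d\<in>space (padic_digit_space p). \<forall>i\<in>{..<n}. d i \<in> ?X i}"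
    using padic_partial_eq_iff[OF assms] by (auto simp: padic_digit_space_def space_PiM)
  show "{d. padic_partial p d n = r} \<in> sets (padic_digit_space p)"
    unfolding eq padic_digit_space_def by measurable
  have "emeasure (measure_pmf (pmf_of_set {..<p})) (?X i) = ennreal (1 / real p)" for i
  proof -
    have "{..<p} \<inter> ?X i = {r div p ^ i mod p}" using assms(1) by auto
    then show ?thesis using assms(1)
      by (subst emeasure_pmf_of_set) (auto simp: lessThan_empty_iff)
  qed
  then have "emeasure (padic_digit_space p) {d. padic_partial p d n = r} = (\<Prod>i<n. ennreal (1 / real p))"
    unfolding eq padic_digit_space_def by (subst emeasure_PiM_Collect) auto
  also have "\<dots> = ennreal (real p powi (- int n))"
    by (simp add: ennreal_power power_int_minus power_one_over inverse_eq_divide)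
  finally show "emeasure (padic_digit_space p) {d. padic_partial p d n = r} = ennreal (real p powi (- int n))" .
qed

definition padic_of_digits :: "(nat \<Rightarrow> nat) \<Rightarrow> 'p::prime_card padic" where
  "padic_of_digits d = abs_padic (Abs_padic_seq (\<lambda>n. of_nat (padic_partial CARD('p) d n)))"

lemma padic_partial_dvd:
  assumes "n \<le> m" shows "int p ^ n dvd int (padic_partial p d m) - int (padic_partial p d n)"
proof -
  have "{..<m} = {..<n} \<union> {n..<m}" using assms by auto
  then have "padic_partial p d m = padic_partial p d n + (\<Sum>i=n..<m. (d i mod p) * p ^ i)"
    unfolding padic_partial_def by (simp add: sum.union_disjoint ivl_disj_int)
  moreover have "p ^ n dvd (\<Sum>i=n..<m. (d i mod p) * p ^ i)"
    by (intro dvd_sum dvd_mult le_imp_power_dvd) auto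
  then have "int (p ^ n) dvd int (\<Sum>i=n..<m. (d i mod p) * p ^ i)" by (simp only: of_nat_dvd_iff)
  ultimately show ?thesis by (simp del: of_nat_sum)
qed

lemma padic_of_digits_approx:
  "padic_norm (padic_of_digits d - of_nat (padic_partial CARD('p) d n) :: 'p::prime_card padic)
     \<le> real CARD('p) powi (- int n)"
proof -
  note p = prime_card[where 'a='p]
  let ?s = "padic_partial CARD('p) d" let ?c = "- of_nat (?s n) :: rat"
  have le: "padic_abs CARD('p) (of_nat (?s m) - of_nat (?s k)) \<le> real CARD('p) powi (- int k)"
    if "k \<le> m" for m k
    using padic_abs_of_int_le[OF p padic_partial_dvd[OF that, of _ d]] by simp
  have cau: "padic_cauchy CARD('p) (\<lambda>n. of_nat (?s n))"
    unfolding padic_cauchy_def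
  proof safe
    fix e :: real assume "e > 0"
    then obtain N where N: "real CARD('p) powi (- int N) < e" using prime_card_powi_less by blast
    have "padic_abs CARD('p) (of_nat (?s m) - of_nat (?s k)) < e" if "m \<ge> N" "k \<ge> N" for m k
      using le[OF that(1)] le[OF that(2)] N
        padic_abs_diff_le[OF p, of "of_nat (?s m) - of_nat (?s N)" "of_nat (?s k) - of_nat (?s N)"] by simp
    then show "\<exists>N. \<forall>m\<ge>N. \<forall>k\<ge>N. padic_abs CARD('p) (of_nat (?s m) - of_nat (?s k)) < e" by blast
  qed
  have cau': "padic_cauchy CARD('p) (\<lambda>m. of_nat (?s m) + ?c)"
    by (rule padic_cauchy_add[OF p cau padic_cauchy_const[OF p]])
  have "seq_plus (Abs_padic_seq (\<lambda>n. of_nat (?s n))) (seq_const ?c)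
      = (Abs_padic_seq (\<lambda>m. of_nat (?s m) + ?c) :: 'p padic_seq)"
    using cau cau' by (simp add: seq_nth_inject[symmetric] seq_plus.rep_eq seq_const.rep_eq Abs_padic_seq_inverse)
  then have "(padic_of_digits d :: 'p padic) + padic_of_rat ?c = abs_padic (Abs_padic_seq (\<lambda>m. of_nat (?s m) + ?c))"
    unfolding padic_of_digits_def padic_of_rat_def
    using plus_padic.abs_eq[of "Abs_padic_seq (\<lambda>n. of_nat (?s n))" "seq_const ?c :: 'p padic_seq"]
    by simp
  from padic_abs_LIMSEQ[OF cau' this]
  have "padic_norm (padic_of_digits d + padic_of_rat ?c :: 'p padic) \<le> real CARD('p) powi (- int n)"
    by (rule LIMSEQ_le_const2) (use le in \<open>auto intro!: exI[of _ n]\<close>)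
  then show ?thesis by (simp add: padic_of_rat_uminus padic_of_rat_of_nat)
qed

lemma padic_of_digits_ball_iff:
  "padic_norm (padic_of_digits d - a :: 'p::prime_card padic) \<le> real CARD('p) powi (- int n)
   \<longleftrightarrow> padic_norm (of_nat (padic_partial CARD('p) d n) - a) \<le> real CARD('p) powi (- int n)"
  by (rule padic_norm_close_iff[OF padic_of_digits_approx])

lemma padic_of_digits_measurable:
  "(\<lambda>d. x + padic_of_digits d) \<in> padic_digit_space CARD('p) \<rightarrow>\<^sub>M (borel :: 'p::prime_card padic measure)"
  unfolding padic_borel_eq
proof (rule measurable_measure_of)
  let ?D = "padic_digit_space CARD('p)" let ?s = "padic_partial CARD('p)"
  have p0: "CARD('p) > 0" using prime_gt_0_nat[OF prime_card[where 'a='p]] .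
  have sp: "space ?D = UNIV" by (auto simp: padic_digit_space_def space_PiM)
  fix y assume "y \<in> range (\<lambda>(q, n). cball (of_rat q :: 'p padic) (real CARD('p) powi (- int n)))"
  then obtain q n where y: "y = cball (of_rat q) (real CARD('p) powi (- int n))" by auto
  let ?K = "{r. r < CARD('p) ^ n \<and> padic_norm (of_nat r - (of_rat q - x)) \<le> real CARD('p) powi (- int n)}"
  have "x + padic_of_digits d \<in> y \<longleftrightarrow> ?s d n \<in> ?K" for d
    using padic_of_digits_ball_iff[of d "of_rat q - x" n] padic_partial_less[OF p0, of d n]
    unfolding y mem_cball_padic by (simp add: algebra_simps)
  then have "(\<lambda>d. x + padic_of_digits d) -` y \<inter> space ?D = (\<Union>r\<in>?K. {d. ?s d n = r})"
    unfolding sp by blast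
  also have "\<dots> \<in> sets ?D"
    by (intro sets.finite_UN padic_digit_space_partial(1)[OF p0]) (auto intro: finite_subset[of _ "{..<CARD('p) ^ n}"])
  finally show "(\<lambda>d. x + padic_of_digits d) -` y \<inter> space ?D \<in> sets ?D" .
qed auto

definition padic_coset_rep :: "'p::prime_card padic \<Rightarrow> 'p padic" where
  "padic_coset_rep x = of_rat (SOME q. padic_norm (x - of_rat q) \<le> 1)"

lemma padic_coset_rep: "padic_norm (x - padic_coset_rep x) \<le> 1"
proof -
  obtain q where "padic_norm (x - of_rat q) < 1" using padic_rat_dense[of 1 x] by auto
  then have "padic_norm (x - of_rat q) \<le> 1" by simp
  then show ?thesis unfolding padic_coset_rep_def
    by (rule someI[where P = "\<lambda>q. padic_norm (x - of_rat q) \<le> 1"])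
qed

lemma padic_coset_rep_cong:
  assumes "padic_norm (x - y) \<le> 1" shows "padic_coset_rep x = padic_coset_rep y"
proof -
  have "padic_norm (x - of_rat q) \<le> 1 \<longleftrightarrow> padic_norm (y - of_rat q) \<le> 1" for q
    by (rule padic_norm_close_iff[OF assms])
  then show ?thesis by (simp add: padic_coset_rep_def)
qed

lemma ex_padic_haar: "\<exists>M :: 'p::prime_card padic measure. is_padic_haar M"
proof -
  note p = prime_card[where 'a='p]
  have p0: "CARD('p) > 0" using prime_gt_0_nat[OF p] .
  let ?C = "range padic_coset_rep :: 'p padic set" let ?D = "padic_digit_space CARD('p)"
  let ?T = "\<lambda>(c, d). c + padic_of_digits d :: 'p padic"
  let ?P = "count_space ?C \<Otimes>\<^sub>M ?D"
  interpret D: prob_space ?D unfolding padic_digit_space_def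
    by (rule prob_space_PiM) (rule measure_pmf.prob_space_axioms)
  have spD: "space ?D = UNIV" by (auto simp: padic_digit_space_def space_PiM)
  have "?C \<subseteq> range of_rat" by (auto simp: padic_coset_rep_def)
  then have C: "countable ?C" by (rule countable_subset) auto
  have T: "?T \<in> ?P \<rightarrow>\<^sub>M borel"
    by (rule measurable_pair_measure_countable1[OF C]) (simp add: padic_of_digits_measurable)
  define M where "M = distr ?P borel ?T"
  have sM: "sets M = sets borel" by (simp add: M_def)
  have M: "emeasure M (cball a (real CARD('p) powi (- int n))) = ennreal (real CARD('p) powi (- int n))" for a n
  proof -
    let ?e = "real CARD('p) powi (- int n)" and ?c = "padic_coset_rep a"
    have e1: "?e \<le> 1"
      using prime_ge_1_nat[OF p] power_int_increasing[of "- int n" 0 "real CARD('p)"] by simp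
    obtain r where r: "r < CARD('p) ^ n" "padic_norm (a - ?c - of_nat r) \<le> ?e"
      using padic_integer_approx[OF padic_coset_rep] by blast
    have "?T -` cball a ?e \<inter> space ?P = {?c} \<times> {d. padic_partial CARD('p) d n = r}" (is "?L = ?R")
    proof -
      have "c + padic_of_digits d \<in> cball a ?e \<longleftrightarrow> c = ?c \<and> padic_partial CARD('p) d n = r"
        if "c \<in> ?C" for c d
      proof -
        have 1: "c = ?c" if *: "c + padic_of_digits d \<in> cball a ?e"
        proof -
          have "padic_norm (padic_of_digits d :: 'p padic) \<le> 1"
            using padic_of_digits_approx[of d 0, where 'p='p] by (simp add: padic_partial_def)
          moreover have "padic_norm (c + padic_of_digits d - a) \<le> 1"
            using * e1 unfolding mem_cball_padic by linarith
          ultimately have "padic_norm (c - a) \<le> 1"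
            using padic_norm_diff_le[of c a "c + padic_of_digits d"] by simp
          then have *: "padic_coset_rep c = ?c" by (rule padic_coset_rep_cong)
          obtain y where y: "c = padic_coset_rep y" using \<open>c \<in> ?C\<close> by blast
          have "padic_coset_rep y = padic_coset_rep c"
            by (rule padic_coset_rep_cong) (simp only: y padic_coset_rep)
          then show ?thesis using * y by metis
        qed
        have "?c + padic_of_digits d \<in> cball a ?e
            \<longleftrightarrow> padic_norm (of_nat (padic_partial CARD('p) d n) - (a - ?c)) \<le> ?e"
          using padic_of_digits_ball_iff[of d "a - ?c" n] unfolding mem_cball_padic
          by (simp add: algebra_simps)
        also have "\<dots> \<longleftrightarrow> padic_norm (of_nat (padic_partial CARD('p) d n) - of_nat r :: 'p padic) \<le> ?e"
          using padic_norm_close_iff[OF r(2), of "of_nat (padic_partial CARD('p) d n)"]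
          by (simp only: padic_norm_commute[of "of_nat (padic_partial CARD('p) d n)"])
        also have "\<dots> \<longleftrightarrow> int CARD('p) ^ n dvd int (padic_partial CARD('p) d n) - int r"
          using padic_norm_of_int_le_iff[of "int (padic_partial CARD('p) d n) - int r" n, where 'p='p] by simp
        also have "\<dots> \<longleftrightarrow> [padic_partial CARD('p) d n = r] (mod CARD('p) ^ n)"
          by (simp add: cong_int_iff[symmetric] cong_iff_dvd_diff)
        also have "\<dots> \<longleftrightarrow> padic_partial CARD('p) d n = r"
          using r(1) padic_partial_less[OF p0, of d n] by (simp add: cong_def)
        finally show ?thesis using 1 by blast
      qed
      then show ?thesis by (auto simp: space_pair_measure spD simp del: mem_cball)
    qed
    moreover have "emeasure ?P ?R = ennreal ?e"
      using padic_digit_space_partial[OF p0 r(1)] by (simp add: D.emeasure_pair_measure_Times)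
    ultimately show ?thesis unfolding M_def by (subst emeasure_distr[OF T]) auto
  qed
  have "emeasure M ((+) x ` A) = emeasure M A" if A: "A \<in> sets borel" for x A
  proof -
    have sh: "(+) (- x) -` B \<inter> space M = (+) x ` B" for B
      using sets_eq_imp_space_eq[OF sM] by (force simp: image_iff)
    have "distr M borel ((+) (- x)) = M"
    proof (rule padic_measure_eqI)
      fix a n
      have "(+) (- x) -` cball a (real CARD('p) powi (- int n)) \<inter> space M
          = cball (x + a) (real CARD('p) powi (- int n))"
        using sets_eq_imp_space_eq[OF sM] by (auto simp: mem_cball_padic algebra_simps simp del: mem_cball)
      then show "emeasure (distr M borel ((+) (- x))) (cball a (real CARD('p) powi (- int n)))
          = ennreal (real CARD('p) powi (- int n))"
        using M sM by (subst emeasure_distr) (auto simp: measurable_cong_sets[OF sM refl])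
    qed (use M sM in auto)
    then have "emeasure M A = emeasure (distr M borel ((+) (- x))) A" by simp
    also have "\<dots> = emeasure M ((+) x ` A)"
      using A sM by (subst emeasure_distr) (auto simp: measurable_cong_sets[OF sM refl] sh)
    finally show ?thesis by simp
  qed
  moreover have "padic_integers = (cball 0 (real CARD('p) powi (- int 0)) :: 'p padic set)"
    by (auto simp: padic_integers_def mem_cball_padic simp del: mem_cball)
  ultimately have "is_padic_haar M" using sM M[of 0 0] by (simp add: is_padic_haar_def)
  then show ?thesis ..
qed

lemma padic_haar_unique:
  "is_padic_haar M \<Longrightarrow> is_padic_haar N \<Longrightarrow> M = (N :: 'p::prime_card padic measure)"
  by (rule padic_measure_eqI) (auto simp: padic_haar_cball is_padic_haar_def)

lemma is_padic_haar_padic_haar: "is_padic_haar (padic_haar :: 'p::prime_card padic measure)"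
proof -
  obtain M :: "'p padic measure" where M: "is_padic_haar M" using ex_padic_haar by blast
  have "padic_haar = M" unfolding padic_haar_def
    by (rule the_equality[where P = is_padic_haar, OF M]) (rule padic_haar_unique[OF _ M])
  then show ?thesis using M by simp
qed


definition padic_vec_norm :: "'p::prime_card padic \<times> 'p padic \<Rightarrow> real" where
  "padic_vec_norm v = max (padic_norm (fst v)) (padic_norm (snd v))"

definition padic_circle :: "('p::prime_card padic \<times> 'p padic) set" where
  "padic_circle = {v. padic_vec_norm v = 1}"

definition padic_arc :: "('p::prime_card padic \<times> 'p padic) set \<Rightarrow> bool" where
  "padic_arc A \<longleftrightarrow> (\<exists>\<theta>\<in>padic_circle. \<exists>N>0.
     A = {(fst \<theta> + of_nat CARD('p) ^ N * x, snd \<theta> + of_nat CARD('p) ^ N * y) | x y.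
            x \<in> padic_integers \<and> y \<in> padic_integers})"

definition padic_circle_measure :: "('p::prime_card padic \<times> 'p padic) measure" where
  "padic_circle_measure = uniform_measure (padic_haar \<Otimes>\<^sub>M padic_haar) padic_circle"

definition circle_point :: "real \<Rightarrow> real \<times> real" where
  "circle_point t = (cos t, sin t)"

text \<open>
  Arc length on the unit circle of the Euclidean plane, normalised to total mass one: the
  parametrisation of the circle by \<open>circle_point\<close> has unit speed.
\<close>

definition circle_measure :: "(real \<times> real) measure" where
  "circle_measure = distr (uniform_measure lborel {0..<2 * pi}) borel circle_point"

text \<open>
  Each endpoint may or may not belong to the arc; the full circle is allowed.
\<close>

definition circle_arc :: "(real \<times> real) set \<Rightarrow> bool" where
  "circle_arc A \<longleftrightarrow> (\<exists>a b I. a < b \<and> b \<le> a + 2 * pi \<and> {a<..<b} \<subseteq> I \<and> I \<subseteq> {a..b}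
     \<and> A = circle_point ` I)"

definition primitive_vectors :: "(int \<times> int) set" where
  "primitive_vectors = {v. gcd (fst v) (snd v) = 1}"

definition vec_of_int :: "int \<times> int \<Rightarrow> 'a::ring_1 \<times> 'a" where
  "vec_of_int v = (of_int (fst v), of_int (snd v))"

definition vec_length :: "int \<times> int \<Rightarrow> real" where
  "vec_length v = norm (vec_of_int v :: real \<times> real)"

definition direction_ratio ::
  "(real \<times> real) set \<Rightarrow> ('p::prime_card padic \<times> 'p padic) set \<Rightarrow> real \<Rightarrow> real" where
  "direction_ratio \<Theta> \<Theta>p R =
     real (card {v \<in> primitive_vectors.
       (vec_of_int v /\<^sub>R vec_length v, vec_of_int v) \<in> \<Theta> \<times> \<Theta>p \<and> vec_length v \<le> R})
     / real (card {v \<in> primitive_vectors. vec_length v \<le> R})"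

end

theory Submission
  imports Defs "HOL-Computational_Algebra.Squarefree"
begin

text \<open>
  A $p$-adic arc of radius $p^{-N}$ meets the integer vectors in a residue class modulo $q = p^N$, so
  the theorem counts primitive vectors in a circular sector and a fixed residue class. Without
  primitivity, counting along horizontal lines gives the area of the sector divided by $q^2$ up to
  $O(R)$. Moebius inversion over the common divisor $d$ replaces the class by its multiple by
  $d^{-1}$ modulo $q$ and only involves $d$ coprime to $q$, so the main term depends on the class
  and the sector only through the angle; the error is $O(R^{3/2})$. Summing over all admissible
  classes, with the full circle as sector, gives the denominator with the same density constant, which
  therefore cancels, and the ratio converges at rate $O(R^{-1/2})$, far better than $R^{-1/14}$.
\<close>

subsection \<open>Lattice points in sectors\<close>

text \<open>The bound \<open>C * \<rho>\<close> for one residue class holds only for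
  \<open>\<rho> \<ge> 1\<close>; applied at \<open>\<rho> / d\<close> it would give a harmonic sum
  together with a cut-off at \<open>d = \<rho>\<close>. It is therefore weakened to exponent 3/2,
  where it holds at every positive radius because sectors of radius below 1 are empty. The errors
  then sum over all \<open>d\<close> to a multiple of zeta(3/2), and the full Moebius series appears
  directly as a limit. The exponent 3/2 is a choice of convenience: convergence asks for more than
  1, and the claimed rate is met up to 27/14. Since each \<open>d\<close> produces its own residue
  class, every constant has to be uniform in the class. The density constant is never evaluated, but
  it must be positive to be divided out. Angles form half-open intervals of reals so that sectors
  split exactly; arcs with other endpoints differ from these by at most two primitive
  vectors.\<close>

lemma card_residues_interval:
  fixes u v :: real
  assumes "q > 0" "u \<le> v"
  shows "finite {x::int. [x = a] (mod int q) \<and> u < x \<and> x \<le> v}" (is "finite ?S")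
    and "\<bar>real (card {x::int. [x = a] (mod int q) \<and> u < x \<and> x \<le> v}) - (v - u) / q\<bar> \<le> 1"
proof -
  have q: "real q > 0" using assms by simp
  \<comment> \<open>Half-open intervals turn the count into a difference of two floors, hence an
    error of at most 1 for every class. The open lower end matches the excluded upper angle of a
    sector.\<close>
  have iff: "u < real_of_int (a + int q * j) \<and> real_of_int (a + int q * j) \<le> v
      \<longleftrightarrow> \<lfloor>(u - a) / q\<rfloor> < j \<and> j \<le> \<lfloor>(v - a) / q\<rfloor>" for j
    using q by (simp add: floor_less_iff le_floor_iff pos_divide_less_eq pos_le_divide_eq algebra_simps)
  have S: "?S = (\<lambda>j. a + int q * j) ` {\<lfloor>(u - a) / q\<rfloor><..\<lfloor>(v - a) / q\<rfloor>}" (is "_ = ?f ` ?J")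
  proof (intro set_eqI iffI)
    fix x assume x: "x \<in> ?S"
    then have "[a = x] (mod int q)" by (auto simp: cong_sym)
    then obtain j where "x = a + int q * j" by (auto simp: cong_iff_lin)
    with x iff[of j] have "j \<in> ?J" by simp
    then show "x \<in> ?f ` ?J" using \<open>x = a + int q * j\<close> by (rule rev_image_eqI)
  next
    fix x assume "x \<in> ?f ` ?J"
    then obtain j where "x = a + int q * j" "j \<in> ?J" by (rule imageE)
    then show "x \<in> ?S" using iff[of j] by (simp add: cong_def)
  qed
  show "finite ?S" unfolding S by simp
  have "inj_on ?f ?J" using assms by (auto simp: inj_on_def)
  then have "card ?S = nat (\<lfloor>(v - a) / q\<rfloor> - \<lfloor>(u - a) / q\<rfloor>)"
    unfolding S by (simp add: card_image)
  moreover have "\<lfloor>(v - a) / q\<rfloor> \<ge> \<lfloor>(u - a) / q\<rfloor>"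
    using assms by (intro floor_mono divide_right_mono) auto
  ultimately have "real (card ?S) = of_int \<lfloor>(v - a) / q\<rfloor> - of_int \<lfloor>(u - a) / q\<rfloor>"
    by simp
  moreover have "(v - u) / q = (v - a) / q - (u - a) / q" by (simp add: diff_divide_distrib)
  ultimately show "\<bar>real (card ?S) - (v - u) / q\<bar> \<le> 1"
    by linarith
qed

text \<open>Takes the place of integrating an antitone \<open>f\<close>: the two inequalities on
  increments of \<open>F\<close> are what an integral would provide. Left and right Riemann sums of
  step \<open>q\<close> differ by at most \<open>q\<close> times the first value, so the error is
  \<open>q * f 0\<close> wherever in the first step the samples start.\<close>

lemma sum_antimono_primitive_bounds:
  fixes f F :: "real \<Rightarrow> real" and q y :: real and K :: nat
  assumes low: "\<And>u v. 0 \<le> u \<Longrightarrow> u \<le> v \<Longrightarrow> (v - u) * f v \<le> F v - F u"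
    and up: "\<And>u v. 0 \<le> u \<Longrightarrow> u \<le> v \<Longrightarrow> F v - F u \<le> (v - u) * f u"
    and f0: "\<And>u. 0 \<le> u \<Longrightarrow> 0 \<le> f u" and q: "q > 0" and y: "0 \<le> y" "y \<le> q"
  shows "\<bar>(\<Sum>k<K. q * f (y + k * q)) - (F (y + K * q) - F 0)\<bar> \<le> q * f 0"
proof -
  \<comment> \<open>The additional term \<open>q * f (y + K * q)\<close> makes the upper bound
    telescope: by \<open>low\<close>, each new sample is charged to the interval ending
    there.\<close>
  have *: "F (y + K * q) - F y \<le> (\<Sum>k<K. q * f (y + k * q)) \<and>
     (\<Sum>k<K. q * f (y + k * q)) + q * f (y + K * q) \<le> F (y + K * q) - F y + q * f y" for K :: nat
  proof (induction K)
    case (Suc K)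
    have e: "y + real (Suc K) * q - (y + K * q) = q" by (simp add: algebra_simps)
    have "0 \<le> y + K * q" "y + K * q \<le> y + Suc K * q" using q y by (auto simp: algebra_simps)
    from low[OF this] up[OF this] Suc show ?case unfolding e by simp
  qed simp
  have 1: "F y - F 0 \<le> q * f 0"
    using up[of 0 y] mult_right_mono[OF y(2) f0[of 0]] y by simp
  have 2: "0 \<le> f (y + K * q)" using y q by (intro f0) auto
  have 3: "q * f y - (F y - F 0) \<le> q * f 0"
  proof -
    \<comment> \<open>Antitonicity is obtained by chaining \<open>low\<close> and \<open>up\<close>
      on the interval from 0 to \<open>y\<close> and cancelling its length.\<close>
    have "f y \<le> f 0" if "y > 0"
      using low[of 0 y] up[of 0 y] that by simp (metis mult_le_cancel_left_pos order_trans)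
    then have "f y \<le> f 0" using y by (cases "y = 0") auto
    moreover have "F y - F 0 \<ge> y * f y" using low[of 0 y] y by simp
    moreover have "y * f y \<ge> 0" using y f0[of y] by simp
    ultimately show ?thesis using q mult_left_mono[of "f y" "f 0" q] by linarith
  qed
  have 4: "0 \<le> q * f (y + K * q)" using 2 q by simp
  show ?thesis using *[of K] 1 3 4 by linarith
qed

text \<open>
  The horizontal slice at height $y$ of the sector of angle $\theta$ and radius $\rho$ has length
  \<open>f y\<close>; beyond height \<open>\<rho> * sin \<theta>\<close> both \<open>f\<close> and the increments of its primitive vanish.
\<close>

lemma sector_slice_primitive:
  fixes \<theta> \<rho> :: real
  assumes \<theta>: "0 < \<theta>" "\<theta> \<le> pi / 2" and \<rho>: "\<rho> > 0"
  defines "f \<equiv> \<lambda>y. max 0 (sqrt (\<rho>\<^sup>2 - y\<^sup>2) - y * (cos \<theta> / sin \<theta>))"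
  obtains F where "\<And>u v. 0 \<le> u \<Longrightarrow> u \<le> v \<Longrightarrow> (v - u) * f v \<le> F v - F u"
    "\<And>u v. 0 \<le> u \<Longrightarrow> u \<le> v \<Longrightarrow> F v - F u \<le> (v - u) * f u"
    "\<And>y. y \<ge> \<rho> \<Longrightarrow> F y - F 0 = \<theta> * \<rho>\<^sup>2 / 2"
proof -
  define c where "c = cos \<theta> / sin \<theta>"
  define Y where "Y = \<rho> * sin \<theta>"
  define g where "g y = sqrt (\<rho>\<^sup>2 - y\<^sup>2) - y * c" for y
  \<comment> \<open>Half of the first two summands is the textbook primitive of the circle's
    half-chord; \<open>y^2 * c / 2\<close> integrates the distance to the slanted ray.\<close>
  define G where "G y = (y * sqrt (\<rho>\<^sup>2 - y\<^sup>2) + \<rho>\<^sup>2 * arcsin (y / \<rho>) - y\<^sup>2 * c) / 2" for y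
  have s: "sin \<theta> > 0" using \<theta> by (intro sin_gt_zero) auto
  have co: "cos \<theta> \<ge> 0" using \<theta> by (intro cos_ge_zero) auto
  have c: "c \<ge> 0" using s co by (simp add: c_def)
  have Y: "0 < Y" "Y \<le> \<rho>" using s \<rho> by (auto simp: Y_def)
  have f: "f y = max 0 (g y)" for y by (simp add: f_def g_def c_def)
  have anti: "g v \<le> g u" if "0 \<le> u" "u \<le> v" for u v
    unfolding g_def using that c
    by (intro diff_mono real_sqrt_le_mono mult_right_mono diff_left_mono power_mono) auto
  have "\<rho>\<^sup>2 - Y\<^sup>2 = (\<rho> * cos \<theta>)\<^sup>2"
    by (simp add: Y_def power_mult_distrib cos_squared_eq algebra_simps)
  then have sqY: "sqrt (\<rho>\<^sup>2 - Y\<^sup>2) = \<rho> * cos \<theta>"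
    using \<rho> co by simp
  have gY: "g Y = 0"
    unfolding g_def sqY using s by (simp add: Y_def c_def)
  have deriv: "(G has_real_derivative g y) (at y)" if "0 < y" "y < \<rho>" for y
  proof -
    have pos: "\<rho>\<^sup>2 - y\<^sup>2 > 0" using that by (simp add: power_strict_mono)
    have y1: "-1 < y / \<rho>" "y / \<rho> < 1" using that by (auto simp: field_simps)
    have sq: "sqrt (1 - (y / \<rho>)\<^sup>2) = sqrt (\<rho>\<^sup>2 - y\<^sup>2) / \<rho>"
    proof -
      have "1 - (y / \<rho>)\<^sup>2 = (\<rho>\<^sup>2 - y\<^sup>2) / \<rho>\<^sup>2" using \<rho> by (simp add: field_simps)
      then show ?thesis using \<rho> by (simp add: real_sqrt_divide)
    qed
    define w where "w = sqrt (\<rho>\<^sup>2 - y\<^sup>2)"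
    have w: "w > 0" "w * w = \<rho>\<^sup>2 - y\<^sup>2" using pos by (auto simp: w_def)
    have d1: "((\<lambda>y. sqrt (\<rho>\<^sup>2 - y\<^sup>2)) has_real_derivative - y / w) (at y)"
    proof -
      have "((\<lambda>y. \<rho>\<^sup>2 - y\<^sup>2) has_real_derivative - 2 * y) (at y)"
        by (auto intro!: derivative_eq_intros)
      from DERIV_chain2[OF DERIV_real_sqrt[OF pos] this] show ?thesis
        unfolding w_def[symmetric] by (simp add: field_simps)
    qed
    have d2: "((\<lambda>y. arcsin (y / \<rho>)) has_real_derivative 1 / w) (at y)"
    proof -
      have "((\<lambda>y. y / \<rho>) has_real_derivative 1 / \<rho>) (at y)"
        using \<rho> by (auto intro!: derivative_eq_intros)
      from DERIV_chain2[OF DERIV_arcsin[OF y1] this] show ?thesis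
        unfolding sq w_def[symmetric] using \<rho> by (simp add: field_simps)
    qed
    have aux: "((\<lambda>y. (y * S y + \<rho>\<^sup>2 * A y - y\<^sup>2 * c) / 2) has_real_derivative
        (1 * S y + S' * y + \<rho>\<^sup>2 * A' - 2 * y * c) / 2) (at y)"
      if "(S has_real_derivative S') (at y)" "(A has_real_derivative A') (at y)" for S A S' A'
      by (auto intro!: derivative_eq_intros that)
    have "(G has_real_derivative (1 * w + (- y / w) * y + \<rho>\<^sup>2 * (1 / w) - 2 * y * c) / 2) (at y)"
      unfolding G_def w_def using aux[OF d1 d2] by (simp add: w_def)
    moreover have "\<rho>\<^sup>2 = w * w + y * y" using w by (simp add: power2_eq_square)
    then have "(1 * w + (- y / w) * y + \<rho>\<^sup>2 * (1 / w) - 2 * y * c) / 2 = g y"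
      unfolding g_def w_def[symmetric] using w(1) by (simp only:) (simp add: field_simps)
    ultimately show ?thesis by simp
  qed
  have cont: "continuous_on {0..Y} G"
    unfolding G_def using Y \<rho> by (intro continuous_intros) (auto simp: field_simps)
  \<comment> \<open>\<open>Y\<close> is the height at which the slanted ray meets the circle, so
    \<open>g\<close> vanishes there; freezing \<open>G\<close> at \<open>Y\<close> corresponds to
    truncating \<open>g\<close> at 0.\<close>
  define F where "F y = G (min y Y)" for y
  \<comment> \<open>For an angle of pi/2 the height \<open>Y\<close> equals \<open>\<rho>\<close>,
    where the square root has a vertical tangent, so the derivative is available only in the
    interior. Continuity lets the mean value theorem reach the endpoints, and antitonicity of
    \<open>g\<close> turns the intermediate value into both bounds.\<close>
  have mono_part: "(v - u) * g v \<le> G v - G u \<and> G v - G u \<le> (v - u) * g u"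
    if uv: "0 \<le> u" "u \<le> v" "v \<le> Y" for u v
  proof (cases "u = v")
    case False
    then have "u < v" using uv by simp
    moreover have "continuous_on {u..v} G" by (rule continuous_on_subset[OF cont]) (use uv in auto)
    moreover have "(G has_derivative (*) (g y)) (at y)" if "u < y" "y < v" for y
      using deriv[of y] that uv Y by (auto simp: has_field_derivative_def)
    ultimately obtain z where z: "u < z" "z < v" "G v - G u = g z * (v - u)"
      using mvt[of u v G "\<lambda>y. (*) (g y)"] by blast
    have "g v \<le> g z" "g z \<le> g u" using anti z uv by auto
    then show ?thesis using z uv by (auto simp: mult.commute mult_right_mono)
  qed simp
  have gpos: "g y \<ge> 0" if "0 \<le> y" "y \<le> Y" for y using anti[OF that] gY by simp
  have gneg: "g y \<le> 0" if "Y \<le> y" for y using anti[OF _ that] gY Y by simp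
  have fY: "f y = (if y \<le> Y then g y else 0)" if "y \<ge> 0" for y
    using gpos[of y] gneg[of y] that by (auto simp: f)
  show ?thesis
  proof
    fix u v :: real assume uv: "0 \<le> u" "u \<le> v"
    consider "v \<le> Y" | "u \<le> Y" "Y < v" | "Y < u" by linarith
    then have "(v - u) * f v \<le> F v - F u \<and> F v - F u \<le> (v - u) * f u"
    proof cases
      case 1 then show ?thesis using mono_part[OF uv 1] uv by (simp add: fY F_def min_def)
    next
      case 2
      have "(Y - u) * g Y \<le> G Y - G u \<and> G Y - G u \<le> (Y - u) * g u" using mono_part[of u Y] 2 uv by simp
      moreover have "(Y - u) * g u \<le> (v - u) * g u" using 2 gpos[of u] uv by (intro mult_right_mono) auto
      ultimately show ?thesis using 2 uv by (simp add: fY F_def min_def gY)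
    next
      case 3 then show ?thesis using uv Y by (simp add: fY F_def min_def)
    qed
    then show "(v - u) * f v \<le> F v - F u" "F v - F u \<le> (v - u) * f u" by auto
  next
    fix y assume "y \<ge> \<rho>"
    then have "min y Y = Y" "min 0 Y = 0" using Y by auto
    then have "F y - F 0 = G Y - G 0" by (simp add: F_def)
    also have "G 0 = 0" by (simp add: G_def)
    \<comment> \<open>At \<open>Y\<close> the square root term and the term in \<open>c\<close>
      cancel; the arcsine leaves the area of the sector.\<close>
    also have "G Y = \<theta> * \<rho>\<^sup>2 / 2"
    proof -
      have "Y / \<rho> = sin \<theta>" using \<rho> by (simp add: Y_def)
      moreover have "arcsin (sin \<theta>) = \<theta>" using \<theta> by (intro arcsin_sin) auto
      moreover have "Y\<^sup>2 * c = Y * (\<rho> * cos \<theta>)" using s by (simp add: Y_def c_def power2_eq_square)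
      ultimately show ?thesis unfolding G_def sqY by simp
    qed
    finally show "F y - F 0 = \<theta> * \<rho>\<^sup>2 / 2" by simp
  qed
qed

section \<open>Lattice points of a residue class in a sector of the first quadrant\<close>

text \<open>Letting \<open>t\<close> be any real number in \<open>J\<close> avoids choosing an
  argument function: sectors may cross any branch cut, and a quarter turn simply adds to
  \<open>t\<close>. Since \<open>r > 0\<close>, the origin lies in no cone.\<close>

definition angular_cone :: "real set \<Rightarrow> (int \<times> int) set" where
  "angular_cone J = {v. \<exists>r>0. \<exists>t\<in>J. of_int (fst v) = r * cos t \<and> of_int (snd v) = r * sin t}"

lemma angular_coneI:
  assumes "r > 0" "t \<in> J" "real_of_int (fst v) = r * cos t" "real_of_int (snd v) = r * sin t"
  shows "v \<in> angular_cone J"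
  using assms unfolding angular_cone_def by blast

lemma angular_coneE:
  assumes "v \<in> angular_cone J"
  obtains r t where "r > 0" "t \<in> J" "real_of_int (fst v) = r * cos t" "real_of_int (snd v) = r * sin t"
  using assms unfolding angular_cone_def by blast

text \<open>\<open>c\<close> is an arbitrary integer pair rather than a reduced representative, so
  negated or multiplied classes can be used as they stand.\<close>

definition lattice_sector :: "nat \<Rightarrow> int \<times> int \<Rightarrow> real set \<Rightarrow> real \<Rightarrow> (int \<times> int) set" where
  "lattice_sector q c J \<rho> = {v \<in> angular_cone J. [fst v = fst c] (mod int q) \<and> [snd v = snd c] (mod int q)
     \<and> vec_length v \<le> \<rho>}"

lemma vec_length_eq: "vec_length v = sqrt ((of_int (fst v))\<^sup>2 + (of_int (snd v))\<^sup>2)"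
  by (simp add: vec_length_def vec_of_int_def norm_Pair)

lemma vec_length_le_iff:
  assumes "\<rho> \<ge> 0"
  shows "vec_length v \<le> \<rho> \<longleftrightarrow> (of_int (fst v))\<^sup>2 + (of_int (snd v))\<^sup>2 \<le> \<rho>\<^sup>2"
proof -
  have "\<rho> = sqrt (\<rho>\<^sup>2)" using assms by simp
  then show ?thesis unfolding vec_length_eq using real_sqrt_le_iff by metis
qed

lemma finite_vec_length_le: "finite {v. vec_length v \<le> \<rho>}"
proof (rule finite_subset)
  have "\<bar>real_of_int (fst v)\<bar> \<le> vec_length v \<and> \<bar>real_of_int (snd v)\<bar> \<le> vec_length v" for v
    unfolding vec_length_eq by (simp add: real_sqrt_ge_abs1 real_sqrt_ge_abs2)
  then show "{v. vec_length v \<le> \<rho>} \<subseteq> {-\<lceil>\<rho>\<rceil>..\<lceil>\<rho>\<rceil>} \<times> {-\<lceil>\<rho>\<rceil>..\<lceil>\<rho>\<rceil>}"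
    by (clarsimp simp: abs_le_iff) (smt (verit) ceiling_le_iff le_of_int_ceiling of_int_le_iff of_int_minus fst_conv snd_conv)
qed auto

lemma finite_lattice_sector: "finite (lattice_sector q c J \<rho>)"
  by (rule finite_subset[OF _ finite_vec_length_le]) (auto simp: lattice_sector_def)

text \<open>For a vector of length \<open>r\<close> at angle \<open>t\<close>,
  \<open>x * sin \<theta> - y * cos \<theta>\<close> equals \<open>r * sin (\<theta> - t)\<close>,
  whose sign compares \<open>t\<close> with \<open>\<theta>\<close>. In the first quadrant the
  cotangent is nonnegative, so the inequality forces \<open>x > 0\<close> and
  \<open>arctan (y / x)\<close> serves as the angle.\<close>

lemma angular_cone_quadrant_iff:
  assumes \<theta>: "0 < \<theta>" "\<theta> \<le> pi / 2"
  shows "(x, y) \<in> angular_cone {0..<\<theta>} \<longleftrightarrow> 0 \<le> y \<and> real_of_int y * (cos \<theta> / sin \<theta>) < real_of_int x"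
proof -
  have s: "sin \<theta> > 0" using \<theta> by (intro sin_gt_zero) auto
  have co: "cos \<theta> \<ge> 0" using \<theta> by (intro cos_ge_zero) auto
  have iff: "real_of_int y * (cos \<theta> / sin \<theta>) < real_of_int x
      \<longleftrightarrow> x * sin \<theta> - y * cos \<theta> > 0"
    using s by (simp add: field_simps)
  show ?thesis
  proof (intro iffI conjI)
    assume "(x, y) \<in> angular_cone {0..<\<theta>}"
    then obtain r t where rt: "r > 0" "0 \<le> t" "t < \<theta>" "real_of_int x = r * cos t" "real_of_int y = r * sin t"
      by (auto simp: angular_cone_def)
    have "sin t \<ge> 0" using rt \<theta> by (intro sin_ge_zero) auto
    then have "real_of_int y \<ge> 0" unfolding rt(5) using rt(1) by simp
    then show "0 \<le> y" by simp
    have "x * sin \<theta> - y * cos \<theta> = r * sin (\<theta> - t)" using rt by (simp add: sin_diff algebra_simps)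
    moreover have "sin (\<theta> - t) > 0" using rt \<theta> by (intro sin_gt_zero) auto
    ultimately show "real_of_int y * (cos \<theta> / sin \<theta>) < real_of_int x" using rt(1) iff by simp
  next
    assume *: "0 \<le> y \<and> real_of_int y * (cos \<theta> / sin \<theta>) < real_of_int x"
    then have "0 \<le> real_of_int y * (cos \<theta> / sin \<theta>)" using s co by simp
    then have x: "real_of_int x > 0" using * by linarith
    define t r where "t = arctan (y / x)" and "r = sqrt ((of_int x)\<^sup>2 + (of_int y)\<^sup>2)"
    have r: "r > 0" using x by (simp add: r_def add_pos_nonneg)
    have sq: "sqrt (1 + (y / x)\<^sup>2) = r / x"
    proof -
      have "1 + (y / x)\<^sup>2 = ((of_int x)\<^sup>2 + (of_int y)\<^sup>2) / (of_int x)\<^sup>2" using x by (simp add: field_simps)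
      then show ?thesis using x by (simp add: r_def real_sqrt_divide)
    qed
    have xy: "real_of_int x = r * cos t" "real_of_int y = r * sin t"
      unfolding t_def cos_arctan sin_arctan sq using x r by (auto simp: field_simps)
    have t: "0 \<le> t" "t < pi / 2" using * x arctan_ubound[of "y / x"] by (auto simp: t_def)
    have "r * sin (\<theta> - t) > 0" using * iff xy by (simp add: sin_diff algebra_simps)
    then have "sin (\<theta> - t) > 0" using r by (simp add: zero_less_mult_iff)
    moreover have "sin (\<theta> - t) \<le> 0" if "t \<ge> \<theta>"
    proof -
      have "sin (t - \<theta>) \<ge> 0" using that t \<theta> by (intro sin_ge_zero) auto
      then show ?thesis using sin_minus[of "t - \<theta>"] by simp
    qed
    ultimately have "t < \<theta>" by force
    then show "(x, y) \<in> angular_cone {0..<\<theta>}" using r xy t by (intro angular_coneI[of r t]) auto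
  qed
qed

text \<open>Each row of the class contributes its slice length over \<open>q\<close> up to 1, and
  the slices form a Riemann sum of step \<open>q\<close> for the area. Row errors and Riemann error
  together give at most \<open>2 * \<rho> / q + 2\<close>, hence \<open>4 * \<rho>\<close>.\<close>

lemma card_lattice_sector_quadrant:
  assumes \<theta>: "0 < \<theta>" "\<theta> \<le> pi / 2" and q: "q > 0" and \<rho>: "\<rho> \<ge> 1"
  shows "\<bar>card (lattice_sector q c {0..<\<theta>} \<rho>) - \<theta> * \<rho>\<^sup>2 / (2 * (real q)\<^sup>2)\<bar> \<le> 4 * \<rho>"
proof -
  define f where "f = (\<lambda>y. max 0 (sqrt (\<rho>\<^sup>2 - y\<^sup>2) - y * (cos \<theta> / sin \<theta>)))"
  have \<rho>0: "\<rho> > 0" using \<rho> by simp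
  obtain F where F: "\<And>u v. 0 \<le> u \<Longrightarrow> u \<le> v \<Longrightarrow> (v - u) * f v \<le> F v - F u"
    "\<And>u v. 0 \<le> u \<Longrightarrow> u \<le> v \<Longrightarrow> F v - F u \<le> (v - u) * f u"
    "\<And>y. y \<ge> \<rho> \<Longrightarrow> F y - F 0 = \<theta> * \<rho>\<^sup>2 / 2"
    using sector_slice_primitive[OF \<theta> \<rho>0] unfolding f_def by metis
  \<comment> \<open>Enough rows that the one of index \<open>K\<close> lies above height
    \<open>\<rho>\<close> even if \<open>b = 0\<close>; the added 1 makes this strict.\<close>
  define K where "K = nat \<lceil>\<rho> / q\<rceil> + 1"
  define b where "b = snd c mod int q"
  define Y where "Y k = b + int k * int q" for k :: nat
  define u where "u k = real_of_int (Y k) * (cos \<theta> / sin \<theta>)" for k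
  \<comment> \<open>The real \<open>sqrt\<close> is odd, hence negative above height
    \<open>\<rho>\<close>; the maximum then makes the row empty, so that \<open>w k - u k\<close> is
    the value of \<open>f\<close> at every height.\<close>
  define w where "w k = max (u k) (sqrt (\<rho>\<^sup>2 - (real_of_int (Y k))\<^sup>2))" for k
  define T where "T k = {x::int. [x = fst c] (mod int q) \<and> u k < x \<and> x \<le> w k}" for k
  have s: "sin \<theta> > 0" using \<theta> by (intro sin_gt_zero) auto
  have co: "cos \<theta> \<ge> 0" using \<theta> by (intro cos_ge_zero) auto
  have b: "0 \<le> b" "b < int q" using q by (auto simp: b_def)
  have Y0: "Y k \<ge> 0" for k using b by (simp add: Y_def)
  have u0: "u k \<ge> 0" for k using s co Y0 by (simp add: u_def)
  have Kq: "real K \<ge> \<rho> / q + 1" unfolding K_def by linarith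
  have Kub: "real K \<le> \<rho> / q + 2" unfolding K_def using \<rho> by (simp add: ) linarith
  have Kq': "real_of_int b + real K * q > \<rho>"
  proof -
    have "real K * q \<ge> (\<rho> / q + 1) * q" using Kq by (intro mult_right_mono) auto
    also have "(\<rho> / q + 1) * q = \<rho> + q" using q by (simp add: field_simps)
    finally show ?thesis using q b by linarith
  qed
  have S: "lattice_sector q c {0..<\<theta>} \<rho> = (\<lambda>(k, x). (x, Y k)) ` (SIGMA k:{..<K}. T k)" (is "?S = ?R")
  proof (intro set_eqI iffI)
    fix v assume v: "v \<in> ?S"
    obtain x y where vxy: "v = (x, y)" by force
    have "(x, y) \<in> angular_cone {0..<\<theta>}" using v vxy by (auto simp: lattice_sector_def)
    then have xy: "0 \<le> y" "real_of_int y * (cos \<theta> / sin \<theta>) < x"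
      unfolding angular_cone_quadrant_iff[OF \<theta>] by auto
    have c: "[x = fst c] (mod int q)" "[y = snd c] (mod int q)" "(of_int x)\<^sup>2 + (of_int y)\<^sup>2 \<le> \<rho>\<^sup>2"
      using v vxy vec_length_le_iff[of \<rho> v] \<rho> by (auto simp: lattice_sector_def)
    have ymod: "y mod int q = b" using c(2) by (simp add: b_def cong_def)
    define k where "k = nat (y div int q)"
    have yk: "y = Y k" using ymod xy(1) q
      by (simp add: Y_def k_def pos_imp_zdiv_nonneg_iff) (metis add.commute div_mult_mod_eq)
    have "(real_of_int y)\<^sup>2 \<le> \<rho>\<^sup>2" using c(3) zero_le_power2[of "real_of_int x"] by linarith
    then have "real_of_int y \<le> \<rho>" using \<rho> by (simp add: power2_le_iff_abs_le)
    then have "real_of_int b + real k * q < b + real K * q" using Kq' yk by (simp add: Y_def b(1))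
    then have "k < K" using q by simp
    moreover have "x \<in> T k"
    proof -
      have "real_of_int x \<le> sqrt (\<rho>\<^sup>2 - (real_of_int y)\<^sup>2)" using c(3) by (intro real_le_rsqrt) auto
      then show ?thesis using xy c yk by (auto simp: T_def u_def w_def)
    qed
    ultimately show "v \<in> ?R" using vxy yk by force
  next
    fix v assume "v \<in> ?R"
    then obtain k x where k: "k < K" "x \<in> T k" "v = (x, Y k)" by auto
    have x: "u k < x" "x \<le> w k" "[x = fst c] (mod int q)" using k by (auto simp: T_def)
    have x0: "real_of_int x > 0" using x(1) u0[of k] by linarith
    have "real_of_int x \<le> sqrt (\<rho>\<^sup>2 - (real_of_int (Y k))\<^sup>2)" using x by (auto simp: w_def max_def split: if_splits)
    then have "sqrt ((real_of_int x)\<^sup>2) \<le> sqrt (\<rho>\<^sup>2 - (real_of_int (Y k))\<^sup>2)" using x0 by simp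
    then have "(real_of_int x)\<^sup>2 + (of_int (Y k))\<^sup>2 \<le> \<rho>\<^sup>2"
      unfolding real_sqrt_le_iff by simp
    moreover have "[Y k = snd c] (mod int q)" by (simp add: Y_def b_def cong_def)
    moreover have "(x, Y k) \<in> angular_cone {0..<\<theta>}" unfolding angular_cone_quadrant_iff[OF \<theta>]
      using x Y0 by (auto simp: u_def)
    ultimately show "v \<in> ?S" using k x vec_length_le_iff[of \<rho> v] \<rho> by (auto simp: lattice_sector_def)
  qed
  have finT: "finite (T k)" for k
    unfolding T_def by (rule card_residues_interval(1)[OF q]) (simp add: w_def)
  have cardT: "\<bar>real (card (T k)) - f (Y k) / q\<bar> \<le> 1" for k
  proof -
    have "w k - u k = f (Y k)" unfolding w_def u_def f_def by (auto simp: max_def)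
    then show ?thesis
      using card_residues_interval(2)[OF q, of "u k" "w k" "fst c"] by (simp add: T_def w_def)
  qed
  have "inj_on (\<lambda>(k, x). (x, Y k)) (SIGMA k:{..<K}. T k)" using q by (auto simp: inj_on_def Y_def)
  then have "card ?S = (\<Sum>k<K. card (T k))" unfolding S using finT by (simp add: card_image)
  then have "\<bar>card ?S - (\<Sum>k<K. f (Y k) / q)\<bar> = \<bar>\<Sum>k<K. (card (T k) - f (Y k) / q)\<bar>"
    by (simp add: sum_subtractf)
  also have "\<dots> \<le> (\<Sum>k<K. 1)"
    by (rule order_trans[OF sum_abs]) (rule sum_mono, rule cardT)
  also have "\<dots> = K" by simp
  finally have 1: "\<bar>card ?S - (\<Sum>k<K. f (Y k) / q)\<bar> \<le> K" .
  have "\<bar>(\<Sum>k<K. q * f (b + k * real q)) - (F (b + K * real q) - F 0)\<bar> \<le> q * f 0"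
    by (rule sum_antimono_primitive_bounds) (use F q b in \<open>auto simp: f_def\<close>)
  moreover have "F (b + K * real q) - F 0 = \<theta> * \<rho>\<^sup>2 / 2" using Kq' b by (intro F) auto
  moreover have "f 0 = \<rho>" using \<rho> by (simp add: f_def)
  ultimately have "\<bar>(\<Sum>k<K. q * f (Y k)) - \<theta> * \<rho>\<^sup>2 / 2\<bar> \<le> q * \<rho>" by (simp add: Y_def)
  then have "\<bar>(\<Sum>k<K. q * f (Y k)) - \<theta> * \<rho>\<^sup>2 / 2\<bar> / (real q)\<^sup>2 \<le> q * \<rho> / (real q)\<^sup>2"
    by (intro divide_right_mono) auto
  also have "\<bar>(\<Sum>k<K. q * f (Y k)) - \<theta> * \<rho>\<^sup>2 / 2\<bar> / (real q)\<^sup>2 =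
      \<bar>((\<Sum>k<K. q * f (Y k)) - \<theta> * \<rho>\<^sup>2 / 2) / (real q)\<^sup>2\<bar>" by (simp add: abs_divide)
  also have "((\<Sum>k<K. q * f (Y k)) - \<theta> * \<rho>\<^sup>2 / 2) / (real q)\<^sup>2 = (\<Sum>k<K. f (Y k) / q) - \<theta> * \<rho>\<^sup>2 / (2 * (real q)\<^sup>2)"
    using q by (simp add: diff_divide_distrib sum_divide_distrib power2_eq_square)
  also have "q * \<rho> / (real q)\<^sup>2 = \<rho> / q" using q by (simp add: power2_eq_square)
  finally have 2: "\<bar>(\<Sum>k<K. f (Y k) / q) - \<theta> * \<rho>\<^sup>2 / (2 * (real q)\<^sup>2)\<bar> \<le> \<rho> / q" .
  have "\<rho> / q \<le> \<rho>" using q \<rho> by (simp add: divide_le_eq)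
  then show ?thesis using 1 2 Kub \<rho> by linarith
qed


section \<open>Sectors in general position, by splitting and quarter turns\<close>

text \<open>Angles taken from the two pieces differ by an amount strictly between 0 and 2 pi, so
  they never give the same direction; this is where the total of at most one turn enters.\<close>

lemma lattice_sector_split:
  assumes "a \<le> b" "b \<le> d" "d \<le> a + 2 * pi"
  shows "card (lattice_sector q c {a..<d} \<rho>)
    = card (lattice_sector q c {a..<b} \<rho>) + card (lattice_sector q c {b..<d} \<rho>)"
proof -
  have "angular_cone {a..<b} \<inter> angular_cone {b..<d} = {}"
  proof (rule ccontr)
    assume "angular_cone {a..<b} \<inter> angular_cone {b..<d} \<noteq> {}"
    then obtain v where "v \<in> angular_cone {a..<b}" "v \<in> angular_cone {b..<d}" by blast
    then obtain r t r' t' where *: "r > 0" "a \<le> t" "t < b" "r' > 0" "b \<le> t'" "t' < d"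
      "of_int (fst v) = r * cos t" "of_int (snd v) = r * sin t"
      "of_int (fst v) = r' * cos t'" "of_int (snd v) = r' * sin t'"
      by (elim angular_coneE) auto
    have "(r * cos t)\<^sup>2 + (r * sin t)\<^sup>2 = (r' * cos t')\<^sup>2 + (r' * sin t')\<^sup>2" using * by simp
    then have "r\<^sup>2 * ((cos t)\<^sup>2 + (sin t)\<^sup>2) = r'\<^sup>2 * ((cos t')\<^sup>2 + (sin t')\<^sup>2)"
      by (simp only: power_mult_distrib distrib_left)
    then have "r = r'" using * by (simp add: power2_eq_iff_nonneg)
    then have "sin t' = sin t \<and> cos t' = cos t" using * by simp
    then obtain n where n: "t' = t + 2 * pi * of_int n" using sin_cos_eq_iff by blast
    have "0 < t' - t" "t' - t < 2 * pi" using * assms by auto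
    then have "0 < 2 * pi * of_int n" "2 * pi * of_int n < 2 * pi * 1" unfolding n by auto
    then have "0 < real_of_int n" "real_of_int n < 1"
      by (auto simp: zero_less_mult_iff)
    then show False by simp
  qed
  moreover have "angular_cone {a..<d} = angular_cone {a..<b} \<union> angular_cone {b..<d}"
    using assms by (fastforce simp: angular_cone_def)
  ultimately have "lattice_sector q c {a..<d} \<rho> = lattice_sector q c {a..<b} \<rho> \<union> lattice_sector q c {b..<d} \<rho>"
    "lattice_sector q c {a..<b} \<rho> \<inter> lattice_sector q c {b..<d} \<rho> = {}"
    by (auto simp: lattice_sector_def)
  then show ?thesis by (simp add: card_Un_disjoint finite_lattice_sector)
qed

text \<open>\<open>C\<close> may depend on \<open>q\<close>, \<open>a\<close> and \<open>b\<close>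
  but not on \<open>c\<close>: quarter turns permute the classes, and Moebius inversion meets a
  different class for each divisor.\<close>

definition sector_equidist :: "nat \<Rightarrow> real \<Rightarrow> real \<Rightarrow> bool" where
  "sector_equidist q a b \<longleftrightarrow> (\<exists>C. \<forall>c. \<forall>\<rho>\<ge>1.
     \<bar>card (lattice_sector q c {a..<b} \<rho>) - (b - a) * \<rho>\<^sup>2 / (2 * (real q)\<^sup>2)\<bar> \<le> C * \<rho>)"

lemma sector_equidist_refl: "sector_equidist q a a"
  unfolding sector_equidist_def
  by (rule exI[of _ 0]) (simp add: lattice_sector_def angular_cone_def)

lemma sector_equidist_join:
  assumes le: "a \<le> b" "b \<le> d" "d \<le> a + 2 * pi"
    and E: "sector_equidist q a b" "sector_equidist q b d"
  shows "sector_equidist q a d"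
proof -
  obtain C1 C2 where C:
    "\<And>c \<rho>. \<rho> \<ge> 1 \<Longrightarrow> \<bar>card (lattice_sector q c {a..<b} \<rho>) - (b - a) * \<rho>\<^sup>2 / (2 * (real q)\<^sup>2)\<bar> \<le> C1 * \<rho>"
    "\<And>c \<rho>. \<rho> \<ge> 1 \<Longrightarrow> \<bar>card (lattice_sector q c {b..<d} \<rho>) - (d - b) * \<rho>\<^sup>2 / (2 * (real q)\<^sup>2)\<bar> \<le> C2 * \<rho>"
    using E unfolding sector_equidist_def by meson
  show ?thesis unfolding sector_equidist_def
  proof (intro exI[of _ "C1 + C2"] allI impI)
    fix c \<rho> assume \<rho>: "(1::real) \<le> \<rho>"
    have "(d - a) * \<rho>\<^sup>2 / (2 * (real q)\<^sup>2) = (b - a) * \<rho>\<^sup>2 / (2 * (real q)\<^sup>2) + (d - b) * \<rho>\<^sup>2 / (2 * (real q)\<^sup>2)"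
      by (simp add: add_divide_distrib[symmetric] algebra_simps)
    then show "\<bar>card (lattice_sector q c {a..<d} \<rho>) - (d - a) * \<rho>\<^sup>2 / (2 * (real q)\<^sup>2)\<bar> \<le> (C1 + C2) * \<rho>"
      using C[OF \<rho>, of c] unfolding lattice_sector_split[OF le] distrib_right by simp
  qed
qed

text \<open>Counts and main terms are both additive in the angle, so a known initial piece can be
  removed. This reaches sectors inside a quadrant whose lower side is not on an axis.\<close>

lemma sector_equidist_diff:
  assumes le: "a \<le> b" "b \<le> d" "d \<le> a + 2 * pi"
    and E: "sector_equidist q a b" "sector_equidist q a d"
  shows "sector_equidist q b d"
proof -
  obtain C1 C2 where C:
    "\<And>c \<rho>. \<rho> \<ge> 1 \<Longrightarrow> \<bar>card (lattice_sector q c {a..<b} \<rho>) - (b - a) * \<rho>\<^sup>2 / (2 * (real q)\<^sup>2)\<bar> \<le> C1 * \<rho>"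
    "\<And>c \<rho>. \<rho> \<ge> 1 \<Longrightarrow> \<bar>card (lattice_sector q c {a..<d} \<rho>) - (d - a) * \<rho>\<^sup>2 / (2 * (real q)\<^sup>2)\<bar> \<le> C2 * \<rho>"
    using E unfolding sector_equidist_def by meson
  show ?thesis unfolding sector_equidist_def
  proof (intro exI[of _ "C1 + C2"] allI impI)
    fix c \<rho> assume \<rho>: "(1::real) \<le> \<rho>"
    have "(d - a) * \<rho>\<^sup>2 / (2 * (real q)\<^sup>2) = (b - a) * \<rho>\<^sup>2 / (2 * (real q)\<^sup>2) + (d - b) * \<rho>\<^sup>2 / (2 * (real q)\<^sup>2)"
      by (simp add: add_divide_distrib[symmetric] algebra_simps)
    then show "\<bar>card (lattice_sector q c {b..<d} \<rho>) - (d - b) * \<rho>\<^sup>2 / (2 * (real q)\<^sup>2)\<bar> \<le> (C1 + C2) * \<rho>"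
      using C[OF \<rho>, of c] unfolding lattice_sector_split[OF le] distrib_right by simp
  qed
qed

text \<open>A quarter turn is a symmetry of the integer lattice: it preserves lengths and carries
  residue classes to residue classes, which a general rotation does not.\<close>

lemma card_lattice_sector_rotate:
  "card (lattice_sector q c {a + pi / 2..<b + pi / 2} \<rho>) = card (lattice_sector q (snd c, - fst c) {a..<b} \<rho>)"
proof -
  have angular_cone: "(- y, x) \<in> angular_cone {a + pi / 2..<b + pi / 2} \<longleftrightarrow> (x, y) \<in> angular_cone {a..<b}" for x y
  proof
    assume "(- y, x) \<in> angular_cone {a + pi / 2..<b + pi / 2}"
    then obtain r t where rt: "r > 0" "a + pi / 2 \<le> t" "t < b + pi / 2"
      "- of_int y = r * cos t" "of_int x = r * sin t" by (auto simp: angular_cone_def)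
    have "cos (t - pi / 2) = sin t" "sin (t - pi / 2) = - cos t" by (simp_all add: cos_diff sin_diff)
    moreover have "t - pi / 2 \<in> {a..<b}" using rt by auto
    ultimately show "(x, y) \<in> angular_cone {a..<b}" using rt by (intro angular_coneI[of r "t - pi / 2"]) auto
  next
    assume "(x, y) \<in> angular_cone {a..<b}"
    then obtain r t where rt: "r > 0" "a \<le> t" "t < b"
      "of_int x = r * cos t" "of_int y = r * sin t" by (auto simp: angular_cone_def)
    have "cos (t + pi / 2) = - sin t" "sin (t + pi / 2) = cos t" by (simp_all add: cos_add sin_add)
    moreover have "t + pi / 2 \<in> {a + pi / 2..<b + pi / 2}" using rt by auto
    ultimately show "(- y, x) \<in> angular_cone {a + pi / 2..<b + pi / 2}"
      using rt by (intro angular_coneI[of r "t + pi / 2"]) auto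
  qed
  have "bij_betw (\<lambda>v. (- snd v, fst v)) (lattice_sector q (snd c, - fst c) {a..<b} \<rho>)
    (lattice_sector q c {a + pi / 2..<b + pi / 2} \<rho>)"
  proof (rule bij_betw_byWitness[where f' = "\<lambda>v. (snd v, - fst v)"])
    have neg: "[- x = y] (mod int q) \<longleftrightarrow> [x = - y] (mod int q)" for x y
      using cong_minus_minus_iff[of x "- y" "int q"] by simp
    show "(\<lambda>v. (- snd v, fst v)) ` lattice_sector q (snd c, - fst c) {a..<b} \<rho>
        \<subseteq> lattice_sector q c {a + pi / 2..<b + pi / 2} \<rho>"
      by (auto simp: lattice_sector_def angular_cone vec_length_eq neg add.commute)
    show "(\<lambda>v. (snd v, - fst v)) ` lattice_sector q c {a + pi / 2..<b + pi / 2} \<rho>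
        \<subseteq> lattice_sector q (snd c, - fst c) {a..<b} \<rho>"
      by (auto simp: lattice_sector_def angular_cone[symmetric] vec_length_eq neg add.commute)
  qed auto
  then show ?thesis by (simp add: bij_betw_same_card)
qed

lemma sector_equidist_shift: "sector_equidist q (a + pi / 2) (b + pi / 2) \<longleftrightarrow> sector_equidist q a b"
proof -
  \<comment> \<open>The quarter turn is a bijection on pairs \<open>c\<close>, so ranging over
    rotated classes is ranging over all classes.\<close>
  have ex: "(\<forall>c::int \<times> int. P (snd c, - fst c)) \<longleftrightarrow> (\<forall>c. P c)" for P
  proof safe
    fix x y :: int assume "\<forall>c. P (snd c, - fst c)"
    from spec[OF this, of "(- y, x)"] show "P (x, y)" by simp
  qed auto
  show ?thesis
    unfolding sector_equidist_def card_lattice_sector_rotate add_diff_cancel_right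
    using ex[of "\<lambda>c. \<forall>\<rho>\<ge>1. \<bar>card (lattice_sector q c {a..<b} \<rho>) - (b - a) * \<rho>\<^sup>2 / (2 * (real q)\<^sup>2)\<bar> \<le> C * \<rho>" for C]
    by (intro ex_cong1)
qed

lemma sector_equidist_shift_int:
  "sector_equidist q (a + of_int k * (pi / 2)) (b + of_int k * (pi / 2)) \<longleftrightarrow> sector_equidist q a b"
proof (induction k rule: int_induct[where k = 0])
  case (step1 i)
  then show ?case using sector_equidist_shift[of q "a + of_int i * (pi / 2)" "b + of_int i * (pi / 2)"]
    by (simp add: algebra_simps add_divide_distrib)
next
  case (step2 i)
  then show ?case using sector_equidist_shift[of q "a + of_int (i - 1) * (pi / 2)" "b + of_int (i - 1) * (pi / 2)"]
    by (simp add: algebra_simps diff_divide_distrib)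
qed simp

lemma sector_equidist:
  assumes q: "q > 0" and ab: "a \<le> b" "b \<le> a + 2 * pi"
  shows "sector_equidist q a b"
proof -
  have zero: "sector_equidist q 0 \<theta>" if "0 \<le> \<theta>" "\<theta> \<le> pi / 2" for \<theta>
  proof (cases "\<theta> = 0")
    case False
    then have "0 < \<theta>" using that by simp
    then show ?thesis unfolding sector_equidist_def
      using card_lattice_sector_quadrant[OF _ that(2) q] by auto
  qed (simp add: sector_equidist_refl)
  \<comment> \<open>A sector inside one quadrant is turned back to the first quadrant, where it is
    the difference of two sectors starting at angle 0.\<close>
  have quad: "sector_equidist q s t"
    if "of_int k * (pi / 2) \<le> s" "s \<le> t" "t \<le> of_int (k + 1) * (pi / 2)" for k s t
  proof -
    have "sector_equidist q (s - of_int k * (pi / 2)) (t - of_int k * (pi / 2))"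
      by (rule sector_equidist_diff[of 0]) (use that in \<open>auto intro!: zero simp: algebra_simps\<close>)
    then show ?thesis using sector_equidist_shift_int[of q "s - of_int k * (pi / 2)" k "t - of_int k * (pi / 2)"]
      by simp
  qed
  define k where "k = \<lfloor>a / (pi / 2)\<rfloor>"
  have k: "of_int k * (pi / 2) \<le> a"
    using of_int_floor_le[of "a / (pi / 2)"] unfolding k_def pos_le_divide_eq[OF pi_half_gt_zero] .
  \<comment> \<open>Induction on the number of quadrants, counted from the axis at or below
    \<open>a\<close>, that are allowed for \<open>d\<close>; each step splits off the last quadrant
    at \<open>m\<close>.\<close>
  have main: "sector_equidist q a d" if "a \<le> d" "d \<le> a + 2 * pi" "d \<le> of_int (k + int n) * (pi / 2)" for n d
    using that
  proof (induction n arbitrary: d)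
    case 0
    then have "d = a" using k by simp
    then show ?case by (simp add: sector_equidist_refl)
  next
    case (Suc n)
    define m where "m = of_int (k + int n) * (pi / 2)"
    consider "d \<le> m" | "d > m" "a \<le> m" | "m < a" by linarith
    then show ?case
    proof cases
      case 1 then show ?thesis using Suc by (simp add: m_def)
    next
      case 2
      have "sector_equidist q a m" using 2 Suc.prems by (intro Suc.IH) (auto simp: m_def)
      moreover have "sector_equidist q m d"
        by (rule quad[of "k + int n"]) (use 2 Suc.prems in \<open>auto simp: m_def algebra_simps\<close>)
      ultimately show ?thesis using 2 Suc.prems by (intro sector_equidist_join[of a m d]) auto
    next
      case 3
      show ?thesis
        by (rule quad[of "k + int n"]) (use 3 Suc.prems in \<open>auto simp: m_def algebra_simps\<close>)
    qed
  qed
  define n where "n = nat (\<lceil>b / (pi / 2)\<rceil> - k)"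
  have "b / (pi / 2) \<le> of_int (k + int n)" unfolding n_def by linarith
  then have "b \<le> of_int (k + int n) * (pi / 2)" by (simp add: pos_divide_le_eq)
  from main[OF ab this] show ?thesis .
qed

subsection \<open>Moebius inversion\<close>

definition moebius_mu :: "nat \<Rightarrow> real" where
  "moebius_mu n = (if squarefree n then (- 1) ^ card (prime_factors n) else 0)"

lemma abs_moebius_mu_le: "\<bar>moebius_mu n\<bar> \<le> 1"
  by (simp add: moebius_mu_def power_abs)

lemma moebius_mu_1 [simp]: "moebius_mu 1 = 1"
  by (simp add: moebius_mu_def)

lemma moebius_mu_prime_mult:
  assumes "prime r" "\<not> r dvd d" "d > 0"
  shows "moebius_mu (r * d) = - moebius_mu d"
proof -
  have co: "coprime r d" using assms by (intro prime_imp_coprime) auto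
  have sq: "squarefree (r * d) \<longleftrightarrow> squarefree d"
    using co assms squarefree_prime[of r] squarefree_mult_coprime squarefree_multD by blast
  have "prime_factors (r * d) = insert r (prime_factors d)"
    using assms prime_gt_0_nat[of r] by (simp add: prime_factorization_mult prime_factorization_prime)
  then have "card (prime_factors (r * d)) = Suc (card (prime_factors d))"
    using assms by (simp add: in_prime_factors_iff)
  then show ?thesis by (simp add: moebius_mu_def sq)
qed

text \<open>For a prime \<open>r\<close> dividing \<open>n\<close>, multiplication by
  \<open>r\<close> pairs the squarefree divisors prime to \<open>r\<close> with the squarefree
  multiples of \<open>r\<close>, and the signs in each pair are opposite.\<close>

lemma sum_moebius_mu_divisors:
  assumes "n > 0"
  shows "(\<Sum>d | d dvd n. moebius_mu d) = (if n = 1 then 1 else 0)"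
proof (cases "n = 1")
  case True
  then have "{d. d dvd n} = {1}" by auto
  then show ?thesis using True by (simp del: One_nat_def)
next
  case False
  then obtain r where r: "prime r" "r dvd n" using prime_factor_nat by blast
  define A where "A = {d. d dvd n \<and> \<not> r dvd d}"
  \<comment> \<open>Squarefreeness makes division by \<open>r\<close> land among the divisors prime
    to \<open>r\<close>; the omitted divisors have value 0.\<close>
  define B where "B = {d. d dvd n \<and> r dvd d \<and> squarefree d}"
  have fin: "finite {d. d dvd n}" using assms by simp
  have finA: "finite A" "finite B" by (rule finite_subset[OF _ fin], auto simp: A_def B_def)+
  have B: "B = (\<lambda>d. r * d) ` {d \<in> A. squarefree d}"
  proof (intro set_eqI iffI)
    fix d assume "d \<in> B"
    then obtain e where e: "d = r * e" "d dvd n" "squarefree d" by (auto simp: B_def)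
    have "\<not> r dvd e"
    proof
      assume "r dvd e"
      then have "r ^ 2 dvd d" unfolding e(1) power2_eq_square by simp
      then have "is_unit r" using e(3) by (meson squarefreeD)
      then show False using r(1) not_prime_unit by blast
    qed
    moreover have "e dvd n" using e by (metis dvd_mult_right)
    moreover have "squarefree e" using e squarefree_multD by blast
    ultimately show "d \<in> (\<lambda>d. r * d) ` {d \<in> A. squarefree d}" using e by (auto simp: A_def)
  next
    fix d assume "d \<in> (\<lambda>d. r * d) ` {d \<in> A. squarefree d}"
    then obtain e where e: "d = r * e" "e dvd n" "\<not> r dvd e" "squarefree e" by (auto simp: A_def)
    have "coprime r e" using e r by (intro prime_imp_coprime) auto
    then show "d \<in> B" using e r squarefree_prime[of r]
      by (auto simp: B_def intro: squarefree_mult_coprime divides_mult)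
  qed
  have "inj_on (\<lambda>d. r * d) {d \<in> A. squarefree d}" using prime_gt_0_nat[OF r(1)] by (auto simp: inj_on_def)
  then have "sum moebius_mu B = (\<Sum>d | d \<in> A \<and> squarefree d. moebius_mu (r * d))"
    unfolding B by (simp add: sum.reindex)
  also have "\<dots> = (\<Sum>d | d \<in> A \<and> squarefree d. - moebius_mu d)"
    using r assms by (intro sum.cong) (auto simp: A_def intro!: moebius_mu_prime_mult dvd_pos_nat[OF assms])
  also have "\<dots> = (\<Sum>d\<in>A. - moebius_mu d)"
    using finA by (intro sum.mono_neutral_left) (auto simp: moebius_mu_def)
  finally have "sum moebius_mu A + sum moebius_mu B = 0" by (simp add: sum_negf)
  moreover have "(\<Sum>d | d dvd n. moebius_mu d) = sum moebius_mu (A \<union> B)"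
    using fin by (intro sum.mono_neutral_right) (auto simp: A_def B_def moebius_mu_def)
  moreover have "A \<inter> B = {}" by (auto simp: A_def B_def)
  ultimately show ?thesis using False finA by (simp add: sum.union_disjoint)
qed

section \<open>Primitive vectors in a sector and a residue class\<close>

lemma vec_length_ge_1:
  assumes "v \<in> angular_cone J" shows "vec_length v \<ge> 1" "v \<noteq> (0, 0)"
proof -
  show nz: "v \<noteq> (0, 0)"
  proof
    assume "v = (0, 0)"
    then obtain t :: real where "cos t = 0" "sin t = 0" using assms by (auto elim: angular_coneE)
    then show False using sin_cos_squared_add[of t] by simp
  qed
  have "1 \<le> (fst v)\<^sup>2 + (snd v)\<^sup>2"
    using nz by (metis add_nonneg_eq_0_iff int_one_le_iff_zero_less not_less_iff_gr_or_eq power2_less_0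
        prod.collapse sum_power2_gt_zero_iff zero_le_power2)
  then have "1 \<le> (real_of_int (fst v))\<^sup>2 + (real_of_int (snd v))\<^sup>2"
    by (metis (mono_tags) of_int_1 of_int_add of_int_le_iff of_int_power)
  then show "vec_length v \<ge> 1" by (simp add: vec_length_eq)
qed

text \<open>Below radius 1 the count is 0 and the main term is itself within the error, as
  \<open>\<rho>^2 \<le> \<rho> powr (3/2)\<close> there. Validity at all positive radii permits
  \<open>\<rho> / d\<close> with arbitrarily large \<open>d\<close>.\<close>

lemma card_lattice_sector_le_powr:
  assumes "q > 0" "a \<le> b" "b \<le> a + 2 * pi"
  obtains C where "C \<ge> 0" "\<And>c \<rho>. \<rho> > 0 \<Longrightarrow>
    \<bar>card (lattice_sector q c {a..<b} \<rho>) - (b - a) / (2 * (real q)\<^sup>2) * \<rho>\<^sup>2\<bar> \<le> C * \<rho> powr (3/2)"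
proof -
  define \<kappa> where "\<kappa> = (b - a) / (2 * (real q)\<^sup>2)"
  have \<kappa>: "\<kappa> \<ge> 0" using assms by (simp add: \<kappa>_def)
  obtain C where C: "\<And>c \<rho>. \<rho> \<ge> 1 \<Longrightarrow>
     \<bar>card (lattice_sector q c {a..<b} \<rho>) - \<kappa> * \<rho>\<^sup>2\<bar> \<le> C * \<rho>"
    using sector_equidist[OF assms] unfolding sector_equidist_def \<kappa>_def by auto
  show ?thesis
  proof (rule that[of "\<bar>C\<bar> + \<kappa>"])
    fix c and \<rho> :: real assume \<rho>: "\<rho> > 0"
    have "\<bar>card (lattice_sector q c {a..<b} \<rho>) - \<kappa> * \<rho>\<^sup>2\<bar> \<le> (\<bar>C\<bar> + \<kappa>) * \<rho> powr (3/2)"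
    proof (cases "\<rho> \<ge> 1")
      case True
      have "\<bar>card (lattice_sector q c {a..<b} \<rho>) - \<kappa> * \<rho>\<^sup>2\<bar> \<le> C * \<rho>" by (rule C[OF True])
      also have "\<dots> \<le> (\<bar>C\<bar> + \<kappa>) * \<rho>" using \<kappa> \<rho> by (intro mult_right_mono) auto
      also have "\<dots> \<le> (\<bar>C\<bar> + \<kappa>) * \<rho> powr (3/2)"
        using \<kappa> powr_mono[of 1 "3/2" \<rho>] True by (intro mult_left_mono) auto
      finally show ?thesis .
    next
      case False
      then have "lattice_sector q c {a..<b} \<rho> = {}"
        using vec_length_ge_1(1) by (force simp: lattice_sector_def)
      then have "\<bar>card (lattice_sector q c {a..<b} \<rho>) - \<kappa> * \<rho>\<^sup>2\<bar> = \<kappa> * \<rho>\<^sup>2" using \<kappa> by simp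
      also have "\<dots> \<le> \<kappa> * \<rho> powr (3/2)"
        using False \<rho> \<kappa> powr_mono'[of "3/2" 2 \<rho>] by (intro mult_left_mono) auto
      also have "\<dots> \<le> (\<bar>C\<bar> + \<kappa>) * \<rho> powr (3/2)" by (intro mult_right_mono) auto
      finally show ?thesis .
    qed
    then show "\<bar>card (lattice_sector q c {a..<b} \<rho>) - (b - a) / (2 * (real q)\<^sup>2) * \<rho>\<^sup>2\<bar> \<le> (\<bar>C\<bar> + \<kappa>) * \<rho> powr (3/2)"
      by (simp only: \<kappa>_def)
  qed (use \<kappa> in simp)
qed

lemma angular_cone_scale:
  assumes "d > 0" shows "(int d * x, int d * y) \<in> angular_cone J \<longleftrightarrow> (x, y) \<in> angular_cone J"
proof
  assume "(int d * x, int d * y) \<in> angular_cone J"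
  then obtain r t where "r > 0" "t \<in> J" "d * x = r * cos t" "d * y = r * sin t"
    by (elim angular_coneE) auto
  then show "(x, y) \<in> angular_cone J" using assms by (intro angular_coneI[of "r / d" t]) (auto simp: field_simps)
next
  assume "(x, y) \<in> angular_cone J"
  then obtain r t where "r > 0" "t \<in> J" "x = r * cos t" "y = r * sin t"
    by (elim angular_coneE) auto
  then show "(int d * x, int d * y) \<in> angular_cone J" using assms by (intro angular_coneI[of "r * d" t]) auto
qed

lemma vec_length_scale: "vec_length (int d * x, int d * y) = d * vec_length (x, y)"
proof -
  have "(real d * x)\<^sup>2 + (real d * y)\<^sup>2 = (real d)\<^sup>2 * ((of_int x)\<^sup>2 + (of_int y)\<^sup>2)"
    by (simp add: power_mult_distrib distrib_left)
  then show ?thesis by (simp add: vec_length_eq real_sqrt_mult)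
qed

text \<open>Dividing by \<open>d\<close> scales the radius and, as \<open>d\<close> is a unit modulo
  \<open>q\<close>, multiplies the class by an inverse \<open>e\<close> of \<open>d\<close>. The new
  class can stay unspecified because only bounds uniform in the class are applied to it.\<close>

lemma card_lattice_sector_dvd:
  assumes d: "d > 0" "coprime d q"
  obtains c' where "card {v \<in> lattice_sector q c J \<rho>. int d dvd gcd (fst v) (snd v)}
    = card (lattice_sector q c' J (\<rho> / d))"
proof -
  have "coprime (int d) (int q)" using d by simp
  then obtain e where e: "[int d * e = 1] (mod int q)" using cong_solve_coprime_int by blast
  have iff: "[int d * x = y] (mod int q) \<longleftrightarrow> [x = e * y] (mod int q)" for x y
  proof
    assume "[int d * x = y] (mod int q)"
    then have "[e * (int d * x) = e * y] (mod int q)" by (rule cong_scalar_left)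
    moreover have "[(int d * e) * x = 1 * x] (mod int q)" using e by (rule cong_scalar_right)
    ultimately show "[x = e * y] (mod int q)"
      by (metis cong_sym cong_trans mult.commute mult.left_commute mult_1)
  next
    assume "[x = e * y] (mod int q)"
    then have "[int d * x = int d * (e * y)] (mod int q)" by (rule cong_scalar_left)
    moreover have "[(int d * e) * y = 1 * y] (mod int q)" using e by (rule cong_scalar_right)
    ultimately show "[int d * x = y] (mod int q)"
      by (metis cong_trans mult.assoc mult_1)
  qed
  let ?c = "(e * fst c, e * snd c)"
  have le: "real d * l \<le> \<rho> \<longleftrightarrow> l \<le> \<rho> / d" for l using d by (simp add: field_simps)
  have "{v \<in> lattice_sector q c J \<rho>. int d dvd gcd (fst v) (snd v)}
      = (\<lambda>(x, y). (int d * x, int d * y)) ` lattice_sector q ?c J (\<rho> / d)" (is "?L = ?f ` ?R")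
  proof (intro set_eqI iffI)
    fix v assume v: "v \<in> ?L"
    then obtain x y where "fst v = int d * x" "snd v = int d * y" by (auto elim!: dvdE)
    then have xy: "v = (int d * x, int d * y)" by (simp add: prod_eq_iff)
    then have "(x, y) \<in> ?R" using v d
      by (auto simp: lattice_sector_def angular_cone_scale vec_length_scale iff le)
    then show "v \<in> ?f ` ?R" using xy by force
  next
    fix v assume "v \<in> ?f ` ?R"
    then show "v \<in> ?L" using d
      by (auto simp: lattice_sector_def angular_cone_scale vec_length_scale iff le)
  qed
  moreover have "inj_on ?f ?R" using d by (auto simp: inj_on_def)
  ultimately show ?thesis using that[of ?c] by (simp add: card_image)
qed

text \<open>A common factor of \<open>d\<close> and \<open>q\<close> would divide the vector and,
  through the congruence, also \<open>c\<close>, contrary to the coprimality of its gcd with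
  \<open>q\<close>.\<close>

lemma lattice_sector_not_coprime:
  assumes c: "coprime (gcd (fst c) (snd c)) (int q)" and d: "\<not> coprime d q"
  shows "{v \<in> lattice_sector q c J \<rho>. int d dvd gcd (fst v) (snd v)} = {}"
proof (rule ccontr)
  assume "\<not> ?thesis"
  then obtain v where v: "[fst v = fst c] (mod int q)" "[snd v = snd c] (mod int q)"
    "int d dvd fst v" "int d dvd snd v" by (auto simp: lattice_sector_def)
  define g where "g = gcd (int d) (int q)"
  have "g dvd fst v" "g dvd snd v" "g dvd int q" using v by (auto simp: g_def intro: gcd_dvdI1 dvd_trans)
  moreover from this have "g dvd fst c" "g dvd snd c"
    using v(1,2) by (meson cong_dvd_iff cong_dvd_modulus)+
  ultimately have "g dvd 1" using c by (meson coprime_common_divisor gcd_greatest)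
  then have "coprime (int d) (int q)" unfolding g_def by (simp add: coprime_iff_gcd_eq_1)
  then show False using d by simp
qed

definition moebius_coprime :: "nat \<Rightarrow> nat \<Rightarrow> real" where
  "moebius_coprime q d = (if coprime d q then moebius_mu d else 0)"

lemma abs_moebius_coprime_le: "\<bar>moebius_coprime q d\<bar> \<le> 1"
  using abs_moebius_mu_le by (simp add: moebius_coprime_def)

text \<open>This is the Euler product of \<open>1 - 1 / r^2\<close> over the primes \<open>r\<close>
  not dividing \<open>q\<close>; the shift by \<open>Suc\<close> starts the series at
  \<open>d = 1\<close>.\<close>

definition coprime_density :: "nat \<Rightarrow> real" where
  "coprime_density q = (\<Sum>n. moebius_coprime q (Suc n) / (real (Suc n))\<^sup>2)"

lemma summable_moebius_coprime: "summable (\<lambda>n. moebius_coprime q (Suc n) / (real (Suc n))\<^sup>2)"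
proof (rule summable_comparison_test')
  have "summable (\<lambda>n. inverse (real n ^ 2))" by (rule inverse_power_summable) simp
  then show "summable (\<lambda>n. inverse (real (Suc n) ^ 2))" by (subst summable_Suc_iff)
  show "norm (moebius_coprime q (Suc n) / (real (Suc n))\<^sup>2) \<le> inverse (real (Suc n) ^ 2)" for n
    using abs_moebius_coprime_le[of q "Suc n"] by (simp add: abs_divide divide_simps)
qed

text \<open>An elementary estimate replaces the Euler product: the first term is 1, and even if
  every later term were \<open>- 1 / d^2\<close>, telescoping shows a loss of at most 3/4.\<close>

lemma coprime_density_pos: "coprime_density q > 0"
proof -
  let ?f = "\<lambda>n. moebius_coprime q (Suc n) / (real (Suc n))\<^sup>2"
  have abs: "\<bar>?f n\<bar> \<le> 1 / (real (Suc n))\<^sup>2" for n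
    using abs_moebius_coprime_le[of q "Suc n"] by (simp add: abs_divide divide_simps)
  have lower: "- (1 / (real (Suc n))\<^sup>2) \<le> ?f n" for n using abs[of n] by linarith
  \<comment> \<open>At \<open>N = 0\<close> the right side is 1/4 + 1/2 = 1 - 1/4. It then drops by
    1/(N+2) - 1/(N+3), which is at least 1/(N+3)^2, the largest possible loss of the new
    term.\<close>
  have main: "(\<Sum>n<N + 2. ?f n) \<ge> 1 / 4 + 1 / (N + 2)" for N
  proof (induction N)
    case 0
    have "?f 0 = 1" by (simp add: moebius_coprime_def moebius_mu_def)
    moreover have "?f 1 \<ge> - (1 / 4)" using lower[of 1] by simp
    ultimately show ?case by (simp add: numeral_2_eq_2)
  next
    case (Suc N)
    have T: "(\<Sum>n<Suc N + 2. ?f n) = (\<Sum>n<N + 2. ?f n) + ?f (N + 2)" "real (Suc N) + 2 = real N + 3"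
      by simp_all
    have "1 / (real N + 3)\<^sup>2 \<le> 1 / (real N + 2) - 1 / (real N + 3)"
      by (simp add: divide_simps power2_eq_square)
    moreover have "real (Suc (N + 2)) = real N + 3" by simp
    then have "?f (N + 2) \<ge> - (1 / (real N + 3)\<^sup>2)" using lower[of "N + 2"] by metis
    ultimately show ?case unfolding T using Suc.IH by linarith
  qed
  have "(\<Sum>n<N. ?f n) \<ge> 1 / 4" if N: "N \<ge> 2" for N
  proof -
    have e: "N = (N - 2) + 2" using N by simp
    have "1 / 4 \<le> 1 / 4 + 1 / (real (N - 2) + 2)" by simp
    also have "\<dots> \<le> (\<Sum>n<N. ?f n)" by (subst (2) e) (rule main)
    finally show ?thesis .
  qed
  then have "coprime_density q \<ge> 1 / 4" unfolding coprime_density_def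
    by (intro LIMSEQ_le_const[OF summable_LIMSEQ[OF summable_moebius_coprime]]) blast
  then show ?thesis by simp
qed

text \<open>The indicator of gcd 1 is written as a divisor sum of \<open>moebius_mu\<close> and the
  two sums are exchanged. \<open>D\<close> is left free above \<open>\<rho>\<close> so that it can
  later tend to infinity.\<close>

lemma card_primitive_sector:
  assumes q: "q > 0" and c: "coprime (gcd (fst c) (snd c)) (int q)" and D: "real D \<ge> \<rho>"
  shows "card (lattice_sector q c J \<rho> \<inter> primitive_vectors) =
    (\<Sum>n<D. moebius_mu (Suc n) * card {v \<in> lattice_sector q c J \<rho>. int (Suc n) dvd gcd (fst v) (snd v)})"
proof -
  let ?L = "lattice_sector q c J \<rho>"
  have fin: "finite ?L" by (rule finite_lattice_sector)
  have ind: "(if v \<in> primitive_vectors then 1 else 0)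
      = (\<Sum>n<D. if int (Suc n) dvd gcd (fst v) (snd v) then moebius_mu (Suc n) else 0)" if v: "v \<in> ?L" for v
  proof -
    define g where "g = nat (gcd (fst v) (snd v))"
    have gi: "int g = gcd (fst v) (snd v)" by (simp add: g_def)
    have vc: "v \<in> angular_cone J" "vec_length v \<le> \<rho>" using v by (auto simp: lattice_sector_def)
    have "v \<noteq> (0, 0)" by (rule vec_length_ge_1(2)[OF vc(1)])
    then have nz: "fst v \<noteq> 0 \<or> snd v \<noteq> 0" by (metis prod.collapse)
    then have g0: "g > 0" by (simp add: g_def)
    \<comment> \<open>The gcd divides a nonzero coordinate, hence is at most the length of the
      vector; no divisor of it is missed by the range up to \<open>D\<close>.\<close>
    have "int g \<le> max \<bar>fst v\<bar> \<bar>snd v\<bar>" unfolding gi using nz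
      by (metis abs_gcd_int dvd_abs_iff dvd_imp_le_int gcd_dvd1 gcd_dvd2 max.coboundedI1 max.coboundedI2)
    then have "real g \<le> max \<bar>real_of_int (fst v)\<bar> \<bar>real_of_int (snd v)\<bar>" by linarith
    also have "\<dots> \<le> vec_length v" unfolding vec_length_eq by (simp add: real_sqrt_ge_abs1 real_sqrt_ge_abs2)
    finally have gD: "g \<le> D" using vc(2) D by linarith
    have "(\<Sum>n<D. if int (Suc n) dvd gcd (fst v) (snd v) then moebius_mu (Suc n) else 0)
       = (\<Sum>n<D. if Suc n dvd g then moebius_mu (Suc n) else 0)" by (simp only: gi[symmetric] int_dvd_int_iff)
    also have "\<dots> = (\<Sum>n | n < D \<and> Suc n dvd g. moebius_mu (Suc n))"
      by (rule sum.mono_neutral_cong_right) auto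
    also have "\<dots> = (\<Sum>d\<in>Suc ` {n. n < D \<and> Suc n dvd g}. moebius_mu d)" by (simp add: sum.reindex)
    also have "Suc ` {n. n < D \<and> Suc n dvd g} = {d. d dvd g}"
    proof (intro set_eqI iffI)
      fix d assume "d \<in> {d. d dvd g}"
      then have "d dvd g" "d > 0" "d \<le> g" using g0 by (auto intro: dvd_pos_nat dvd_imp_le)
      then show "d \<in> Suc ` {n. n < D \<and> Suc n dvd g}" using gD by (intro image_eqI[of _ _ "d - 1"]) auto
    qed auto
    also have "(\<Sum>d | d dvd g. moebius_mu d) = (if g = 1 then 1 else 0)" by (rule sum_moebius_mu_divisors[OF g0])
    also have "g = 1 \<longleftrightarrow> v \<in> primitive_vectors" using gi by (auto simp: primitive_vectors_def)
    finally show ?thesis by simp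
  qed
  have "real (card (?L \<inter> primitive_vectors)) = (\<Sum>v\<in>?L. if v \<in> primitive_vectors then 1 else 0)"
    using fin by (simp add: sum.If_cases)
  also have "\<dots> = (\<Sum>v\<in>?L. \<Sum>n<D. if int (Suc n) dvd gcd (fst v) (snd v) then moebius_mu (Suc n) else 0)"
    by (rule sum.cong) (simp_all only: ind)
  also have "\<dots> = (\<Sum>n<D. \<Sum>v\<in>?L. if int (Suc n) dvd gcd (fst v) (snd v) then moebius_mu (Suc n) else 0)"
    by (rule sum.swap)
  also have "\<dots> = (\<Sum>n<D. moebius_mu (Suc n) * card {v \<in> ?L. int (Suc n) dvd gcd (fst v) (snd v)})"
    using fin by (intro sum.cong refl) (simp add: sum.If_cases Int_def mult.commute)
  finally show ?thesis .
qed

lemma primitive_sector_asymptotic: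
  assumes q: "q > 0" and ab: "a \<le> b" "b \<le> a + 2 * pi"
  obtains C where "C \<ge> 0" "\<And>c \<rho>. coprime (gcd (fst c) (snd c)) (int q) \<Longrightarrow> \<rho> > 0 \<Longrightarrow>
    \<bar>card (lattice_sector q c {a..<b} \<rho> \<inter> primitive_vectors)
      - (b - a) / (2 * (real q)\<^sup>2) * coprime_density q * \<rho>\<^sup>2\<bar> \<le> C * \<rho> powr (3/2)"
proof -
  define \<kappa> where "\<kappa> = (b - a) / (2 * (real q)\<^sup>2)"
  obtain C where C: "C \<ge> 0" "\<And>c \<rho>. \<rho> > 0 \<Longrightarrow>
    \<bar>card (lattice_sector q c {a..<b} \<rho>) - \<kappa> * \<rho>\<^sup>2\<bar> \<le> C * \<rho> powr (3/2)"
    using card_lattice_sector_le_powr[OF assms] unfolding \<kappa>_def by metis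
  \<comment> \<open>The value zeta(3/2), which collects the errors
    \<open>C * (\<rho> / d) powr (3/2)\<close> over all \<open>d\<close>.\<close>
  define Z where "Z = (\<Sum>n. real (Suc n) powr - (3/2))"
  have "summable (\<lambda>n. real n powr - (3/2))" by (subst summable_real_powr_iff) simp
  then have Zs: "summable (\<lambda>n. real (Suc n) powr - (3/2))" by (subst summable_Suc_iff)
  have Z0: "Z \<ge> 0" unfolding Z_def by (rule suminf_nonneg[OF Zs]) simp
  show ?thesis
  proof (rule that[of "C * Z"])
    fix c and \<rho> :: real assume c: "coprime (gcd (fst c) (snd c)) (int q)" and \<rho>: "\<rho> > 0"
    let ?P = "real (card (lattice_sector q c {a..<b} \<rho> \<inter> primitive_vectors))"
    let ?m = "\<lambda>n. moebius_coprime q (Suc n)"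
    have summand: "\<bar>moebius_mu d * card {v \<in> lattice_sector q c {a..<b} \<rho>. int d dvd gcd (fst v) (snd v)}
        - \<kappa> * \<rho>\<^sup>2 * (moebius_coprime q d / (real d)\<^sup>2)\<bar> \<le> C * \<rho> powr (3/2) * real d powr - (3/2)"
      if d: "d > 0" for d
    proof (cases "coprime d q")
      case True
      obtain c' where c': "card {v \<in> lattice_sector q c {a..<b} \<rho>. int d dvd gcd (fst v) (snd v)}
          = card (lattice_sector q c' {a..<b} (\<rho> / d))" using card_lattice_sector_dvd[OF d True] .
      have "\<bar>moebius_mu d * card (lattice_sector q c' {a..<b} (\<rho> / d)) - \<kappa> * \<rho>\<^sup>2 * (moebius_mu d / (real d)\<^sup>2)\<bar>
          = \<bar>moebius_mu d\<bar> * \<bar>card (lattice_sector q c' {a..<b} (\<rho> / d)) - \<kappa> * (\<rho> / d)\<^sup>2\<bar>"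
        by (simp add: abs_mult[symmetric] power_divide algebra_simps)
      also have "\<dots> \<le> 1 * (C * (\<rho> / d) powr (3/2))"
        using abs_moebius_mu_le C(2)[of "\<rho> / d" c'] d \<rho> by (intro mult_mono) auto
      also have "\<dots> = C * \<rho> powr (3/2) * real d powr - (3/2)"
        using \<rho> d by (simp add: powr_divide powr_minus_divide)
      finally show ?thesis unfolding c' using True by (simp add: moebius_coprime_def)
    next
      case False
      show ?thesis unfolding lattice_sector_not_coprime[OF c False] using False C(1)
        by (simp add: moebius_coprime_def)
    qed
    have bound: "\<bar>?P - \<kappa> * \<rho>\<^sup>2 * (\<Sum>n<D. ?m n / (real (Suc n))\<^sup>2)\<bar> \<le> C * Z * \<rho> powr (3/2)"
      if D: "real D \<ge> \<rho>" for D
    proof -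
      have "?P - \<kappa> * \<rho>\<^sup>2 * (\<Sum>n<D. ?m n / (real (Suc n))\<^sup>2)
        = (\<Sum>n<D. moebius_mu (Suc n) * card {v \<in> lattice_sector q c {a..<b} \<rho>. int (Suc n) dvd gcd (fst v) (snd v)}
        - \<kappa> * \<rho>\<^sup>2 * (?m n / (real (Suc n))\<^sup>2))"
        unfolding card_primitive_sector[OF q c D] by (simp only: sum_subtractf sum_distrib_left)
      also have "\<bar>\<dots>\<bar> \<le> (\<Sum>n<D. C * \<rho> powr (3/2) * real (Suc n) powr - (3/2))"
        by (rule order_trans[OF sum_abs]) (intro sum_mono summand, simp)
      also have "\<dots> = C * \<rho> powr (3/2) * (\<Sum>n<D. real (Suc n) powr - (3/2))"
        by (simp only: sum_distrib_left)
      also have "\<dots> \<le> C * \<rho> powr (3/2) * Z"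
        unfolding Z_def using C(1) by (intro mult_left_mono sum_le_suminf[OF Zs]) auto
      finally show ?thesis by (simp add: mult_ac)
    qed
    \<comment> \<open>The error bound is the same for every \<open>D \<ge> \<rho>\<close>, so the
      limit completes the series without a tail estimate.\<close>
    have lim: "(\<lambda>D. \<bar>?P - \<kappa> * \<rho>\<^sup>2 * (\<Sum>n<D. ?m n / (real (Suc n))\<^sup>2)\<bar>)
       \<longlonglongrightarrow> \<bar>?P - \<kappa> * \<rho>\<^sup>2 * coprime_density q\<bar>"
      unfolding coprime_density_def
      by (intro tendsto_intros summable_LIMSEQ[OF summable_moebius_coprime])
    have "\<bar>?P - \<kappa> * \<rho>\<^sup>2 * coprime_density q\<bar> \<le> C * Z * \<rho> powr (3/2)"
    proof (rule LIMSEQ_le_const2[OF lim], intro exI[of _ "nat \<lceil>\<rho>\<rceil>"] allI impI)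
      fix n assume "n \<ge> nat \<lceil>\<rho>\<rceil>"
      then have "real n \<ge> \<rho>" by linarith
      then show "\<bar>?P - \<kappa> * \<rho>\<^sup>2 * (\<Sum>n<n. ?m n / (real (Suc n))\<^sup>2)\<bar> \<le> C * Z * \<rho> powr (3/2)"
        by (rule bound)
    qed
    then show "\<bar>?P - (b - a) / (2 * (real q)\<^sup>2) * coprime_density q * \<rho>\<^sup>2\<bar> \<le> C * Z * \<rho> powr (3/2)"
      unfolding \<kappa>_def by (simp add: mult_ac)
  qed (use C Z0 in simp)
qed

subsection \<open>The $p$-adic circle\<close>

lemma padic_norm_of_int_eq_1:
  assumes "\<not> int CARD('p::prime_card) dvd a"
  shows "padic_norm (of_int a :: 'p padic) = 1"
proof -
  have "a \<noteq> 0" using assms by auto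
  then show ?thesis
    using padic_abs_Fract[OF prime_card[where 'a='p], of a 1] padic_norm_of_rat'[of "of_int a", where 'p='p] assms
    by (simp add: not_dvd_imp_multiplicity_0)
qed

lemma padic_norm_prime_power:
  "padic_norm (of_nat CARD('p) ^ n :: 'p::prime_card padic) = real CARD('p) powi (- int n)"
proof -
  note p = prime_card[where 'a='p]
  have "multiplicity (int CARD('p)) (int CARD('p) ^ n) = n"
    using p prime_gt_1_nat[OF p] by (intro multiplicity_same_power) auto
  moreover have "int CARD('p) ^ n \<noteq> 0" using prime_gt_0_nat[OF p] by simp
  ultimately show ?thesis
    using padic_abs_Fract[OF p, of "int CARD('p) ^ n" 1] padic_norm_of_rat'[of "of_int (int CARD('p) ^ n)", where 'p='p]
    by (simp add: of_rat_power)
qed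

text \<open>The norm takes no value strictly between 1/p and 1. An integer within 1/p of
  \<open>x\<close> has norm below 1, so \<open>p\<close> divides it, and the ultrametric inequality
  carries the bound 1/p back to \<open>x\<close>.\<close>

lemma padic_norm_less_1_iff:
  "padic_norm (x :: 'p::prime_card padic) < 1 \<longleftrightarrow> padic_norm x \<le> real CARD('p) powi (- int 1)"
proof
  have p1: "real CARD('p) > 1" using prime_gt_1_nat[OF prime_card[where 'a='p]] by simp
  have inv: "real CARD('p) powi (- int 1) = 1 / real CARD('p)"
    by (simp add: power_int_minus inverse_eq_divide)
  {
    assume "padic_norm x \<le> real CARD('p) powi (- int 1)"
    also have "\<dots> < 1" unfolding inv using p1 by simp
    finally show "padic_norm x < 1" .
  }
  assume x: "padic_norm x < 1"
  then obtain r where r: "padic_norm (x - of_nat r) \<le> real CARD('p) powi (- int 1)"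
    using padic_integer_approx[of x 1] by auto
  have "padic_norm (of_nat r :: 'p padic) \<le> max (padic_norm x) (padic_norm (x - of_nat r))"
    using padic_norm_add_le[of x "- (x - of_nat r)"] unfolding padic_norm_minus by simp
  also have "\<dots> < 1"
  proof -
    have "real CARD('p) powi (- int 1) < 1" unfolding inv using p1 by simp
    then show ?thesis using x r by linarith
  qed
  finally have "int CARD('p) dvd int r"
    using padic_norm_of_int_eq_1[where 'p='p, of "int r"] by fastforce
  then have "padic_norm (of_nat r - 0 :: 'p padic) \<le> real CARD('p) powi (- int 1)"
    using padic_norm_of_int_le_iff[of "int r" 1, where 'p='p] by simp
  then have "padic_norm (x - 0) \<le> real CARD('p) powi (- int 1)"
    unfolding padic_norm_close_iff[OF r, of 0] .
  then show "padic_norm x \<le> real CARD('p) powi (- int 1)" by simp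
qed

text \<open>By discreteness of the norm the circle is a difference of two products of closed balls,
  which gives measurability and measure at once. The radius 1 is kept as a \<open>powi\<close> to
  fit the ball formulas.\<close>

lemma padic_circle_eq:
  "(padic_circle :: ('p::prime_card padic \<times> 'p padic) set) =
    cball 0 (real CARD('p) powi (- int 0)) \<times> cball 0 (real CARD('p) powi (- int 0))
    - cball 0 (real CARD('p) powi (- int 1)) \<times> cball 0 (real CARD('p) powi (- int 1))"
proof -
  have 0: "x \<in> cball 0 (real CARD('p) powi (- int 0)) \<longleftrightarrow> padic_norm x \<le> 1" for x :: "'p padic"
    unfolding mem_cball_padic by simp
  have 1: "x \<in> cball 0 (real CARD('p) powi (- int 1)) \<longleftrightarrow> padic_norm x < 1" for x :: "'p padic"
    by (simp only: mem_cball_padic padic_norm_less_1_iff diff_zero)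
  show ?thesis
    unfolding padic_circle_def padic_vec_norm_def set_eq_iff Diff_iff mem_Times_iff 0 1
    by (auto simp: max_def)
qed

lemma padic_ball_eq:
  "{a + of_nat CARD('p) ^ N * x | x. x \<in> padic_integers}
    = cball (a :: 'p::prime_card padic) (real CARD('p) powi (- int N))"
proof (intro set_eqI iffI)
  fix y assume "y \<in> {a + of_nat CARD('p) ^ N * x | x. x \<in> padic_integers}"
  then obtain x where x: "y = a + of_nat CARD('p) ^ N * x" "padic_norm x \<le> 1" by (auto simp: padic_integers_def)
  then have "padic_norm (y - a) = real CARD('p) powi (- int N) * padic_norm x"
    by (simp add: padic_norm_mult padic_norm_prime_power)
  also have "\<dots> \<le> real CARD('p) powi (- int N)" using x by (intro mult_left_le) (auto intro: less_imp_le)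
  finally show "y \<in> cball a (real CARD('p) powi (- int N))" unfolding mem_cball_padic .
next
  fix y assume "y \<in> cball a (real CARD('p) powi (- int N))"
  then have y: "padic_norm (y - a) \<le> real CARD('p) powi (- int N)" unfolding mem_cball_padic .
  define x where "x = (y - a) / of_nat CARD('p) ^ N"
  have nz: "(of_nat CARD('p) ^ N :: 'p padic) \<noteq> 0" using prime_gt_0_nat[OF prime_card[where 'a='p]] by simp
  have yx: "y - a = of_nat CARD('p) ^ N * x" using nz by (simp add: x_def)
  then have "real CARD('p) powi (- int N) * padic_norm x \<le> real CARD('p) powi (- int N) * 1"
    using y by (simp add: padic_norm_mult padic_norm_prime_power)
  then have "padic_norm x \<le> 1" by (rule mult_left_le_imp_le) simp
  moreover have "y = a + of_nat CARD('p) ^ N * x" using yx by (simp add: algebra_simps)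
  ultimately show "y \<in> {a + of_nat CARD('p) ^ N * x | x. x \<in> padic_integers}"
    by (auto simp: padic_integers_def)
qed

text \<open>Every point of a p-adic ball is a centre and integers approximate all of the unit ball,
  so the centre can be made integral. If \<open>p\<close> divided both coordinates,
  \<open>\<theta>\<close> would have norm below 1, since the radius is at most 1/p.\<close>

lemma padic_arc_eq_residue_class:
  assumes "padic_arc (A :: ('p::prime_card padic \<times> 'p padic) set)"
  obtains N c where "N > 0" "\<not> (int CARD('p) dvd fst c \<and> int CARD('p) dvd snd c)"
    "A = cball (of_int (fst c)) (real CARD('p) powi (- int N)) \<times> cball (of_int (snd c)) (real CARD('p) powi (- int N))"
proof -
  obtain \<theta> N where \<theta>: "\<theta> \<in> padic_circle" "N > 0"
    and A: "A = {(fst \<theta> + of_nat CARD('p) ^ N * x, snd \<theta> + of_nat CARD('p) ^ N * y) | x y.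
            x \<in> padic_integers \<and> y \<in> padic_integers}"
    using assms unfolding padic_arc_def by blast
  let ?e = "real CARD('p) powi (- int N)"
  have "A = {fst \<theta> + of_nat CARD('p) ^ N * x | x. x \<in> padic_integers}
      \<times> {snd \<theta> + of_nat CARD('p) ^ N * x | x. x \<in> padic_integers}"
    unfolding A by auto
  then have A': "A = cball (fst \<theta>) ?e \<times> cball (snd \<theta>) ?e" unfolding padic_ball_eq .
  have n: "max (padic_norm (fst \<theta>)) (padic_norm (snd \<theta>)) = 1"
    using \<theta> by (simp add: padic_circle_def padic_vec_norm_def)
  then obtain r s where r: "padic_norm (fst \<theta> - of_nat r) \<le> ?e" and s: "padic_norm (snd \<theta> - of_nat s) \<le> ?e"
    using padic_integer_approx[of "fst \<theta>" N] padic_integer_approx[of "snd \<theta>" N] by (metis max.cobounded1 max.cobounded2)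
  have "cball (fst \<theta>) ?e = cball (of_nat r) ?e"
    using r by (intro cball_padic_eq) (simp only: mem_cball_padic padic_norm_commute)
  moreover have "cball (snd \<theta>) ?e = cball (of_nat s) ?e"
    using s by (intro cball_padic_eq) (simp only: mem_cball_padic padic_norm_commute)
  ultimately have "A = cball (of_int (int r)) ?e \<times> cball (of_int (int s)) ?e" using A' by simp
  moreover have "\<not> (int CARD('p) dvd int r \<and> int CARD('p) dvd int s)"
  proof
    assume *: "int CARD('p) dvd int r \<and> int CARD('p) dvd int s"
    have p1: "real CARD('p) \<ge> 1" using prime_ge_1_nat[OF prime_card[where 'a='p]] by simp
    have e: "?e \<le> real CARD('p) powi (- int 1)" using \<theta>(2) p1 by (intro power_int_increasing) auto
    have small: "padic_norm x < 1" if "padic_norm (x - of_nat k) \<le> ?e" "int CARD('p) dvd int k" for x :: "'p padic" and k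
    proof -
      have 1: "padic_norm (x - of_nat k) \<le> real CARD('p) powi (- int 1)" using that e by linarith
      have "padic_norm (of_nat k - 0 :: 'p padic) \<le> real CARD('p) powi (- int 1)"
        using padic_norm_of_int_le_iff[of "int k" 1, where 'p='p] that by simp
      then have "padic_norm (x - 0) \<le> real CARD('p) powi (- int 1)"
        unfolding padic_norm_close_iff[OF 1, of 0] .
      then show ?thesis by (simp only: padic_norm_less_1_iff diff_zero)
    qed
    show False using small[OF r] small[OF s] * n by (simp add: max_def split: if_splits)
  qed
  ultimately show ?thesis using that[of N "(int r, int s)"] \<theta>(2) by simp
qed

lemma of_int_mem_padic_cball_iff:
  "of_int x \<in> cball (of_int y :: 'p::prime_card padic) (real CARD('p) powi (- int N))
    \<longleftrightarrow> [x = y] (mod int (CARD('p) ^ N))"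
  using padic_norm_of_int_le_iff[of "x - y" N, where 'p='p]
  unfolding mem_cball_padic by (simp add: cong_iff_dvd_diff)

section \<open>Haar measure of the circle and its arcs\<close>

lemma sigma_finite_padic_haar: "sigma_finite_measure (padic_haar :: 'p::prime_card padic measure)"
proof
  note H = is_padic_haar_padic_haar[where 'p='p]
  have sets: "sets (padic_haar :: 'p padic measure) = sets borel" using H by (simp add: is_padic_haar_def)
  let ?A = "range (\<lambda>q. cball (of_rat q :: 'p padic) (real CARD('p) powi (- int 0)))"
  have "\<Union> ?A = UNIV"
  proof (intro set_eqI iffI)
    fix x :: "'p padic"
    obtain q where "padic_norm (x - of_rat q) < 1" using padic_rat_dense[of 1 x] by auto
    then show "x \<in> \<Union> ?A" by (auto simp: mem_cball_padic simp del: mem_cball intro: less_imp_le)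
  qed simp
  then have "countable ?A \<and> ?A \<subseteq> sets padic_haar \<and> \<Union> ?A = space padic_haar \<and> (\<forall>a\<in>?A. emeasure padic_haar a \<noteq> \<infinity>)"
    using sets_eq_imp_space_eq[OF sets] padic_haar_cball[OF H, of _ 0] by (auto simp: sets simp del: of_nat_0)
  then show "\<exists>A. countable A \<and> A \<subseteq> sets (padic_haar :: 'p padic measure) \<and> \<Union> A = space padic_haar
      \<and> (\<forall>a\<in>A. emeasure padic_haar a \<noteq> \<infinity>)" by blast
qed

lemma measure_padic_balls:
  fixes a b :: "'p::prime_card padic" and n :: nat
  defines "B \<equiv> cball a (real CARD('p) powi (- int n)) \<times> cball b (real CARD('p) powi (- int n))"
  shows "B \<in> sets (padic_haar \<Otimes>\<^sub>M padic_haar)"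
    and "emeasure (padic_haar \<Otimes>\<^sub>M padic_haar) B = ennreal (1 / (real CARD('p) ^ n)\<^sup>2)"
proof -
  interpret sigma_finite_measure "padic_haar :: 'p padic measure" by (rule sigma_finite_padic_haar)
  note H = is_padic_haar_padic_haar[where 'p='p]
  have sets: "sets (padic_haar :: 'p padic measure) = sets borel" using H by (simp add: is_padic_haar_def)
  show "B \<in> sets (padic_haar \<Otimes>\<^sub>M padic_haar)" unfolding B_def by (intro pair_measureI) (auto simp: sets)
  have "emeasure (padic_haar \<Otimes>\<^sub>M padic_haar) B
      = ennreal (real CARD('p) powi (- int n)) * ennreal (real CARD('p) powi (- int n))"
    unfolding B_def by (subst emeasure_pair_measure_Times) (auto simp: sets padic_haar_cball[OF H])
  also have "\<dots> = ennreal (real CARD('p) powi (- int n) * real CARD('p) powi (- int n))"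
    by (rule ennreal_mult[symmetric]) (auto intro: less_imp_le)
  also have "real CARD('p) powi (- int n) * real CARD('p) powi (- int n) = 1 / (real CARD('p) ^ n)\<^sup>2"
    by (simp add: power_int_minus power2_eq_square field_simps)
  finally show "emeasure (padic_haar \<Otimes>\<^sub>M padic_haar) B = ennreal (1 / (real CARD('p) ^ n)\<^sup>2)" .
qed

lemma measure_padic_circle:
  "padic_circle \<in> sets (padic_haar \<Otimes>\<^sub>M (padic_haar :: 'p::prime_card padic measure))"
  "emeasure (padic_haar \<Otimes>\<^sub>M padic_haar) (padic_circle :: ('p padic \<times> 'p padic) set) = ennreal (1 - 1 / (real CARD('p))\<^sup>2)"
proof -
  let ?B = "\<lambda>n. cball (0 :: 'p padic) (real CARD('p) powi (- int n)) \<times> cball (0 :: 'p padic) (real CARD('p) powi (- int n))"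
  have p1: "real CARD('p) \<ge> 1" using prime_ge_1_nat[OF prime_card[where 'a='p]] by simp
  have "real CARD('p) powi (- int 1) \<le> real CARD('p) powi (- int 0)" using p1 by (intro power_int_increasing) auto
  then have sub: "?B 1 \<subseteq> ?B 0" by (intro Sigma_mono subset_cball) auto
  show "padic_circle \<in> sets (padic_haar \<Otimes>\<^sub>M (padic_haar :: 'p padic measure))"
    unfolding padic_circle_eq by (intro sets.Diff measure_padic_balls)
  have "emeasure (padic_haar \<Otimes>\<^sub>M padic_haar) (padic_circle :: ('p padic \<times> 'p padic) set)
      = emeasure (padic_haar \<Otimes>\<^sub>M padic_haar) (?B 0) - emeasure (padic_haar \<Otimes>\<^sub>M padic_haar) (?B 1)"
    unfolding padic_circle_eq
    by (rule emeasure_Diff[OF _ measure_padic_balls(1) measure_padic_balls(1) sub])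
      (simp only: measure_padic_balls(2), simp)
  also have "\<dots> = ennreal (1 - 1 / (real CARD('p))\<^sup>2)"
    unfolding measure_padic_balls(2) by (simp add: ennreal_minus[symmetric])
  finally show "emeasure (padic_haar \<Otimes>\<^sub>M padic_haar) (padic_circle :: ('p padic \<times> 'p padic) set)
      = ennreal (1 - 1 / (real CARD('p))\<^sup>2)" .
qed

text \<open>A point within 1/p of an integer has norm 1 exactly when \<open>p\<close> does not
  divide that integer, so the whole arc lies in the circle. The value is the reciprocal of the
  number of admissible residues modulo \<open>p^N\<close>.\<close>

lemma measure_padic_arc:
  fixes N :: nat and c :: "int \<times> int"
  assumes N: "N > 0" and c: "\<not> (int CARD('p::prime_card) dvd fst c \<and> int CARD('p) dvd snd c)"
  defines "A \<equiv> cball (of_int (fst c) :: 'p padic) (real CARD('p) powi (- int N))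
      \<times> cball (of_int (snd c)) (real CARD('p) powi (- int N))"
  shows "measure padic_circle_measure A = 1 / ((real CARD('p) ^ N)\<^sup>2 * (1 - 1 / (real CARD('p))\<^sup>2))"
proof -
  let ?M = "padic_haar \<Otimes>\<^sub>M (padic_haar :: 'p padic measure)"
  have p1: "real CARD('p) > 1" using prime_gt_1_nat[OF prime_card[where 'a='p]] by simp
  have e: "real CARD('p) powi (- int N) \<le> real CARD('p) powi (- int 1)"
    using N p1 by (intro power_int_increasing) auto
  have e1: "real CARD('p) powi (- int N) \<le> 1"
    using p1 power_int_increasing[of "- int N" 0 "real CARD('p)"] by simp
  have ball: "padic_norm x \<le> 1 \<and> (padic_norm x < 1 \<longleftrightarrow> int CARD('p) dvd k)"
    if x: "x \<in> cball (of_int k :: 'p padic) (real CARD('p) powi (- int N))" for x k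
  proof
    have d: "padic_norm (x - of_int k) \<le> real CARD('p) powi (- int N)" using x unfolding mem_cball_padic .
    then have d1: "padic_norm (x - of_int k) \<le> real CARD('p) powi (- int 1)" using e by linarith
    have "padic_norm (of_int k :: 'p padic) \<le> 1" using padic_norm_of_int_le_iff[of k 0, where 'p='p] by simp
    then show "padic_norm x \<le> 1" using padic_norm_add_le[of "x - of_int k" "of_int k"] d e1 by simp
    show "padic_norm x < 1 \<longleftrightarrow> int CARD('p) dvd k"
      using padic_norm_close_iff[OF d1, of 0] padic_norm_of_int_le_iff[of k 1, where 'p='p]
      by (simp only: padic_norm_less_1_iff diff_zero power_one_right)
  qed
  have "A \<subseteq> padic_circle"
  proof
    fix v assume "v \<in> A"
    then have "fst v \<in> cball (of_int (fst c)) (real CARD('p) powi (- int N))"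
      "snd v \<in> cball (of_int (snd c)) (real CARD('p) powi (- int N))" unfolding A_def by auto
    from ball[OF this(1)] ball[OF this(2)] c show "v \<in> padic_circle"
      unfolding padic_circle_def padic_vec_norm_def by (auto simp: max_def)
  qed
  then have int: "padic_circle \<inter> A = A" by blast
  have sq: "1 / (real CARD('p))\<^sup>2 < 1" using p1 by (simp add: one_less_power)
  have "measure padic_circle_measure A = measure ?M (padic_circle \<inter> A) / measure ?M padic_circle"
    unfolding padic_circle_measure_def
    by (rule measure_uniform_measure) (use sq measure_padic_balls(1) in \<open>auto simp: measure_padic_circle A_def\<close>)
  also have "\<dots> = 1 / (real CARD('p) ^ N)\<^sup>2 / (1 - 1 / (real CARD('p))\<^sup>2)"
    unfolding int using sq by (simp add: measure_def measure_padic_circle A_def measure_padic_balls(2))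
  finally show ?thesis by simp
qed

subsection \<open>Arcs of the unit circle\<close>

lemma circle_point_eq_iff: "circle_point s = circle_point t \<longleftrightarrow> (\<exists>n::int. s = t + 2 * pi * n)"
  unfolding circle_point_def using sin_cos_eq_iff[of s t] by auto

lemma circle_point_measurable: "circle_point \<in> borel_measurable borel"
proof -
  have "(\<lambda>t::real. (cos t, sin t)) \<in> borel_measurable borel"
    by (intro borel_measurable_continuous_onI continuous_intros)
  then show ?thesis by (simp add: circle_point_def[abs_def])
qed

text \<open>Images of Borel sets need not be Borel in general; here the image is a compact set minus
  a finite one, since only images of the two endpoints can be missing.\<close>

lemma circle_point_image_borel:
  assumes "{a<..<b} \<subseteq> I" "I \<subseteq> {a..b}"
  shows "circle_point ` I \<in> sets borel"
proof -
  have "continuous_on {a..b} circle_point"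
    unfolding circle_point_def[abs_def] by (intro continuous_intros)
  then have "compact (circle_point ` {a..b})" by (intro compact_continuous_image) auto
  then have "circle_point ` {a..b} \<in> sets borel" by (intro borel_closed compact_imp_closed)
  moreover have "finite (circle_point ` {a..b} - circle_point ` I)"
  proof (rule finite_subset)
    show "circle_point ` {a..b} - circle_point ` I \<subseteq> circle_point ` {a, b}"
    proof
      fix z assume "z \<in> circle_point ` {a..b} - circle_point ` I"
      then obtain t where t: "z = circle_point t" "t \<in> {a..b}" "t \<notin> I" by blast
      then have "t \<notin> {a<..<b}" using assms(1) by blast
      then have "t \<in> {a, b}" using t(2) by auto
      then show "z \<in> circle_point ` {a, b}" using t(1) by blast
    qed
  qed simp
  then have "circle_point ` {a..b} - circle_point ` I \<in> sets borel"
    by (intro borel_closed finite_imp_closed)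
  ultimately have "circle_point ` {a..b} - (circle_point ` {a..b} - circle_point ` I) \<in> sets borel" by (rule sets.Diff)
  moreover have "circle_point ` {a..b} - (circle_point ` {a..b} - circle_point ` I) = circle_point ` I"
    using assms(2) by blast
  ultimately show ?thesis by simp
qed

lemma measure_circle_arc:
  assumes ab: "a < b" "b \<le> a + 2 * pi" and I: "{a<..<b} \<subseteq> I" "I \<subseteq> {a..b}"
  shows "measure circle_measure (circle_point ` I) = (b - a) / (2 * pi)"
proof -
  define V where "V = {0..<2 * pi} \<inter> circle_point -` (circle_point ` I)"
  have B: "circle_point ` I \<in> sets borel" by (rule circle_point_image_borel[OF I])
  have pre: "circle_point -` (circle_point ` I) \<in> sets borel"
    using measurable_sets[OF circle_point_measurable B] by simp
  have "measure circle_measure (circle_point ` I)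
      = measure (uniform_measure lborel {0..<2 * pi}) (circle_point -` (circle_point ` I))"
    unfolding circle_measure_def using B circle_point_measurable
    by (subst measure_distr) (auto simp: measurable_cong_sets[OF sets_uniform_measure refl])
  also have "\<dots> = measure lborel V / measure lborel {0..<2 * pi}"
    unfolding V_def by (rule measure_uniform_measure) (use pre in auto)
  finally have 1: "measure circle_measure (circle_point ` I) = measure lborel V / (2 * pi)" by simp
  define k where "k = \<lfloor>a / (2 * pi)\<rfloor>"
  define a' b' where "a' = a - 2 * pi * k" and "b' = b - 2 * pi * k"
  have "of_int k \<le> a / (2 * pi)" "a / (2 * pi) < of_int k + 1" unfolding k_def by linarith+
  then have "of_int k * (2 * pi) \<le> a" "a < (of_int k + 1) * (2 * pi)"
    by (simp_all only: pos_le_divide_eq pos_divide_less_eq pi_gt_zero zero_less_mult_iff zero_less_numeral simp_thms)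
  then have a': "0 \<le> a'" "a' < 2 * pi" by (auto simp: a'_def algebra_simps)
  have b': "a' < b'" "b' \<le> a' + 2 * pi" "b' - a' = b - a" using ab by (auto simp: a'_def b'_def)
  \<comment> \<open>Seen from parameters in one turn, the arc is \<open>W1\<close> together with a
    wrapped remainder \<open>W2\<close>, empty unless the arc runs past 2 pi. Interval ends go into
    the finite null set \<open>F\<close>.\<close>
  define W1 W2 where "W1 = {a'<..<min b' (2 * pi)}" and "W2 = {0<..<b' - 2 * pi}"
  define F where "F = {0, a', b', a' - 2 * pi, b' - 2 * pi}"
  have iff: "t \<in> V \<longleftrightarrow> t \<in> W1 \<union> W2" if "t \<notin> F" for t
  proof
    assume t: "t \<in> V"
    then obtain s where s: "s \<in> I" "circle_point s = circle_point t" by (auto simp: V_def)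
    then obtain n :: int where n: "s = t + 2 * pi * n" unfolding circle_point_eq_iff by blast
    have t0: "0 \<le> t" "t < 2 * pi" using t by (auto simp: V_def)
    have s': "a' \<le> t + 2 * pi * (n - k)" "t + 2 * pi * (n - k) \<le> b'"
      using s I n by (auto simp: a'_def b'_def algebra_simps)
    \<comment> \<open>As \<open>t\<close> lies in [0, 2 pi) and the shifted arc in [0, 4 pi), the
      only possible winding numbers are 0 and 1.\<close>
    have "2 * pi * (n - k) > 2 * pi * (- 1)" using s' a' t0 by linarith
    then have "real_of_int (n - k) > - 1" by (subst (asm) mult_less_cancel_left_pos) auto
    moreover have "2 * pi * (n - k) < 2 * pi * 2" using s' b' a' t0 by linarith
    then have "real_of_int (n - k) < 2" by (subst (asm) mult_less_cancel_left_pos) auto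
    ultimately have "n - k = 0 \<or> n - k = 1" by linarith
    then show "t \<in> W1 \<union> W2" using s' t0 that a' b' by (elim disjE) (auto simp: W1_def W2_def F_def)
  next
    assume t: "t \<in> W1 \<union> W2"
    obtain n :: int where n: "a < t + 2 * pi * n" "t + 2 * pi * n < b"
    proof (cases "t \<in> W1")
      case True
      then show ?thesis using that[of k] by (auto simp: W1_def a'_def b'_def)
    next
      case False
      then show ?thesis using that[of "k + 1"] t a' b' by (auto simp: W2_def a'_def b'_def algebra_simps)
    qed
    have "circle_point (t + 2 * pi * n) \<in> circle_point ` I" using I(1) n by auto
    moreover have "circle_point (t + 2 * pi * n) = circle_point t" unfolding circle_point_eq_iff by blast
    ultimately show "t \<in> V" using t a' b' by (auto simp: V_def W1_def W2_def)
  qed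
  have "AE t in lborel. t \<notin> F"
    by (rule AE_not_in) (simp add: finite_imp_null_set_lborel F_def)
  then have "AE t in lborel. t \<in> V \<longleftrightarrow> t \<in> W1 \<union> W2" using iff by (auto elim: eventually_mono)
  then have "measure lborel V = measure lborel (W1 \<union> W2)"
    by (rule measure_eq_AE) (use pre in \<open>auto simp: V_def W1_def W2_def\<close>)
  also have "\<dots> = measure lborel W1 + measure lborel W2"
    by (rule measure_Union) (use b' emeasure_bounded_finite[of W1] emeasure_bounded_finite[of W2] in \<open>auto simp: W1_def W2_def\<close>)
  also have "\<dots> = b - a" using a' b' by (auto simp: W1_def W2_def min_def)
  finally show ?thesis using 1 by simp
qed

section \<open>Integer vectors with direction in an arc\<close>

lemma angular_cone_iff_circle_point:
  assumes "v \<noteq> (0, 0)"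
  shows "v \<in> angular_cone I \<longleftrightarrow> vec_of_int v /\<^sub>R vec_length v \<in> circle_point ` I"
proof
  assume "v \<in> angular_cone I"
  then obtain r t where rt: "r > 0" "t \<in> I" "real_of_int (fst v) = r * cos t" "real_of_int (snd v) = r * sin t"
    by (elim angular_coneE)
  have "(r * cos t)\<^sup>2 + (r * sin t)\<^sup>2 = r\<^sup>2 * ((cos t)\<^sup>2 + (sin t)\<^sup>2)"
    by (simp only: power_mult_distrib distrib_left)
  then have "vec_length v = r" using rt by (simp add: vec_length_eq)
  then have "vec_of_int v /\<^sub>R vec_length v = circle_point t"
    using rt by (simp add: vec_of_int_def circle_point_def)
  then show "vec_of_int v /\<^sub>R vec_length v \<in> circle_point ` I" using rt(2) by blast
next
  assume "vec_of_int v /\<^sub>R vec_length v \<in> circle_point ` I"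
  then obtain t where t: "t \<in> I" "vec_of_int v /\<^sub>R vec_length v = circle_point t" by blast
  have "(real_of_int (fst v))\<^sup>2 + (real_of_int (snd v))\<^sup>2 > 0"
    using assms by (auto simp: sum_power2_gt_zero_iff prod_eq_iff)
  then have pos: "vec_length v > 0" by (simp add: vec_length_eq)
  have "of_int (fst v) / vec_length v = cos t" "of_int (snd v) / vec_length v = sin t"
    using t(2) by (auto simp: vec_of_int_def circle_point_def divide_inverse mult.commute)
  then show "v \<in> angular_cone I" using pos t(1) by (intro angular_coneI[of "vec_length v" t]) (auto simp: field_simps)
qed

lemma angular_cone_full: "angular_cone {0..<2 * pi} = - {(0, 0)}"
proof (intro set_eqI iffI)
  fix v :: "int \<times> int" assume "v \<in> - {(0, 0)}"
  then have v: "v \<noteq> (0, 0)" by simp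
  define l where "l = vec_length v"
  have "(real_of_int (fst v))\<^sup>2 + (real_of_int (snd v))\<^sup>2 > 0"
    using v by (auto simp: sum_power2_gt_zero_iff prod_eq_iff)
  then have l: "l > 0" "l\<^sup>2 = (real_of_int (fst v))\<^sup>2 + (real_of_int (snd v))\<^sup>2" by (simp_all add: l_def vec_length_eq)
  have "(of_int (fst v) / l)\<^sup>2 + (of_int (snd v) / l)\<^sup>2 = 1"
    using l(1) by (simp add: power_divide add_divide_distrib[symmetric] l(2)[symmetric])
  then obtain t where t: "0 \<le> t" "t < 2 * pi" "of_int (fst v) / l = cos t" "of_int (snd v) / l = sin t"
    using sincos_total_2pi by metis
  then show "v \<in> angular_cone {0..<2 * pi}" using l(1) by (intro angular_coneI[of l t]) (auto simp: field_simps)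
qed (use vec_length_ge_1(2) in auto)

text \<open>A vanishing cross product and coprime coordinates make corresponding coordinates divide
  each other, so they agree up to sign; the positive radii fix the signs.\<close>

lemma primitive_ray_unique:
  assumes v: "v \<in> primitive_vectors" "v \<in> angular_cone {t}" and w: "w \<in> primitive_vectors" "w \<in> angular_cone {t}"
  shows "v = w"
proof -
  obtain r s where rs: "r > 0" "s > 0" "real_of_int (fst v) = r * cos t" "real_of_int (snd v) = r * sin t"
    "real_of_int (fst w) = s * cos t" "real_of_int (snd w) = s * sin t"
    using v(2) w(2) by (auto elim!: angular_coneE)
  have "real_of_int (fst v * snd w) = real_of_int (snd v * fst w)" using rs by simp
  then have cross: "fst v * snd w = snd v * fst w" by (simp only: of_int_eq_iff)
  have co: "coprime (fst v) (snd v)" "coprime (fst w) (snd w)"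
    using v(1) w(1) by (auto simp: primitive_vectors_def coprime_iff_gcd_eq_1)
  have "fst v dvd fst w" "fst w dvd fst v" "snd v dvd snd w" "snd w dvd snd v"
    using cross co by (metis coprime_commute coprime_dvd_mult_left_iff coprime_dvd_mult_right_iff dvd_triv_left dvd_triv_right)+
  then have abs: "\<bar>fst v\<bar> = \<bar>fst w\<bar>" "\<bar>snd v\<bar> = \<bar>snd w\<bar>" by (auto intro: zdvd_antisym_abs)
  have "fst v * fst w \<ge> 0" "snd v * snd w \<ge> 0"
  proof -
    have "real_of_int (fst v * fst w) = r * s * (cos t)\<^sup>2" "real_of_int (snd v * snd w) = r * s * (sin t)\<^sup>2"
      unfolding of_int_mult rs by (simp_all add: power2_eq_square)
    moreover have "0 \<le> r * s * (cos t)\<^sup>2" "0 \<le> r * s * (sin t)\<^sup>2" using rs(1,2) by auto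
    ultimately have "real_of_int (fst v * fst w) \<ge> 0" "real_of_int (snd v * snd w) \<ge> 0" by simp_all
    then show "fst v * fst w \<ge> 0" "snd v * snd w \<ge> 0" by (simp_all only: of_int_0_le_iff)
  qed
  then have "fst v = fst w" "snd v = snd w" using abs
    by (auto simp: abs_eq_iff zero_le_mult_iff)
  then show ?thesis by (simp add: prod_eq_iff)
qed

text \<open>Passing from \<open>I\<close> to the half-open interval affects only the rays at
  \<open>a\<close> and \<open>b\<close>, and a ray carries at most one primitive vector, whatever
  the radius.\<close>

lemma card_primitive_sector_endpoints:
  assumes "a < b" "{a<..<b} \<subseteq> I" "I \<subseteq> {a..b}"
  shows "\<bar>real (card (lattice_sector q c I \<rho> \<inter> primitive_vectors))
    - real (card (lattice_sector q c {a..<b} \<rho> \<inter> primitive_vectors))\<bar> \<le> 2"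
proof -
  let ?L = "\<lambda>J. lattice_sector q c J \<rho> \<inter> primitive_vectors"
  define E where "E = (angular_cone {a} \<union> angular_cone {b}) \<inter> primitive_vectors"
  have single: "finite (angular_cone {t} \<inter> primitive_vectors) \<and> card (angular_cone {t} \<inter> primitive_vectors) \<le> 1" for t
  proof -
    have "angular_cone {t} \<inter> primitive_vectors = {} \<or> (\<exists>v. angular_cone {t} \<inter> primitive_vectors = {v})"
      using primitive_ray_unique[of _ t] by blast
    then show ?thesis by (elim disjE exE) simp_all
  qed
  have E: "E = angular_cone {a} \<inter> primitive_vectors \<union> angular_cone {b} \<inter> primitive_vectors" unfolding E_def by blast
  have finE: "finite E" unfolding E using single by blast
  have "card E \<le> card (angular_cone {a} \<inter> primitive_vectors) + card (angular_cone {b} \<inter> primitive_vectors)"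
    unfolding E by (rule card_Un_le)
  then have cE: "card E \<le> 2" using single[of a] single[of b] by linarith
  have fin: "finite (?L J)" for J using finite_lattice_sector by blast
  have mono: "angular_cone J \<subseteq> angular_cone J' \<union> angular_cone {a} \<union> angular_cone {b}" if "J \<subseteq> J' \<union> {a, b}" for J J'
    using that by (fastforce elim!: angular_coneE intro: angular_coneI)
  have le: "card (?L J) \<le> card (?L J') + 2" if "J \<subseteq> J' \<union> {a, b}" for J J'
  proof -
    have "?L J \<subseteq> ?L J' \<union> E" using mono[OF that] by (auto simp: lattice_sector_def E_def)
    then have "card (?L J) \<le> card (?L J' \<union> E)" using fin finE by (intro card_mono) auto
    also have "\<dots> \<le> card (?L J') + card E" by (rule card_Un_le)
    finally show ?thesis using cE by linarith
  qed
  have "I \<subseteq> {a..<b} \<union> {a, b}" using assms by auto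
  moreover have "{a..<b} \<subseteq> I \<union> {a, b}"
  proof
    fix t assume "t \<in> {a..<b}"
    then show "t \<in> I \<union> {a, b}" using assms(2) by (cases "t = a") (auto simp: subset_iff)
  qed
  ultimately show ?thesis using le[of I "{a..<b}"] le[of "{a..<b}" I] by linarith
qed

subsection \<open>Equidistribution\<close>

text \<open>For \<open>q\<close> a positive power of \<open>p\<close> these represent the pairs
  modulo \<open>q\<close> whose gcd is prime to \<open>q\<close>, the only ones that primitive
  vectors can occupy.\<close>

definition admissible_residues :: "nat \<Rightarrow> nat \<Rightarrow> (int \<times> int) set" where
  "admissible_residues p q = {c. 0 \<le> fst c \<and> fst c < int q \<and> 0 \<le> snd c \<and> snd c < int q
     \<and> \<not> (int p dvd fst c \<and> int p dvd snd c)}"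

lemma finite_admissible_residues: "finite (admissible_residues p q)"
  by (rule finite_subset[of _ "{0..<int q} \<times> {0..<int q}"]) (auto simp: admissible_residues_def)

lemma card_admissible_residues:
  assumes p: "p > 0" and N: "N > 0"
  shows "real (card (admissible_residues p (p ^ N))) = (real p ^ N)\<^sup>2 * (1 - 1 / (real p)\<^sup>2)"
proof -
  obtain n where n: "N = Suc n" using N gr0_implies_Suc by blast
  \<comment> \<open>There are \<open>p ^ n\<close> multiples of \<open>p\<close> in the range, and
    the excluded pairs form the square of this set.\<close>
  define M where "M = {x. 0 \<le> x \<and> x < int (p ^ N) \<and> int p dvd x}"
  have "M = (\<lambda>j. int p * j) ` {0..<int (p ^ n)}"
  proof (intro set_eqI iffI)
    fix x assume "x \<in> M"
    then obtain j where "x = int p * j" "0 \<le> int p * j" "int p * j < int p * int (p ^ n)"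
      by (auto simp: M_def n)
    then show "x \<in> (\<lambda>j. int p * j) ` {0..<int (p ^ n)}"
      using p by (auto simp: zero_le_mult_iff mult_less_cancel_left_pos)
  qed (use p in \<open>auto simp: M_def n\<close>)
  moreover have "inj_on (\<lambda>j. int p * j) {0..<int (p ^ n)}" using p by (auto simp: inj_on_def)
  ultimately have M: "card M = p ^ n" "finite M" by (auto simp: card_image simp del: of_nat_power)
  have eq: "admissible_residues p (p ^ N) = {0..<int (p ^ N)} \<times> {0..<int (p ^ N)} - M \<times> M"
    by (auto simp: admissible_residues_def M_def)
  have sub: "M \<times> M \<subseteq> {0..<int (p ^ N)} \<times> {0..<int (p ^ N)}" by (auto simp: M_def)
  have "card (admissible_residues p (p ^ N)) = p ^ N * p ^ N - p ^ n * p ^ n"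
    unfolding eq using M sub by (subst card_Diff_subset) (auto simp: card_cartesian_product simp del: of_nat_power)
  moreover have "p ^ n * p ^ n \<le> p ^ N * p ^ N" using p n by (intro mult_mono power_increasing) auto
  ultimately have "real (card (admissible_residues p (p ^ N))) = real (p ^ N * p ^ N) - real (p ^ n * p ^ n)"
    by (simp only: of_nat_diff)
  also have "\<dots> = (real p ^ N)\<^sup>2 * (1 - 1 / (real p)\<^sup>2)"
    using p by (simp add: n power2_eq_square field_simps)
  finally show ?thesis .
qed

lemma coprime_gcd_prime_power_iff:
  assumes "prime p" "N > 0"
  shows "coprime (gcd (fst c) (snd c)) (int (p ^ N)) \<longleftrightarrow> \<not> (int p dvd fst c \<and> int p dvd snd c)"
proof -
  have "coprime (gcd (fst c) (snd c)) (int (p ^ N)) \<longleftrightarrow> coprime (int p) (gcd (fst c) (snd c))"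
    using assms by (simp add: coprime_commute)
  also have "\<dots> \<longleftrightarrow> \<not> int p dvd gcd (fst c) (snd c)"
  proof
    assume "coprime (int p) (gcd (fst c) (snd c))"
    then show "\<not> int p dvd gcd (fst c) (snd c)"
      using assms(1) by (metis coprime_absorb_left not_prime_unit prime_nat_int_transfer)
  qed (use assms(1) in \<open>intro prime_imp_coprime; simp\<close>)
  finally show ?thesis by simp
qed

text \<open>A primitive vector reduces to exactly one admissible pair, and a full turn of angles
  covers every nonzero vector.\<close>

lemma card_primitive_vectors_eq:
  assumes p: "prime p" and N: "N > 0"
  shows "card {v \<in> primitive_vectors. vec_length v \<le> \<rho>}
    = (\<Sum>c\<in>admissible_residues p (p ^ N). card (lattice_sector (p ^ N) c {0..<2 * pi} \<rho> \<inter> primitive_vectors))"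
proof -
  let ?q = "p ^ N"
  have q: "int ?q > 0" using prime_gt_0_nat[OF p] by simp
  let ?L = "\<lambda>c. lattice_sector ?q c {0..<2 * pi} \<rho> \<inter> primitive_vectors"
  have "{v \<in> primitive_vectors. vec_length v \<le> \<rho>} = (\<Union>c\<in>admissible_residues p ?q. ?L c)"
  proof (intro set_eqI iffI)
    fix v assume v: "v \<in> {v \<in> primitive_vectors. vec_length v \<le> \<rho>}"
    define c where "c = (fst v mod int ?q, snd v mod int ?q)"
    have pq: "int p dvd int ?q" using N by simp
    have "\<not> int p dvd gcd (fst v) (snd v)" using v prime_gt_1_nat[OF p] by (auto simp: primitive_vectors_def)
    then have "\<not> (int p dvd fst v \<and> int p dvd snd v)" by simp
    then have "\<not> (int p dvd fst c \<and> int p dvd snd c)" unfolding c_def using pq by (simp only: fst_conv snd_conv dvd_mod_iff) simp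
    then have "c \<in> admissible_residues p ?q" using q by (simp add: admissible_residues_def c_def del: of_nat_power)
    moreover have "v \<noteq> (0, 0)" using v by (auto simp: primitive_vectors_def)
    then have "v \<in> ?L c" using v by (simp add: lattice_sector_def angular_cone_full c_def)
    ultimately show "v \<in> (\<Union>c\<in>admissible_residues p ?q. ?L c)" by blast
  qed (auto simp: lattice_sector_def)
  also have "card \<dots> = (\<Sum>c\<in>admissible_residues p ?q. card (?L c))"
  proof (rule card_UN_disjoint[OF finite_admissible_residues])
    show "\<forall>c\<in>admissible_residues p ?q. finite (?L c)" using finite_lattice_sector by blast
    have "c = (fst v mod int ?q, snd v mod int ?q)" if "c \<in> admissible_residues p ?q" "v \<in> ?L c" for c v
      using that by (auto simp: admissible_residues_def lattice_sector_def cong_def prod_eq_iff simp del: of_nat_power)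
    then show "\<forall>c\<in>admissible_residues p ?q. \<forall>d\<in>admissible_residues p ?q. c \<noteq> d \<longrightarrow> ?L c \<inter> ?L d = {}"
      by (metis (no_types, lifting) disjoint_iff)
  qed
  finally show ?thesis .
qed

section \<open>The quotient of the two counts\<close>

text \<open>Over the common denominator \<open>\<beta> * B R\<close> the quadratic terms cancel,
  leaving order \<open>R powr (3/2)\<close> against order \<open>R^2\<close>.\<close>

lemma ratio_asymptotic:
  fixes A B :: "real \<Rightarrow> real"
  assumes A: "\<And>R. R \<ge> 1 \<Longrightarrow> \<bar>A R - \<alpha> * R\<^sup>2\<bar> \<le> C * R powr (3/2)"
    and B: "\<And>R. R \<ge> 1 \<Longrightarrow> \<bar>B R - \<beta> * R\<^sup>2\<bar> \<le> D * R powr (3/2)" and \<beta>: "\<beta> > 0"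
  shows "(\<lambda>R. A R / B R - \<alpha> / \<beta>) \<in> O[at_top](\<lambda>R. R powr (- (1/2)))"
proof (rule landau_o.bigI)
  define K where "K = 2 * (\<beta> * \<bar>C\<bar> + \<bar>\<alpha>\<bar> * \<bar>D\<bar>) / \<beta>\<^sup>2"
  \<comment> \<open>\<open>K\<close> may be 0, whereas a big-O constant must be positive.\<close>
  show "K + 1 > 0" using \<beta> by (simp add: K_def add_nonneg_pos)
  show "\<forall>\<^sub>F R in at_top. norm (A R / B R - \<alpha> / \<beta>) \<le> (K + 1) * norm (R powr (- (1/2)))"
    \<comment> \<open>Beyond this threshold \<open>\<bar>D\<bar> * R powr (3/2)\<close> is at most
      \<open>\<beta> * R^2 / 2\<close>, so \<open>B R\<close> keeps at least half of its main
      term.\<close>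
    using eventually_ge_at_top[of "max 1 ((2 * \<bar>D\<bar> / \<beta>)\<^sup>2)"]
  proof eventually_elim
    case (elim R)
    then have R: "R \<ge> 1" "(2 * \<bar>D\<bar> / \<beta>)\<^sup>2 \<le> R" by auto
    have pw: "R powr (3/2) = R * sqrt R" "R\<^sup>2 = R * sqrt R * sqrt R" "R powr (- (1/2)) = 1 / sqrt R"
      using R powr_add[of R 1 "1/2"] by (simp_all add: powr_half_sqrt powr_minus_divide power2_eq_square)
    define P where "P = R * sqrt R"
    have P: "P > 0" "sqrt R \<ge> 1" using R by (auto simp: P_def)
    have "2 * \<bar>D\<bar> / \<beta> \<le> sqrt R" using R \<beta> by (intro real_le_rsqrt)
    then have "2 * \<bar>D\<bar> \<le> \<beta> * sqrt R" using \<beta> by (simp add: field_simps)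
    then have "\<bar>D\<bar> * P \<le> \<beta> * sqrt R / 2 * P" using P by (intro mult_right_mono) auto
    moreover have "D * P \<le> \<bar>D\<bar> * P" using P by (intro mult_right_mono) auto
    moreover have BR: "\<bar>B R - \<beta> * (P * sqrt R)\<bar> \<le> D * P" using B[OF R(1)] unfolding pw P_def .
    ultimately have Blow: "B R \<ge> \<beta> * (P * sqrt R) / 2" by (simp add: algebra_simps abs_le_iff)
    have lowpos: "\<beta> * (P * sqrt R) / 2 > 0" using \<beta> P by simp
    then have Bpos: "B R > 0" using Blow by linarith
    have AR: "\<bar>A R - \<alpha> * (P * sqrt R)\<bar> \<le> C * P" using A[OF R(1)] unfolding pw P_def .
    have "\<beta> * A R - \<alpha> * B R = \<beta> * (A R - \<alpha> * (P * sqrt R)) - \<alpha> * (B R - \<beta> * (P * sqrt R))" by (simp add: algebra_simps)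
    also have "\<bar>\<dots>\<bar> \<le> \<beta> * \<bar>A R - \<alpha> * (P * sqrt R)\<bar> + \<bar>\<alpha>\<bar> * \<bar>B R - \<beta> * (P * sqrt R)\<bar>"
      using \<beta> by (intro order_trans[OF abs_triangle_ineq4]) (simp add: abs_mult)
    also have "\<dots> \<le> \<beta> * (\<bar>C\<bar> * P) + \<bar>\<alpha>\<bar> * (\<bar>D\<bar> * P)"
    proof (intro add_mono mult_left_mono)
      show "\<bar>A R - \<alpha> * (P * sqrt R)\<bar> \<le> \<bar>C\<bar> * P" using AR P by (intro order_trans[OF AR] mult_right_mono) auto
      show "\<bar>B R - \<beta> * (P * sqrt R)\<bar> \<le> \<bar>D\<bar> * P" using BR P by (intro order_trans[OF BR] mult_right_mono) auto
    qed (use \<beta> in auto)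
    finally have num: "\<bar>\<beta> * A R - \<alpha> * B R\<bar> \<le> (\<beta> * \<bar>C\<bar> + \<bar>\<alpha>\<bar> * \<bar>D\<bar>) * P" by (simp add: algebra_simps)
    have "norm (A R / B R - \<alpha> / \<beta>) = \<bar>\<beta> * A R - \<alpha> * B R\<bar> / (\<beta> * B R)"
    proof -
      have "A R / B R - \<alpha> / \<beta> = (\<beta> * A R - \<alpha> * B R) / (\<beta> * B R)" using \<beta> Bpos by (simp add: field_simps)
      then show ?thesis using \<beta> Bpos by (simp add: abs_divide abs_mult)
    qed
    also have "\<dots> \<le> (\<beta> * \<bar>C\<bar> + \<bar>\<alpha>\<bar> * \<bar>D\<bar>) * P / (\<beta> * (\<beta> * (P * sqrt R) / 2))"
      using num Blow lowpos \<beta> by (intro frac_le mult_left_mono mult_pos_pos) (auto intro: order_trans[OF abs_ge_zero])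
    also have "\<dots> = K * (1 / sqrt R)" using \<beta> P by (simp add: K_def power2_eq_square field_simps)
    also have "\<dots> \<le> (K + 1) * (1 / sqrt R)" using P by (intro mult_right_mono) auto
    finally show ?case using P(2) by (simp add: pw(3))
  qed
qed

lemma direction_ratio_asymptotic:
  fixes \<Theta> :: "(real \<times> real) set"
    and \<Theta>p :: "('p::prime_card padic \<times> 'p padic) set"
  assumes "circle_arc \<Theta>" and "padic_arc \<Theta>p"
  shows "(\<lambda>R. direction_ratio \<Theta> \<Theta>p R - measure circle_measure \<Theta> * measure padic_circle_measure \<Theta>p)
    \<in> O[at_top](\<lambda>R. R powr (- (1/2)))"
proof -
  define p where "p = CARD('p)"
  have p: "prime p" unfolding p_def by (rule prime_card)
  obtain a b I where ab: "a < b" "b \<le> a + 2 * pi" and I: "{a<..<b} \<subseteq> I" "I \<subseteq> {a..b}"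
    and \<Theta>: "\<Theta> = circle_point ` I"
    using assms(1) unfolding circle_arc_def by blast
  obtain N c where N: "N > 0" and c: "\<not> (int p dvd fst c \<and> int p dvd snd c)"
    and \<Theta>p: "\<Theta>p = cball (of_int (fst c)) (real CARD('p) powi (- int N)) \<times> cball (of_int (snd c)) (real CARD('p) powi (- int N))"
    using padic_arc_eq_residue_class[OF assms(2)] unfolding p_def by blast
  define q where "q = p ^ N"
  have q: "q > 0" using prime_gt_0_nat[OF p] by (simp add: q_def)
  define A where "A R = real (card {v \<in> primitive_vectors.
       (vec_of_int v /\<^sub>R vec_length v, vec_of_int v) \<in> \<Theta> \<times> \<Theta>p \<and> vec_length v \<le> R})" for R
  define B where "B R = real (card {v \<in> primitive_vectors. vec_length v \<le> R})" for R
  define S where "S = coprime_density q"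
  have S: "S > 0" unfolding S_def by (rule coprime_density_pos)
  define n where "n = real (card (admissible_residues p q))"
  have p2: "1 / (real p)\<^sup>2 < 1" using prime_gt_1_nat[OF p] by (simp add: one_less_power)
  have n: "n = (real p ^ N)\<^sup>2 * (1 - 1 / (real p)\<^sup>2)"
    unfolding n_def q_def using prime_gt_0_nat[OF p] N by (rule card_admissible_residues)
  have n0: "n > 0" unfolding n using p2 prime_gt_0_nat[OF p] by simp
  define \<alpha> where "\<alpha> = (b - a) / (2 * (real q)\<^sup>2) * S"
  \<comment> \<open>The full-turn analogue of \<open>\<alpha>\<close>; each of the \<open>n\<close>
    classes contributes this coefficient to the denominator.\<close>
  define \<gamma> where "\<gamma> = (2 * pi - 0) / (2 * (real q)\<^sup>2) * S"
  have cop: "coprime (gcd (fst d) (snd d)) (int q) \<longleftrightarrow> \<not> (int p dvd fst d \<and> int p dvd snd d)" for d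
    unfolding q_def by (rule coprime_gcd_prime_power_iff[OF p N])
  have "A R = real (card (lattice_sector q c I R \<inter> primitive_vectors))" for R
  proof -
    have 1: "v \<noteq> (0, 0)" if "v \<in> primitive_vectors" for v using that by (auto simp: primitive_vectors_def)
    have "{v \<in> primitive_vectors. (vec_of_int v /\<^sub>R vec_length v, vec_of_int v) \<in> \<Theta> \<times> \<Theta>p \<and> vec_length v \<le> R}
      = lattice_sector q c I R \<inter> primitive_vectors"
      unfolding \<Theta> \<Theta>p lattice_sector_def q_def p_def
      using 1 by (auto simp: angular_cone_iff_circle_point vec_of_int_def[where 'a = "'p padic"] of_int_mem_padic_cball_iff
          simp del: mem_cball of_nat_power)
    then show ?thesis by (simp add: A_def)
  qed
  then have A2: "\<bar>A R - card (lattice_sector q c {a..<b} R \<inter> primitive_vectors)\<bar> \<le> 2" for R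
    using card_primitive_sector_endpoints[OF ab(1) I] by simp
  obtain C where C: "C \<ge> 0" "\<And>d \<rho>. coprime (gcd (fst d) (snd d)) (int q) \<Longrightarrow> \<rho> > 0 \<Longrightarrow>
    \<bar>card (lattice_sector q d {a..<b} \<rho> \<inter> primitive_vectors) - \<alpha> * \<rho>\<^sup>2\<bar> \<le> C * \<rho> powr (3/2)"
    using primitive_sector_asymptotic[OF q less_imp_le[OF ab(1)] ab(2)] unfolding \<alpha>_def S_def by blast
  \<comment> \<open>The two endpoint vectors are absorbed into the error because
    \<open>R powr (3/2)\<close> is at least 1.\<close>
  have A: "\<bar>A R - \<alpha> * R\<^sup>2\<bar> \<le> (C + 2) * R powr (3/2)" if "R \<ge> 1" for R
  proof -
    have "\<bar>card (lattice_sector q c {a..<b} R \<inter> primitive_vectors) - \<alpha> * R\<^sup>2\<bar> \<le> C * R powr (3/2)"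
      using c that by (intro C(2)) (auto simp: cop)
    moreover have "R powr (3/2) \<ge> 1" using that by (intro ge_one_powr_ge_zero) auto
    ultimately show ?thesis using A2[of R] unfolding distrib_right by linarith
  qed
  obtain D where D: "D \<ge> 0" "\<And>d \<rho>. coprime (gcd (fst d) (snd d)) (int q) \<Longrightarrow> \<rho> > 0 \<Longrightarrow>
    \<bar>card (lattice_sector q d {0..<2 * pi} \<rho> \<inter> primitive_vectors) - \<gamma> * \<rho>\<^sup>2\<bar> \<le> D * \<rho> powr (3/2)"
    using primitive_sector_asymptotic[OF q, of 0 "2 * pi"] unfolding \<gamma>_def S_def by auto
  have B: "\<bar>B R - (n * \<gamma>) * R\<^sup>2\<bar> \<le> (n * D) * R powr (3/2)" if "R \<ge> 1" for R
  proof -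
    let ?K = "admissible_residues p q"
    have "B R = (\<Sum>d\<in>?K. real (card (lattice_sector q d {0..<2 * pi} R \<inter> primitive_vectors)))"
      unfolding B_def q_def card_primitive_vectors_eq[OF p N] by simp
    then have "B R - (n * \<gamma>) * R\<^sup>2 = (\<Sum>d\<in>?K. real (card (lattice_sector q d {0..<2 * pi} R \<inter> primitive_vectors)) - \<gamma> * R\<^sup>2)"
      by (simp add: sum_subtractf n_def)
    also have "\<bar>\<dots>\<bar> \<le> (\<Sum>d\<in>?K. D * R powr (3/2))"
      using that by (intro order_trans[OF sum_abs] sum_mono D(2)) (auto simp: cop admissible_residues_def)
    also have "\<dots> = (n * D) * R powr (3/2)" by (simp add: n_def)
    finally show ?thesis .
  qed
  have "n * \<gamma> > 0" using n0 S q by (simp add: \<gamma>_def)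
  from ratio_asymptotic[OF A B this]
  have "(\<lambda>R. A R / B R - \<alpha> / (n * \<gamma>)) \<in> O[at_top](\<lambda>R. R powr (- (1/2)))" .
  \<comment> \<open>\<open>S\<close> and \<open>2 * q^2\<close> cancel, leaving the angular fraction
    \<open>(b - a) / (2 * pi)\<close> divided by the number of classes.\<close>
  moreover have "\<alpha> / (n * \<gamma>) = measure circle_measure \<Theta> * measure padic_circle_measure \<Theta>p"
  proof -
    have padic: "measure padic_circle_measure \<Theta>p = 1 / n"
      unfolding \<Theta>p n p_def using N c unfolding p_def by (rule measure_padic_arc)
    have arc: "measure circle_measure \<Theta> = (b - a) / (2 * pi)"
      unfolding \<Theta> by (rule measure_circle_arc[OF ab I])
    show ?thesis unfolding padic arc \<alpha>_def \<gamma>_def using S q n0 by (simp add: field_simps)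
  qed
  moreover have "direction_ratio \<Theta> \<Theta>p = (\<lambda>R. A R / B R)"
    by (simp add: direction_ratio_def A_def B_def fun_eq_iff)
  ultimately show ?thesis by simp
qed

theorem theorem1:
  fixes \<Theta> :: "(real \<times> real) set"
    and \<Theta>p :: "('p::prime_card padic \<times> 'p padic) set"
  assumes "circle_arc \<Theta>" and "padic_arc \<Theta>p"
  shows "(direction_ratio \<Theta> \<Theta>p
        \<longlongrightarrow> measure circle_measure \<Theta> * measure padic_circle_measure \<Theta>p) at_top
    \<and> (\<forall>\<delta>>0. (\<lambda>R. \<bar>direction_ratio \<Theta> \<Theta>p R
          - measure circle_measure \<Theta> * measure padic_circle_measure \<Theta>p\<bar>)
        \<in> O[at_top](\<lambda>R. R powr (- 2 * (1 / 28) + \<delta>)))"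
proof (intro conjI allI impI)
  let ?m = "measure circle_measure \<Theta> * measure padic_circle_measure \<Theta>p"
  note big = direction_ratio_asymptotic[OF assms]
  have "((\<lambda>R::real. R powr (- (1/2))) \<longlongrightarrow> 0) at_top"
    by (rule tendsto_neg_powr) (auto intro: filterlim_ident)
  then have "(\<lambda>R::real. R powr (- (1/2))) \<in> o[at_top](\<lambda>_. 1)" by (intro smalloI_tendsto) auto
  from smalloD_tendsto[OF landau_o.big_small_trans[OF big this]]
  have "((\<lambda>R. direction_ratio \<Theta> \<Theta>p R - ?m) \<longlongrightarrow> 0) at_top" by simp
  then show "(direction_ratio \<Theta> \<Theta>p \<longlongrightarrow> ?m) at_top" by (simp add: LIM_zero_iff)
  fix \<delta> :: real assume "\<delta> > 0"
  \<comment> \<open>The exponent -1/2 lies below -1/14, hence below -1/14 +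
    \<open>\<delta>\<close>.\<close>
  then have "(\<lambda>R::real. R powr (- (1/2))) \<in> O[at_top](\<lambda>R. R powr (- 2 * (1 / 28) + \<delta>))"
    by (intro landau_o.bigI[of 1] eventually_mono[OF eventually_ge_at_top[of 1]]) (auto intro!: powr_mono)
  from landau_o.big_trans[OF big this]
  show "(\<lambda>R. \<bar>direction_ratio \<Theta> \<Theta>p R - ?m\<bar>) \<in> O[at_top](\<lambda>R. R powr (- 2 * (1 / 28) + \<delta>))"
    by (simp add: landau_o.big.abs_in_iff)
qed

end
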